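(* There exist surjective maps $S_1^{\,i}$, $i\in\{0,1\}$, from the class $\mathcal I$ of $\infty$-homotopies for 2-term Leibniz infinity algebras to the class $\mathcal T$ of 2-term $\infty$-homotopies for 2-term Leibniz infinity algebras.
   Context: Work over a field $\mathbb K$ of characteristic zero, with homological grading; $s$ is the suspension. **2-term Leibniz infinity algebra**: $V=V_0\oplus V_1$ with linear, bilinear, trilinear maps $l_1,l_2,l_3$ of degrees $-1,0,1$ such that for $w,x,y,z\in V_0$, $h,k\in V_1$: (a) $l_1l_2(x,h)=l_2(x,l_1h)$, $l_1l_2(h,x)=l_2(l_1h,x)$; (b) $l_2(l_1h,k)=l_2(h,l_1k)$; (c) $l_1l_3(x,y,z)=l_2(x,l_2(y,z))-l_2(y,l_2(x,z))-l_2(l_2(x,y),z)$; (d) $l_3(x,y,l_1h)=l_2(x,l_2(y,h))-l_2(y,l_2(x,h))-l_2(l_2(x,y),h)$, $l_3(x,l_1h,y)=l_2(x,l_2(h,y))-l_2(h,l_2(x,y))-l_2(l_2(x,h),y)$, $l_3(l_1h,x,y)=l_2(h,l_2(x,y))-l_2(x,l_2(h,y))-l_2(l_2(h,x),y)$; (e) $l_2(l_3(w,x,y),z)+l_2(w,l_3(x,y,z))-l_2(x,l_3(w,y,z))+l_2(y,l_3(w,x,z))-l_3(l_2(w,x),y,z)+l_3(w,l_2(x,y),z)-l_3(x,l_2(w,y),z)-l_3(w,x,l_2(y,z))+l_3(w,y,l_2(x,z))-l_3(x,y,l_2(w,z))=0$. **Infinity morphism** $f=(f_1,f_2):(V,l_\bullet)\to(W,m_\bullet)$: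 linear $f_1$ and bilinear $f_2$ from $V$ to $W$ of degrees $0,1$ with, for $x,y,z\in V_0$, $h\in V_1$: $m_1f_1h=f_1l_1h$; $m_2(f_1x,f_1y)+m_1f_2(x,y)=f_1l_2(x,y)$; $m_2(f_1x,f_1h)=f_1l_2(x,h)-f_2(x,l_1h)$; $m_2(f_1h,f_1x)=f_1l_2(h,x)-f_2(l_1h,x)$; $m_3(f_1x,f_1y,f_1z)-m_2(f_2(x,y),f_1z)+m_2(f_1x,f_2(y,z))-m_2(f_1y,f_2(x,z))=f_1l_3(x,y,z)+f_2(l_2(x,y),z)-f_2(x,l_2(y,z))+f_2(y,l_2(x,z))$. **2-term $\infty$-homotopy** $\theta_1:f\Rightarrow g$ between infinity morphisms $f,g:V\to W$: a linear map $\theta_1:V\to W$ of degree $1$ with, for $x,y\in V_0$, $h\in V_1$: $g_1x-f_1x=m_1\theta_1x$; $g_1h-f_1h=\theta_1l_1h$; $g_2(x,y)-f_2(x,y)=\theta_1l_2(x,y)-m_2(f_1x,\theta_1y)-m_2(\theta_1x,g_1y)$. $\mathcal T$ is the class of all of these (for all $V,W,f,g$). **$\infty$-homotopy.** Let $\mathrm{Zin}^c(sV)=\bigoplus_{n\ge1}(sV)^{\otimes n}$ with coproduct $\Delta(v_1\dots v_p)=\sum_{k=1}^{p-1}\sum_{\sigma\in\mathrm{Sh}(k,p-k-1)}\varepsilon(\sigma)(v_{\sigma(1)}\dots v_{\sigma(k)})\otimes(v_{\sigma(k+1)}\dots v_{\sigma(p-1)}v_p)$ ($\varepsilon(\sigma)$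 the Koszul sign), and let $D$ be the coderivation with corestrictions $D_i$, $l_i=s^{-1}D_is^{\otimes i}$. The space $L=L(V,W)=\mathrm{Hom}_{\mathbb K}(\mathrm{Zin}^c(sV),W)$ carries the convolution Lie infinity structure $\mathcal L_1f=m_1f+(-1)^{f}fD$ and, for $p\ge2$, $\mathcal L_p(f_1,\dots,f_p)=m_p\circ\big(\sum_{\sigma\in S(p)}\varepsilon(\sigma)\mathrm{sign}(\sigma)f_{\sigma(1)}\otimes\dots\otimes f_{\sigma(p)}\big)\circ\Delta^{p-1}$, with $\Delta^{p-1}=(\Delta\otimes\mathrm{id}^{\otimes(p-2)})\cdots(\Delta\otimes\mathrm{id})\Delta$. The Maurer-Cartan set of a Lie infinity algebra $(\mathfrak g,\ell_i)$ is $\mathrm{MC}(\mathfrak g)=\{\alpha\in\mathfrak g_{-1}:\sum_{i\ge1}\frac1{i!}(-1)^{i(i-1)/2}\ell_i(\alpha,\dots,\alpha)=0\}$. Infinity morphisms $f:V\to W$ are identified with elements of $\mathrm{MC}(L)$ (the components $\alpha^p:(sV)^{\otimes p}\to W$ of $\alpha$ being related to $f$ by $f_p=\alpha^ps^{\otimes p}$). Let $\Omega^\star_1$ be the commutative differential graded algebra of polynomial differential forms (coefficients in $\mathbb K$) on the 1-simplex $\Delta^1$, with forms in nonpositive degrees ($dt$ of degree $-1$). $\bar L=L\otimes\Omega_1^\star$ has the Lie infinity structure obtained by extension of scalars: $\bar{\mathcal L}_1=\mathcal L_1\otimes\mathrm{id}+\mathrm{id}\otimes d$ and $\bar{\mathcal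 L}_i(v_1\otimes a_1,\dots,v_i\otimes a_i)=\pm\mathcal L_i(v_1,\dots,v_i)\otimes(a_1\cdots a_i)$ (Koszul sign) for $i\ge2$. An $\infty$-homotopy from $f$ to $g$ is an element $\alpha\in\mathrm{MC}_1(\bar L)=\mathrm{MC}(L\otimes\Omega_1^\star)$ whose evaluations at the vertices $0$ and $1$ are the Maurer-Cartan elements $f$ and $g$. $\mathcal I$ is the class of all $\infty$-homotopies between infinity morphisms of 2-term Leibniz infinity algebras. *)

theory Defs
  imports
    "HOL-Library.Function_Algebras"
    "HOL-Library.Product_Plus"
    "HOL-Library.Poly_Mapping"
    "HOL-Computational_Algebra.Polynomial"
    "HOL-Combinatorics.Permutations"
begin

section \<open>Signs and formal linear combinations\<close>

text \<open>\<^term>\<open>psgn d\<close> is $(-1)^d$, for an integer $d$ of either sign.\<close>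

definition psgn :: "int \<Rightarrow> 'k::ring_1"
  where "psgn d = (if even d then 1 else - 1)"

text \<open>A finite formal \<open>'k\<close>-linear combination of objects of type \<open>'b\<close> is an element of
  \<open>'b \<Rightarrow>\<^sub>0 'k\<close>. A map defined on the objects, with values in a vector space with scaling
  \<open>sc\<close>, extends linearly.\<close>

definition lin_ext :: "('k::zero \<Rightarrow> 'm \<Rightarrow> 'm) \<Rightarrow> ('b \<Rightarrow> 'm::comm_monoid_add) \<Rightarrow> ('b \<Rightarrow>\<^sub>0 'k) \<Rightarrow> 'm"
  where "lin_ext sc F p = (\<Sum>b\<in>Poly_Mapping.keys p. sc (Poly_Mapping.lookup p b) (F b))"

definition fscale :: "'k::semiring_0 \<Rightarrow> ('b \<Rightarrow>\<^sub>0 'k) \<Rightarrow> ('b \<Rightarrow>\<^sub>0 'k)"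
  where "fscale c p = Poly_Mapping.map ((*) c) p"


section \<open>The Zinbiel coalgebra and its coderivations\<close>

text \<open>Tensors are handled through words of homogeneous letters; \<open>dg\<close> gives the degree of a
  letter.\<close>

definition word_deg :: "('a \<Rightarrow> int) \<Rightarrow> 'a list \<Rightarrow> int"
  where "word_deg dg w = sum_list (map dg w)"

text \<open>A shuffle $\sigma\in\mathrm{Sh}(k,n-k)$ is the same thing as the $k$-element set
  $S=\{\sigma(1),\dots,\sigma(k)\}$ of positions; it brings the letters at the positions in \<open>S\<close>
  to the front and keeps the order inside the two groups. Its Koszul sign therefore collects
  the pairs \<open>i < j\<close> of positions with \<open>j\<close> in \<open>S\<close> and \<open>i\<close> not.\<close>

definition shuffle_sign :: "('a \<Rightarrow> int) \<Rightarrow> 'a list \<Rightarrow> nat set \<Rightarrow> 'k::comm_ring_1"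
  where "shuffle_sign dg w S =
    (\<Prod>(i, j)\<in>{(i, j). i < j \<and> j < length w \<and> i \<notin> S \<and> j \<in> S}. psgn (dg (w ! i) * dg (w ! j)))"

text \<open>The last letter, at position \<open>length w - 1\<close>, always stays at the end of the right
  factor; all \<open>k\<close> from \<open>1\<close> to \<open>length w - 1\<close> occur.\<close>

definition zin_coprod :: "('a \<Rightarrow> int) \<Rightarrow> 'a list \<Rightarrow> (('a list \<times> 'a list) \<Rightarrow>\<^sub>0 'k::comm_ring_1)"
  where "zin_coprod dg w =
    (\<Sum>S\<in>Pow {..<length w - 1} - {{}}.
       Poly_Mapping.single (nths w S, nths w (- S)) (shuffle_sign dg w S))"

text \<open>\<open>zin_coprod_iter dg n\<close> is $\Delta^n=(\Delta\otimes\mathrm{id}^{\otimes(n-1)})\cdots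
  (\Delta\otimes\mathrm{id})\Delta$; a basis element of the \<open>(n+1)\<close>-fold tensor power is a list
  of \<open>n + 1\<close> words.\<close>

fun zin_coprod_iter :: "('a \<Rightarrow> int) \<Rightarrow> nat \<Rightarrow> 'a list \<Rightarrow> ('a list list \<Rightarrow>\<^sub>0 'k::comm_ring_1)"
  where
    "zin_coprod_iter dg 0 w = Poly_Mapping.single [w] 1"
  | "zin_coprod_iter dg (Suc n) w =
       lin_ext fscale
         (\<lambda>us. lin_ext fscale (\<lambda>(a, b). Poly_Mapping.single (a # b # tl us) 1)
                 (zin_coprod dg (hd us)))
         (zin_coprod_iter dg n w)"

text \<open>A coderivation \<open>D\<close> of degree $-1$ with corestrictions \<open>c\<close>: it satisfies
  $\Delta D=(D\otimes\mathrm{id}+\mathrm{id}\otimes D)\Delta$, where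
  $(\mathrm{id}\otimes D)(u\otimes v)=(-1)^{|u|}u\otimes Dv$, and the component of \<open>D w\<close> along
  words of length one is \<open>c w\<close>. The empty word is not part of the coalgebra.\<close>

definition zin_coderivation ::
    "('a \<Rightarrow> int) \<Rightarrow> ('a list \<Rightarrow> ('a \<Rightarrow>\<^sub>0 'k::comm_ring_1)) \<Rightarrow> ('a list \<Rightarrow> ('a list \<Rightarrow>\<^sub>0 'k)) \<Rightarrow> bool"
  where "zin_coderivation dg c D \<longleftrightarrow>
    D [] = 0 \<and>
    (\<forall>w. [] \<notin> Poly_Mapping.keys (D w)) \<and>
    (\<forall>w x. w \<noteq> [] \<longrightarrow> Poly_Mapping.lookup (D w) [x] = Poly_Mapping.lookup (c w) x) \<and>
    (\<forall>w. lin_ext fscale (zin_coprod dg) (D w) =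
         lin_ext fscale
           (\<lambda>(u, v). lin_ext fscale (\<lambda>u'. Poly_Mapping.single (u', v) 1) (D u)
                   + fscale (psgn (word_deg dg u))
                       (lin_ext fscale (\<lambda>v'. Poly_Mapping.single (u, v') 1) (D v)))
           (zin_coprod dg w))"

definition the_coderivation ::
    "('a \<Rightarrow> int) \<Rightarrow> ('a list \<Rightarrow> ('a \<Rightarrow>\<^sub>0 'k::comm_ring_1)) \<Rightarrow> 'a list \<Rightarrow> ('a list \<Rightarrow>\<^sub>0 'k)"
  where "the_coderivation dg c = (THE D. zin_coderivation dg c D)"

text \<open>Coderivations exist and are determined by their corestrictions, provided the corestrictions
  lower the degree by one (up to parity), so that the definite description is meaningful.\<close>

abbreviation ev :: "('b \<Rightarrow> 'k::comm_ring_1) \<Rightarrow> ('b \<Rightarrow>\<^sub>0 'k) \<Rightarrow> 'k"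
  where "ev \<equiv> lin_ext (*)"

lemma psgn_add: "(psgn (a + b) :: 'k::comm_ring_1) = psgn a * psgn b"
  by (auto simp: psgn_def)

lemma psgn_0 [simp]: "psgn 0 = 1"
  by (simp add: psgn_def)

lemma psgn_cong: "even (a - b) \<Longrightarrow> psgn a = psgn b"
  by (auto simp: psgn_def)

lemma psgn_sum: "finite A \<Longrightarrow> (psgn (\<Sum>i\<in>A. f i) :: 'k::comm_ring_1) = (\<Prod>i\<in>A. psgn (f i))"
  by (induction A rule: finite_induct) (auto simp: psgn_add)

lemma ev_superset:
  assumes "finite A" "Poly_Mapping.keys p \<subseteq> A"
  shows "ev F p = (\<Sum>b\<in>A. Poly_Mapping.lookup p b * F b)"
  unfolding lin_ext_def
  by (rule sum.mono_neutral_left) (use assms in \<open>auto simp: in_keys_iff\<close>)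

lemma ev_zero [simp]: "ev F 0 = 0"
  by (simp add: lin_ext_def)

lemma ev_add: "ev F (p + q) = ev F p + ev F q"
proof -
  let ?A = "Poly_Mapping.keys p \<union> Poly_Mapping.keys q"
  have k: "Poly_Mapping.keys (p + q) \<subseteq> ?A" by (rule keys_add)
  show ?thesis
    by (subst (1 2 3) ev_superset[where A = ?A])
       (use k in \<open>auto simp: lookup_add distrib_right sum.distrib\<close>)
qed

lemma ev_sum: "ev F (\<Sum>i\<in>A. p i) = (\<Sum>i\<in>A. ev F (p i))"
  by (induction A rule: infinite_finite_induct) (auto simp: ev_add)

lemma ev_single [simp]: "ev F (Poly_Mapping.single b c) = c * F b"
  by (subst ev_superset[where A = "{b}"]) (auto simp: lookup_single)

lemma lookup_fscale: "Poly_Mapping.lookup (fscale c p) b = c * Poly_Mapping.lookup p b"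
  by (simp add: fscale_def Poly_Mapping.map.rep_eq when_def)

lemma keys_fscale: "Poly_Mapping.keys (fscale c p) \<subseteq> Poly_Mapping.keys p"
  by (auto simp: in_keys_iff lookup_fscale)

lemma ev_fscale: "ev F (fscale c p) = c * ev F p"
  by (subst (1 2) ev_superset[where A = "Poly_Mapping.keys p"])
     (use keys_fscale[of c p] in \<open>auto simp: lookup_fscale sum_distrib_left mult.assoc\<close>)

lemma ev_lin_ext: "ev F (lin_ext fscale G p) = ev (\<lambda>b. ev F (G b)) p"
proof -
  have "ev F (lin_ext fscale G p) =
      (\<Sum>b\<in>Poly_Mapping.keys p. ev F (fscale (Poly_Mapping.lookup p b) (G b)))"
    by (subst lin_ext_def[of fscale]) (rule ev_sum)
  also have "\<dots> = ev (\<lambda>b. ev F (G b)) p"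
    by (simp add: ev_fscale lin_ext_def[of "(*)" "\<lambda>b. ev F (G b)"])
  finally show ?thesis .
qed

lemma ev_lookup: "ev (\<lambda>b. of_bool (b = x)) p = Poly_Mapping.lookup p x"
  by (subst ev_superset[where A = "insert x (Poly_Mapping.keys p)"])
     (auto simp: of_bool_def if_distrib sum.delta cong: if_cong)

lemma ev_eqI: "(\<And>F. ev F p = ev F q) \<Longrightarrow> p = q"
  by (rule poly_mapping_eqI) (metis ev_lookup)

lemma ev_cong: "(\<And>b. b \<in> Poly_Mapping.keys p \<Longrightarrow> F b = G b) \<Longrightarrow> ev F p = ev G p"
  by (simp add: lin_ext_def)

lemma ev_plus: "ev (\<lambda>b. F b + G b) p = ev F p + ev G p"
  by (simp add: lin_ext_def distrib_left sum.distrib)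

lemma ev_mult: "ev (\<lambda>b. k * F b) p = k * ev F p"
  by (simp add: lin_ext_def sum_distrib_left mult.left_commute)

lemma word_deg_simps [simp]:
  "word_deg dg [] = 0" "word_deg dg (x # w) = dg x + word_deg dg w"
  "word_deg dg (v @ w) = word_deg dg v + word_deg dg w"
  by (auto simp: word_deg_def)

lemma word_deg_nths:
  "word_deg dg (nths w A) = (\<Sum>i | i < length w \<and> i \<in> A. dg (w ! i))"
proof (induction w rule: rev_induct)
  case (snoc x w)
  have "{i. i < Suc (length w) \<and> i \<in> A} =
      {i. i < length w \<and> i \<in> A} \<union> (if length w \<in> A then {length w} else {})"
    by (auto simp: less_Suc_eq)
  moreover have "(\<Sum>i | i < length w \<and> i \<in> A. dg ((w @ [x]) ! i)) =
      (\<Sum>i | i < length w \<and> i \<in> A. dg (w ! i))"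
    by (rule sum.cong) (auto simp: nth_append)
  ultimately show ?case
    by (auto simp: nths_append snoc.IH)
qed simp

text \<open>The full unshuffle, in which both factors may be empty, paired with a function.\<close>

definition unsh :: "('a \<Rightarrow> int) \<Rightarrow> 'a list \<Rightarrow> ('a list \<Rightarrow> 'a list \<Rightarrow> 'k::comm_ring_1) \<Rightarrow> 'k"
  where "unsh dg w F =
    (\<Sum>S\<in>Pow {..<length w}. shuffle_sign dg w S * F (nths w S) (nths w (- S)))"

lemma unsh_Nil [simp]: "unsh dg [] F = F [] []"
  by (simp add: unsh_def shuffle_sign_def)

lemma shuffle_sign_snoc:
  assumes "S \<subseteq> {..<length w}"
  shows "shuffle_sign dg (w @ [x]) S = shuffle_sign dg w S"
  unfolding shuffle_sign_def
  by (rule prod.cong) (use assms in \<open>auto simp: nth_append\<close>)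

lemma shuffle_sign_snoc_insert:
  assumes S: "S \<subseteq> {..<length w}"
  shows "(shuffle_sign dg (w @ [x]) (insert (length w) S) :: 'k::comm_ring_1) =
    shuffle_sign dg w S * psgn (dg x * word_deg dg (nths w (- S)))"
proof -
  let ?n = "length w"
  let ?f = "\<lambda>(i, j). psgn (dg ((w @ [x]) ! i) * dg ((w @ [x]) ! j)) :: 'k"
  let ?A = "{(i, j). i < j \<and> j < ?n \<and> i \<notin> S \<and> j \<in> S}"
  let ?B = "(\<lambda>i. (i, ?n)) ` {i. i < ?n \<and> i \<in> - S}"
  have eq: "{(i, j). i < j \<and> j < length (w @ [x]) \<and> i \<notin> insert ?n S \<and> j \<in> insert ?n S} = ?A \<union> ?B"
    using S by auto
  have fin: "finite ?A"
    by (rule finite_subset[of _ "{..<?n} \<times> {..<?n}"]) auto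
  have "prod ?f (?A \<union> ?B) = prod ?f ?A * prod ?f ?B"
    by (rule prod.union_disjoint) (use fin in auto)
  also have "prod ?f ?A = shuffle_sign dg w S"
    unfolding shuffle_sign_def by (rule prod.cong) (auto simp: nth_append)
  also have "prod ?f ?B = (\<Prod>i | i < ?n \<and> i \<in> - S. psgn (dg x * dg (w ! i)))"
    by (subst prod.reindex) (auto simp: inj_on_def nth_append mult.commute intro!: prod.cong)
  also have "\<dots> = psgn (dg x * word_deg dg (nths w (- S)))"
    by (simp add: word_deg_nths sum_distrib_left psgn_sum)
  finally show ?thesis
    unfolding shuffle_sign_def[of dg "w @ [x]"] eq .
qed

lemma nths_cong_idx:
  "(\<And>i. i < length w \<Longrightarrow> i \<in> A \<longleftrightarrow> i \<in> B) \<Longrightarrow> nths w A = nths w B"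
  unfolding nths_def
  by (rule arg_cong[of _ _ "map fst"], rule filter_cong) (auto simp: set_zip)

lemma nths_snoc_in:
  assumes "S \<subseteq> {..<length w}"
  shows "nths (w @ [x]) S = nths w S" "nths (w @ [x]) (- S) = nths w (- S) @ [x]"
    "nths (w @ [x]) (insert (length w) S) = nths w S @ [x]"
    "nths (w @ [x]) (- insert (length w) S) = nths w (- S)"
proof -
  have n: "length w \<notin> S" using assms by auto
  have 1: "nths w (insert (length w) S) = nths w S"
    by (rule nths_cong_idx) auto
  have 2: "nths w (- insert (length w) S) = nths w (- S)"
    by (rule nths_cong_idx) auto
  show "nths (w @ [x]) S = nths w S" "nths (w @ [x]) (- S) = nths w (- S) @ [x]"
    using n by (simp_all add: nths_append)
  show "nths (w @ [x]) (insert (length w) S) = nths w S @ [x]"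
    unfolding nths_append 1 by simp
  show "nths (w @ [x]) (- insert (length w) S) = nths w (- S)"
    unfolding nths_append 2 by simp
qed

lemma unsh_snoc:
  "unsh dg (w @ [x]) F =
   unsh dg w (\<lambda>a b. F a (b @ [x]) + psgn (dg x * word_deg dg b) * F (a @ [x]) b)"
proof -
  let ?n = "length w"
  let ?P = "Pow {..<?n}"
  let ?g = "\<lambda>S. shuffle_sign dg (w @ [x]) S * F (nths (w @ [x]) S) (nths (w @ [x]) (- S))"
  have "Pow {..<length (w @ [x])} = ?P \<union> insert ?n ` ?P"
    by (simp add: lessThan_Suc Pow_insert)
  moreover have "sum ?g (?P \<union> insert ?n ` ?P) = sum ?g ?P + sum ?g (insert ?n ` ?P)"
    by (rule sum.union_disjoint) auto
  moreover have "sum ?g (insert ?n ` ?P) = (\<Sum>S\<in>?P. ?g (insert ?n S))"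
  proof -
    have "inj_on (insert ?n) ?P"
    proof (rule inj_onI)
      fix A B assume "A \<in> ?P" "B \<in> ?P" "insert ?n A = insert ?n B"
      moreover from this have "?n \<notin> A" "?n \<notin> B" by auto
      ultimately show "A = B" by (simp add: insert_ident)
    qed
    then show ?thesis by (simp only: sum.reindex o_def)
  qed
  ultimately have "unsh dg (w @ [x]) F = (\<Sum>S\<in>?P. ?g S + ?g (insert ?n S))"
    by (simp only: unsh_def sum.distrib)
  also have "\<dots> = unsh dg w (\<lambda>a b. F a (b @ [x]) + psgn (dg x * word_deg dg b) * F (a @ [x]) b)"
    unfolding unsh_def
    by (rule sum.cong)
       (simp_all add: Pow_iff nths_snoc_in shuffle_sign_snoc shuffle_sign_snoc_insert algebra_simps)
  finally show ?thesis .
qed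

lemma unsh_cong:
  "(\<And>a b. word_deg dg a + word_deg dg b = word_deg dg w \<Longrightarrow> F a b = G a b) \<Longrightarrow>
   unsh dg w F = unsh dg w G"
proof (induction w arbitrary: F G rule: rev_induct)
  case (snoc x w)
  show ?case
    unfolding unsh_snoc by (rule snoc.IH) (auto simp: snoc.prems)
qed simp

lemma unsh_plus: "unsh dg w (\<lambda>a b. F a b + G a b) = unsh dg w F + unsh dg w G"
  by (simp add: unsh_def distrib_left sum.distrib)

lemma unsh_mult: "unsh dg w (\<lambda>a b. k * F a b) = k * unsh dg w F"
  by (simp add: unsh_def sum_distrib_left mult.left_commute)

lemma unsh_mult_right: "unsh dg w (\<lambda>a b. F a b * k) = unsh dg w F * k"
  by (simp add: unsh_def sum_distrib_right mult.assoc)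

lemma unsh_coassoc:
  fixes G :: "'a list \<Rightarrow> 'a list \<Rightarrow> 'a list \<Rightarrow> 'b::comm_ring_1"
  shows "unsh dg w (\<lambda>u v. unsh dg u (\<lambda>a b. G a b v)) = unsh dg w (\<lambda>u v. unsh dg v (\<lambda>a b. G u a b))"
proof (induction w arbitrary: G rule: rev_induct)
  case (snoc x w)
  let ?s = "\<lambda>b. psgn (dg x * word_deg dg b) :: 'b"
  have "unsh dg (w @ [x]) (\<lambda>u v. unsh dg u (\<lambda>a b. G a b v)) =
      unsh dg w (\<lambda>u v. unsh dg u (\<lambda>a b. G a b (v @ [x]) + ?s v * G a (b @ [x]) v
                                        + ?s v * (?s b * G (a @ [x]) b v)))"
    by (simp add: unsh_snoc unsh_plus unsh_mult distrib_left add.assoc)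
  also have "\<dots> = unsh dg w (\<lambda>u v. unsh dg v (\<lambda>a b. G u a (b @ [x]) + ?s b * G u (a @ [x]) b
                                        + ?s b * (?s a * G (u @ [x]) a b)))"
    by (rule snoc.IH)
  also have "\<dots> = unsh dg w (\<lambda>u v. unsh dg v (\<lambda>a b. G u a (b @ [x]) + ?s b * G u (a @ [x]) b
                                        + ?s v * G (u @ [x]) a b))"
  proof -
    have "unsh dg v (\<lambda>a b. G u a (b @ [x]) + ?s b * G u (a @ [x]) b
                          + ?s b * (?s a * G (u @ [x]) a b)) =
          unsh dg v (\<lambda>a b. G u a (b @ [x]) + ?s b * G u (a @ [x]) b + ?s v * G (u @ [x]) a b)" for u v
    proof (rule unsh_cong)
      fix a b assume ab: "word_deg dg a + word_deg dg b = word_deg dg v"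
      have "?s b * ?s a = ?s v"
        by (simp add: distrib_left psgn_add mult.commute flip: ab)
      then show "G u a (b @ [x]) + ?s b * G u (a @ [x]) b + ?s b * (?s a * G (u @ [x]) a b) =
          G u a (b @ [x]) + ?s b * G u (a @ [x]) b + ?s v * G (u @ [x]) a b"
        by (simp flip: mult.assoc)
    qed
    then show ?thesis by simp
  qed
  also have "\<dots> = unsh dg (w @ [x]) (\<lambda>u v. unsh dg v (\<lambda>a b. G u a b))"
    by (simp add: unsh_snoc unsh_plus unsh_mult distrib_left add.assoc)
  finally show ?case .
qed simp

lemma unsh_cocomm:
  fixes F :: "'a list \<Rightarrow> 'a list \<Rightarrow> 'b::comm_ring_1"
  shows "unsh dg w (\<lambda>a b. psgn (word_deg dg a * word_deg dg b) * F b a) = unsh dg w F"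
proof (induction w arbitrary: F rule: rev_induct)
  case (snoc x w)
  let ?d = "word_deg dg"
  have "unsh dg (w @ [x]) (\<lambda>a b. psgn (?d a * ?d b) * F b a) =
      unsh dg w (\<lambda>a b. psgn (?d a * ?d b) * (F b (a @ [x]) + psgn (dg x * ?d a) * F (b @ [x]) a))"
    unfolding unsh_snoc
  proof (rule unsh_cong)
    fix a b
    have "psgn (?d a * ?d (b @ [x])) = (psgn (?d a * ?d b) * psgn (dg x * ?d a) :: 'b)"
      by (simp add: psgn_add distrib_left mult.commute)
    moreover have "psgn (dg x * ?d b) * psgn (?d (a @ [x]) * ?d b) = (psgn (?d a * ?d b) :: 'b)"
      unfolding psgn_add[symmetric] by (rule psgn_cong) (simp add: distrib_right)
    ultimately show "psgn (?d a * ?d (b @ [x])) * F (b @ [x]) a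
        + psgn (dg x * ?d b) * (psgn (?d (a @ [x]) * ?d b) * F b (a @ [x])) =
      psgn (?d a * ?d b) * (F b (a @ [x]) + psgn (dg x * ?d a) * F (b @ [x]) a)"
      by (simp add: mult.assoc[symmetric] distrib_left add.commute)
  qed
  also have "\<dots> = unsh dg (w @ [x]) F"
    unfolding unsh_snoc by (rule snoc.IH)
  finally show ?case .
qed simp

lemma zin_coprod_Nil [simp]: "zin_coprod dg [] = 0"
  by (simp add: zin_coprod_def)

lemma ev_zin_coprod_snoc:
  "ev F (zin_coprod dg (w @ [x])) = unsh dg w (\<lambda>a b. if a = [] then 0 else F (a, b @ [x]))"
proof -
  let ?P = "Pow {..<length w}"
  let ?h = "\<lambda>S. shuffle_sign dg w S * (if nths w S = [] then 0 else F (nths w S, nths w (- S) @ [x]))"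
  have ne: "nths w S \<noteq> []" if "S \<subseteq> {..<length w}" "S \<noteq> {}" for S
  proof -
    have "card {i. i < length w \<and> i \<in> S} \<noteq> 0" using that by auto
    then show ?thesis by (metis length_nths list.size(3))
  qed
  have "ev F (zin_coprod dg (w @ [x])) = (\<Sum>S\<in>?P - {{}}. ?h S)"
    unfolding zin_coprod_def ev_sum
    by (rule sum.cong) (auto simp: nths_snoc_in shuffle_sign_snoc ne)
  also have "\<dots> = (\<Sum>S\<in>?P. ?h S)"
    by (rule sum.mono_neutral_left) auto
  finally show ?thesis by (simp add: unsh_def)
qed

text \<open>An explicit recursion for the coderivation, along the last letter.\<close>

primrec coder_rev ::
    "('a \<Rightarrow> int) \<Rightarrow> ('a list \<Rightarrow> ('a \<Rightarrow>\<^sub>0 'k::comm_ring_1)) \<Rightarrow> 'a list \<Rightarrow> ('a list \<Rightarrow>\<^sub>0 'k)"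
  where
    "coder_rev dg c [] = 0"
  | "coder_rev dg c (x # r) =
      lin_ext fscale (\<lambda>u. Poly_Mapping.single (u @ [x]) 1) (coder_rev dg c r) +
      (\<Sum>S\<in>Pow {..<length r}.
         fscale (shuffle_sign dg (rev r) S * psgn (word_deg dg (nths (rev r) S)))
           (lin_ext fscale (\<lambda>y. Poly_Mapping.single (nths (rev r) S @ [y]) 1)
              (c (nths (rev r) (- S) @ [x]))))"

definition coder :: "('a \<Rightarrow> int) \<Rightarrow> ('a list \<Rightarrow> ('a \<Rightarrow>\<^sub>0 'k::comm_ring_1)) \<Rightarrow> 'a list \<Rightarrow> ('a list \<Rightarrow>\<^sub>0 'k)"
  where "coder dg c w = coder_rev dg c (rev w)"

lemma coder_Nil [simp]: "coder dg c [] = 0"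
  by (simp add: coder_def)

lemma ev_coder_snoc:
  "ev F (coder dg c (w @ [x])) = ev (\<lambda>u. F (u @ [x])) (coder dg c w) +
     unsh dg w (\<lambda>a b. psgn (word_deg dg a) * ev (\<lambda>y. F (a @ [y])) (c (b @ [x])))"
  by (simp add: coder_def ev_add ev_sum ev_fscale ev_lin_ext unsh_def mult.assoc)

lemma ev_coder_cong:
  assumes c: "\<And>w y. y \<in> Poly_Mapping.keys (c w) \<Longrightarrow> even (dg y - word_deg dg w + 1)"
  shows "(\<And>u. u \<noteq> [] \<Longrightarrow> even (word_deg dg u - word_deg dg w + 1) \<Longrightarrow> F u = G u) \<Longrightarrow>
    ev F (coder dg c w) = ev G (coder dg c w)"
proof (induction w arbitrary: F G rule: rev_induct)
  case (snoc x w)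
  have 1: "ev (\<lambda>u. F (u @ [x])) (coder dg c w) = ev (\<lambda>u. G (u @ [x])) (coder dg c w)"
    by (rule snoc.IH) (auto intro!: snoc.prems)
  have 2: "unsh dg w (\<lambda>a b. psgn (word_deg dg a) * ev (\<lambda>y. F (a @ [y])) (c (b @ [x]))) =
      unsh dg w (\<lambda>a b. psgn (word_deg dg a) * ev (\<lambda>y. G (a @ [y])) (c (b @ [x])))"
  proof (rule unsh_cong)
    fix a b assume ab: "word_deg dg a + word_deg dg b = word_deg dg w"
    have "ev (\<lambda>y. F (a @ [y])) (c (b @ [x])) = ev (\<lambda>y. G (a @ [y])) (c (b @ [x]))"
    proof (rule ev_cong, rule snoc.prems)
      fix y assume "y \<in> Poly_Mapping.keys (c (b @ [x]))"
      from c[OF this] show "even (word_deg dg (a @ [y]) - word_deg dg (w @ [x]) + 1)"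
        unfolding ab[symmetric] word_deg_simps by presburger
    qed simp
    then show "psgn (word_deg dg a) * ev (\<lambda>y. F (a @ [y])) (c (b @ [x])) =
        psgn (word_deg dg a) * ev (\<lambda>y. G (a @ [y])) (c (b @ [x]))" by simp
  qed
  show ?case unfolding ev_coder_snoc 1 2 ..
qed simp

text \<open>The half unshuffle, with empty left factor allowed.\<close>

definition hunsh :: "('a \<Rightarrow> int) \<Rightarrow> 'a list \<Rightarrow> ('a list \<Rightarrow> 'a list \<Rightarrow> 'k::comm_ring_1) \<Rightarrow> 'k"
  where "hunsh dg w F = (if w = [] then 0 else unsh dg (butlast w) (\<lambda>a b. F a (b @ [last w])))"

lemma hunsh_snoc [simp]: "hunsh dg (w @ [x]) F = unsh dg w (\<lambda>a b. F a (b @ [x]))"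
  by (simp add: hunsh_def)

lemma unsh_eq_hunsh:
  assumes "w \<noteq> []"
  shows "unsh dg w F =
    hunsh dg w F + hunsh dg w (\<lambda>a b. psgn (word_deg dg a * word_deg dg b) * F b a)"
proof -
  let ?d = "word_deg dg"
  obtain v x where w: "w = v @ [x]" using assms by (metis rev_exhaust)
  have "unsh dg v (\<lambda>a b. psgn (dg x * ?d b) * F (a @ [x]) b) =
      unsh dg v (\<lambda>a b. psgn (?d a * ?d b) * (psgn (dg x * ?d a) * F (b @ [x]) a))"
    by (rule unsh_cocomm[symmetric])
  also have "\<dots> = unsh dg v (\<lambda>a b. psgn (?d a * ?d (b @ [x])) * F (b @ [x]) a)"
    by (simp add: distrib_left psgn_add mult.assoc mult.commute[of "dg x"])
  finally show ?thesis
    unfolding w unsh_snoc hunsh_snoc unsh_plus by simp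
qed

definition coder_tensor ::
    "('a \<Rightarrow> int) \<Rightarrow> ('a list \<Rightarrow> ('a list \<Rightarrow>\<^sub>0 'k::comm_ring_1)) \<Rightarrow>
     ('a list \<Rightarrow> 'a list \<Rightarrow> 'k) \<Rightarrow> 'a list \<Rightarrow> 'a list \<Rightarrow> 'k"
  where "coder_tensor dg D F a b =
    ev (\<lambda>u. F u b) (D a) + psgn (word_deg dg a) * ev (F a) (D b)"

lemma hunsh_cong:
  "(\<And>a b. F a b = G a b) \<Longrightarrow> hunsh dg w F = hunsh dg w G"
  by (simp add: hunsh_def)

lemma hunsh_plus: "hunsh dg w (\<lambda>a b. F a b + G a b) = hunsh dg w F + hunsh dg w G"
  by (simp add: hunsh_def unsh_plus)

lemma coder_half_full:
  fixes c :: "'a list \<Rightarrow> ('a \<Rightarrow>\<^sub>0 'k::comm_ring_1)"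
  assumes c: "\<And>w y. y \<in> Poly_Mapping.keys (c w) \<Longrightarrow> even (dg y - word_deg dg w + 1)"
  shows "ev (\<lambda>u. hunsh dg u F) (coder dg c w) = hunsh dg w (coder_tensor dg (coder dg c) F)"
    and "ev (\<lambda>u. unsh dg u F) (coder dg c w) = unsh dg w (coder_tensor dg (coder dg c) F)"
proof (induction w arbitrary: F rule: rev_induct)
  case Nil
  case 1 show ?case by (simp add: hunsh_def)
  case 2 show ?case by (simp add: coder_tensor_def)
next
  case (snoc x w)
  note IH = snoc.IH(2)
  let ?D = "coder dg c"
  let ?d = "word_deg dg"
  have half: "ev (\<lambda>u. hunsh dg u F) (?D (w @ [x])) =
      hunsh dg (w @ [x]) (coder_tensor dg ?D F)" for F :: "'a list \<Rightarrow> 'a list \<Rightarrow> 'k"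
  proof -
    let ?C = "\<lambda>a b. ev (\<lambda>y. F (fst a) (snd a @ [y])) (c (b @ [x]))"
    have A: "ev (\<lambda>u. unsh dg u (\<lambda>a b. F a (b @ [x]))) (?D w) =
        unsh dg w (\<lambda>a b. ev (\<lambda>u. F u (b @ [x])) (?D a) + psgn (?d a) * ev (\<lambda>v. F a (v @ [x])) (?D b))"
      unfolding IH by (rule unsh_cong) (simp add: coder_tensor_def)
    have swap: "ev (\<lambda>y. unsh dg a (\<lambda>a' b'. G a' b' y)) p = unsh dg a (\<lambda>a' b'. ev (G a' b') p)"
      for a :: "'a list" and G :: "'a list \<Rightarrow> 'a list \<Rightarrow> 'a \<Rightarrow> 'k" and p
    proof -
      have "ev (\<lambda>y. unsh dg a (\<lambda>a' b'. G a' b' y)) p =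
          (\<Sum>y\<in>Poly_Mapping.keys p. \<Sum>S\<in>Pow {..<length a}.
             Poly_Mapping.lookup p y * (shuffle_sign dg a S * G (nths a S) (nths a (- S)) y))"
        by (simp add: lin_ext_def unsh_def sum_distrib_left)
      also have "\<dots> = (\<Sum>S\<in>Pow {..<length a}. \<Sum>y\<in>Poly_Mapping.keys p.
             Poly_Mapping.lookup p y * (shuffle_sign dg a S * G (nths a S) (nths a (- S)) y))"
        by (rule sum.swap)
      also have "\<dots> = unsh dg a (\<lambda>a' b'. ev (G a' b') p)"
        by (simp add: lin_ext_def unsh_def sum_distrib_left mult.left_commute)
      finally show ?thesis .
    qed
    have B: "unsh dg w (\<lambda>a b. psgn (?d a) * ev (\<lambda>y. hunsh dg (a @ [y]) F) (c (b @ [x]))) =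
        unsh dg w (\<lambda>u v. psgn (?d u) * unsh dg v (\<lambda>a b. psgn (?d a) * ev (\<lambda>y. F u (a @ [y])) (c (b @ [x]))))"
    proof -
      have "unsh dg w (\<lambda>a b. psgn (?d a) * ev (\<lambda>y. hunsh dg (a @ [y]) F) (c (b @ [x]))) =
          unsh dg w (\<lambda>u v. unsh dg u (\<lambda>a b. psgn (?d u) * ?C (a, b) v))"
        by (simp add: swap unsh_mult)
      also have "\<dots> = unsh dg w (\<lambda>u v. unsh dg u (\<lambda>a b. psgn (?d a) * (psgn (?d b) * ?C (a, b) v)))"
        by (intro arg_cong[of _ _ "unsh dg w"] ext unsh_cong)
           (simp add: psgn_add mult.assoc flip: mult.assoc psgn_add)
      also have "\<dots> = unsh dg w (\<lambda>u v. unsh dg v (\<lambda>a b. psgn (?d u) * (psgn (?d a) * ?C (u, a) b)))"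
        by (rule unsh_coassoc)
      finally show ?thesis by (simp add: unsh_mult)
    qed
    have "ev (\<lambda>u. hunsh dg u F) (?D (w @ [x])) =
        unsh dg w (\<lambda>a b. ev (\<lambda>u. F u (b @ [x])) (?D a) + psgn (?d a) * ev (\<lambda>v. F a (v @ [x])) (?D b))
        + unsh dg w (\<lambda>u v. psgn (?d u) * unsh dg v (\<lambda>a b. psgn (?d a) * ev (\<lambda>y. F u (a @ [y])) (c (b @ [x]))))"
      unfolding ev_coder_snoc B using A by simp
    also have "\<dots> = hunsh dg (w @ [x]) (coder_tensor dg ?D F)"
      by (simp add: coder_tensor_def ev_coder_snoc distrib_left unsh_plus add.assoc)
    finally show ?thesis .
  qed
  case 1 show ?case by (rule half)
  case 2
  let ?flip = "\<lambda>G a b. psgn (?d a * ?d b) * G b a :: 'k"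
  have flip: "coder_tensor dg ?D (?flip F) a b = ?flip (coder_tensor dg ?D F) a b" for a b
  proof -
    have "ev (\<lambda>u. psgn (?d u * ?d b) * F b u) (?D a) =
        ev (\<lambda>u. psgn (?d a * ?d b) * psgn (?d b) * F b u) (?D a)"
    proof (rule ev_coder_cong[OF c])
      fix u assume "even (?d u - ?d a + 1)"
      then have "psgn (?d u * ?d b) = (psgn (?d a * ?d b + ?d b) :: 'k)"
        by (intro psgn_cong) auto
      then show "psgn (?d u * ?d b) * F b u = psgn (?d a * ?d b) * psgn (?d b) * F b u"
        by (simp add: psgn_add)
    qed
    moreover have "psgn (?d a) * ev (\<lambda>v. psgn (?d a * ?d v) * F v a) (?D b) =
        ev (\<lambda>v. psgn (?d a) * (psgn (?d a * ?d v) * F v a)) (?D b)"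
      by (rule ev_mult[symmetric])
    moreover have "\<dots> = ev (\<lambda>v. psgn (?d a * ?d b) * F v a) (?D b)"
    proof (rule ev_coder_cong[OF c])
      fix v assume "even (?d v - ?d b + 1)"
      then have "psgn (?d a + ?d a * ?d v) = (psgn (?d a * ?d b) :: 'k)"
        by (intro psgn_cong) auto
      then show "psgn (?d a) * (psgn (?d a * ?d v) * F v a) = psgn (?d a * ?d b) * F v a"
        by (simp add: psgn_add flip: mult.assoc)
    qed
    ultimately show ?thesis
      by (simp add: coder_tensor_def ev_mult distrib_left mult.assoc)
  qed
  have "ev (\<lambda>u. unsh dg u F) (?D (w @ [x])) =
      ev (\<lambda>u. hunsh dg u F + hunsh dg u (?flip F)) (?D (w @ [x]))"
    by (rule ev_coder_cong[OF c]) (auto simp: unsh_eq_hunsh)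
  also have "\<dots> = hunsh dg (w @ [x]) (coder_tensor dg ?D F) + hunsh dg (w @ [x]) (?flip (coder_tensor dg ?D F))"
    unfolding ev_plus half flip ..
  also have "\<dots> = unsh dg (w @ [x]) (coder_tensor dg ?D F)"
    by (rule unsh_eq_hunsh[symmetric]) simp
  finally show ?case .
qed

lemma ev_zin_coprod:
  "ev F (zin_coprod dg w) = hunsh dg w (\<lambda>a b. if a = [] then 0 else F (a, b))"
  by (cases w rule: rev_cases) (simp_all add: ev_zin_coprod_snoc hunsh_def[of _ "[]"])

lemma coder_keys:
  assumes c: "\<And>w y. y \<in> Poly_Mapping.keys (c w) \<Longrightarrow> even (dg y - word_deg dg w + 1)"
  shows "[] \<notin> Poly_Mapping.keys (coder dg c w)"
proof -
  have "ev (\<lambda>u. of_bool (u = [])) (coder dg c w) = ev (\<lambda>u. 0) (coder dg c w)"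
    by (rule ev_coder_cong[OF c]) auto
  also have "\<dots> = 0" by (simp add: lin_ext_def)
  finally show ?thesis by (simp add: in_keys_iff ev_lookup)
qed

lemma zin_coderivation_coder:
  fixes c :: "'a list \<Rightarrow> ('a \<Rightarrow>\<^sub>0 'k::comm_ring_1)"
  assumes c: "\<And>w y. y \<in> Poly_Mapping.keys (c w) \<Longrightarrow> even (dg y - word_deg dg w + 1)"
  shows "zin_coderivation dg c (coder dg c)"
  unfolding zin_coderivation_def
proof (intro conjI allI impI)
  let ?D = "coder dg c"
  show "?D [] = 0" by simp
  show nil: "[] \<notin> Poly_Mapping.keys (?D w)" for w by (rule coder_keys[OF c])
  show "Poly_Mapping.lookup (?D w) [x] = Poly_Mapping.lookup (c w) x" if "w \<noteq> []" for w x
  proof -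
    from that obtain v z where w: "w = v @ [z]" by (metis rev_exhaust)
    have "Poly_Mapping.lookup (?D w) [x] = ev (\<lambda>u. of_bool (u @ [z] = [x])) (?D v) +
       unsh dg v (\<lambda>a b. psgn (word_deg dg a) * ev (\<lambda>y. of_bool (a @ [y] = [x])) (c (b @ [z])))"
      unfolding w ev_lookup[symmetric] ev_coder_snoc ..
    also have "ev (\<lambda>u. of_bool (u @ [z] = [x])) (?D v) = ev (\<lambda>u. 0) (?D v)"
      by (rule ev_cong) (use nil[of v] in auto)
    also have "\<dots> = 0" by (simp add: lin_ext_def)
    also have "unsh dg v (\<lambda>a b. psgn (word_deg dg a) * ev (\<lambda>y. of_bool (a @ [y] = [x])) (c (b @ [z]))) =
        unsh dg v (\<lambda>a b. if a = [] then ev (\<lambda>y. of_bool (y = x)) (c (b @ [z])) else 0)"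
      by (rule unsh_cong) (auto simp: lin_ext_def)
    also have "\<dots> = Poly_Mapping.lookup (c (v @ [z])) x"
    proof -
      have "unsh dg v (\<lambda>a b. if a = [] then F b else 0) = F v" for F :: "'a list \<Rightarrow> 'k"
        by (induction v arbitrary: F rule: rev_induct) (auto simp: unsh_snoc)
      from this[of "\<lambda>b. ev (\<lambda>y. of_bool (y = x)) (c (b @ [z]))"] show ?thesis by (simp add: ev_lookup)
    qed
    finally show ?thesis by (simp add: w)
  qed
  show "lin_ext fscale (zin_coprod dg) (?D w) =
         lin_ext fscale
           (\<lambda>(u, v). lin_ext fscale (\<lambda>u'. Poly_Mapping.single (u', v) 1) (?D u)
                   + fscale (psgn (word_deg dg u))
                       (lin_ext fscale (\<lambda>v'. Poly_Mapping.single (u, v') 1) (?D v)))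
           (zin_coprod dg w)" for w
  proof (rule ev_eqI)
    fix F :: "'a list \<times> 'a list \<Rightarrow> 'k"
    let ?F = "\<lambda>a b. if a = [] then 0 else F (a, b)"
    have "ev F (lin_ext fscale (zin_coprod dg) (?D w)) = ev (\<lambda>u. hunsh dg u ?F) (?D w)"
      by (simp add: ev_lin_ext ev_zin_coprod)
    also have "\<dots> = hunsh dg w (coder_tensor dg ?D ?F)"
      by (rule coder_half_full(1)[OF c])
    also have "\<dots> = hunsh dg w (\<lambda>a b. if a = [] then 0 else coder_tensor dg ?D (\<lambda>a b. F (a, b)) a b)"
    proof (rule hunsh_cong)
      fix a b
      have "ev (\<lambda>u. ?F u b) (?D a) = ev (\<lambda>u. F (u, b)) (?D a)"
        by (rule ev_cong) (use nil[of a] in auto)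
      then show "coder_tensor dg ?D ?F a b =
          (if a = [] then 0 else coder_tensor dg ?D (\<lambda>a b. F (a, b)) a b)"
        by (auto simp: coder_tensor_def lin_ext_def)
    qed
    also have "\<dots> = ev (\<lambda>(a, b). coder_tensor dg ?D (\<lambda>a b. F (a, b)) a b) (zin_coprod dg w)"
      by (simp add: ev_zin_coprod cong: if_cong)
    also have "\<dots> = ev F (lin_ext fscale
           (\<lambda>(u, v). lin_ext fscale (\<lambda>u'. Poly_Mapping.single (u', v) 1) (?D u)
                   + fscale (psgn (word_deg dg u))
                       (lin_ext fscale (\<lambda>v'. Poly_Mapping.single (u, v') 1) (?D v)))
           (zin_coprod dg w))"
      by (simp add: ev_lin_ext coder_tensor_def split_def ev_add ev_fscale)
    finally show "ev F (lin_ext fscale (zin_coprod dg) (?D w)) = \<dots>" .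
  qed
qed

lemma zin_coderivation_unique:
  fixes c :: "'a list \<Rightarrow> ('a \<Rightarrow>\<^sub>0 'k::comm_ring_1)"
  assumes D: "zin_coderivation dg c D" and E: "zin_coderivation dg c E"
  shows "D = E"
proof
  fix w
  let ?co = "\<lambda>D. \<lambda>(u, v). lin_ext fscale (\<lambda>u'. Poly_Mapping.single (u', v) 1) (D u)
                   + fscale (psgn (word_deg dg u))
                       (lin_ext fscale (\<lambda>v'. Poly_Mapping.single (u, v') (1 :: 'k)) (D v))"
  have last: "Poly_Mapping.lookup (D w) (u @ [y]) =
      Poly_Mapping.lookup (lin_ext fscale (zin_coprod dg) (D w)) (u, [y])"
    if "u \<noteq> []" for D :: "'a list \<Rightarrow> 'a list \<Rightarrow>\<^sub>0 'k" and w u y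
  proof -
    have pr: "unsh dg v (\<lambda>a b. of_bool (a = u \<and> b = [])) = (of_bool (v = u) :: 'k)" for v
    proof -
      have "unsh dg v (\<lambda>a b. of_bool (b = []) * F a) = (F v :: 'k)" for F
      proof (induction v arbitrary: F rule: rev_induct)
        case (snoc x v)
        have "unsh dg (v @ [x]) (\<lambda>a b. of_bool (b = []) * F a) =
            unsh dg v (\<lambda>a b. of_bool (b = []) * F (a @ [x]))"
          unfolding unsh_snoc by (rule unsh_cong) auto
        then show ?case by (simp add: snoc.IH)
      qed simp
      from this[of "\<lambda>a. of_bool (a = u)"] show ?thesis
        by (simp add: conj_commute flip: of_bool_conj)
    qed
    have "Poly_Mapping.lookup (lin_ext fscale (zin_coprod dg) (D w)) (u, [y]) =
        ev (\<lambda>t. ev (\<lambda>b. of_bool (b = (u, [y]))) (zin_coprod dg t)) (D w)"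
      unfolding ev_lin_ext[symmetric] by (rule ev_lookup[symmetric])
    also have "\<dots> = ev (\<lambda>t. of_bool (t = u @ [y])) (D w)"
    proof (rule ev_cong)
      fix t
      show "ev (\<lambda>b. of_bool (b = (u, [y]))) (zin_coprod dg t) = (of_bool (t = u @ [y]) :: 'k)"
      proof (cases t rule: rev_cases)
        case (snoc v x)
        have "ev (\<lambda>b. of_bool (b = (u, [y]))) (zin_coprod dg t) =
            unsh dg v (\<lambda>a b. of_bool (x = y) * of_bool (a = u \<and> b = []) :: 'k)"
          unfolding snoc ev_zin_coprod_snoc by (rule unsh_cong) (use that in auto)
        also have "\<dots> = of_bool (x = y) * of_bool (v = u)" unfolding unsh_mult pr ..
        finally show ?thesis by (auto simp: snoc)
      qed simp
    qed
    also have "\<dots> = Poly_Mapping.lookup (D w) (u @ [y])" by (rule ev_lookup)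
    finally show ?thesis by simp
  qed
  show "D w = E w"
  proof (induction w rule: length_induct)
    case (1 w)
    show ?case
    proof (cases "w = []")
      case True
      then show ?thesis using D E by (simp add: zin_coderivation_def)
    next
      case False
      have co: "lin_ext fscale (?co D) (zin_coprod dg w) = lin_ext fscale (?co E) (zin_coprod dg w)"
      proof -
        have "?co D p = ?co E p" if pk: "p \<in> Poly_Mapping.keys (zin_coprod dg w :: _ \<Rightarrow>\<^sub>0 'k)" for p
        proof -
          obtain S where S': "S \<in> Pow {..<length w - 1} - {{}}"
              "p \<in> Poly_Mapping.keys
                 (Poly_Mapping.single (nths w S, nths w (- S)) (shuffle_sign dg w S :: 'k))"
            using subsetD[OF keys_sum pk[unfolded zin_coprod_def]] by blast
          then have S: "S \<subseteq> {..<length w - 1}" "S \<noteq> {}" and p: "p = (nths w S, nths w (- S))"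
            by (auto split: if_splits)
          obtain s where s: "s \<in> S" using S by auto
          have lt: "length (nths w A) < length w" if "i < length w" "i \<notin> A" for A i
          proof -
            have "{i. i < length w \<and> i \<in> A} \<subset> {..<length w}" using that by auto
            then have "card {i. i < length w \<and> i \<in> A} < card {..<length w}"
              by (rule psubset_card_mono[OF finite_lessThan])
            then show ?thesis by (simp add: length_nths)
          qed
          have "length (nths w S) < length w"
            by (rule lt[of "length w - 1"]) (use S False in auto)
          moreover have "length (nths w (- S)) < length w"
            by (rule lt[of s]) (use S s in auto)
          ultimately show ?thesis using 1 by (simp add: p)
        qed
        then show ?thesis by (simp add: lin_ext_def[of fscale "?co D"] lin_ext_def[of fscale "?co E"])
      qed
      have eq: "lin_ext fscale (zin_coprod dg) (D w) = lin_ext fscale (zin_coprod dg) (E w)"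
        using D E co unfolding zin_coderivation_def by metis
      show ?thesis
      proof (rule poly_mapping_eqI)
        fix t
        show "Poly_Mapping.lookup (D w) t = Poly_Mapping.lookup (E w) t"
        proof (cases t rule: rev_cases)
          case Nil
          have "[] \<notin> Poly_Mapping.keys (D w)" "[] \<notin> Poly_Mapping.keys (E w)"
            using D E by (auto simp: zin_coderivation_def)
          then show ?thesis by (simp add: Nil in_keys_iff)
        next
          case (snoc u y)
          show ?thesis
          proof (cases "u = []")
            case True
            then show ?thesis using D E False by (simp add: zin_coderivation_def snoc)
          next
            case False
            then show ?thesis by (simp add: snoc last eq)
          qed
        qed
      qed
    qed
  qed
qed

lemma the_coderivation_eq:
  assumes c: "\<And>w y. y \<in> Poly_Mapping.keys (c w) \<Longrightarrow> even (dg y - word_deg dg w + 1)"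
  shows "the_coderivation dg c = coder dg c" "zin_coderivation dg c (the_coderivation dg c)"
proof -
  have ex: "zin_coderivation dg c (coder dg c)"
    using c by (rule zin_coderivation_coder)
  then show eq: "the_coderivation dg c = coder dg c"
    unfolding the_coderivation_def by (intro the_equality zin_coderivation_unique[OF _ ex])
  show "zin_coderivation dg c (the_coderivation dg c)"
    unfolding eq by (rule ex)
qed

section \<open>2-term Leibniz infinity algebras, infinity morphisms and 2-term homotopies\<close>

text \<open>A graded vector space $V=V_0\oplus V_1$ is given by the scalings \<open>sc0\<close>, \<open>sc1\<close> on the
  types \<open>'a\<close> of $V_0$ and \<open>'b\<close> of $V_1$. By degree reasons $l_1$ is a map $V_1\to V_0$, $l_3$ a
  map $V_0^3\to V_1$, and $l_2$ has the components \<open>l200\<close>, \<open>l201\<close>, \<open>l210\<close> on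
  $V_0\times V_0$, $V_0\times V_1$, $V_1\times V_0$.\<close>

record ('k, 'a, 'b) leib2 =
  sc0 :: "'k \<Rightarrow> 'a \<Rightarrow> 'a"
  sc1 :: "'k \<Rightarrow> 'b \<Rightarrow> 'b"
  l1 :: "'b \<Rightarrow> 'a"
  l200 :: "'a \<Rightarrow> 'a \<Rightarrow> 'a"
  l201 :: "'a \<Rightarrow> 'b \<Rightarrow> 'b"
  l210 :: "'b \<Rightarrow> 'a \<Rightarrow> 'b"
  l3 :: "'a \<Rightarrow> 'a \<Rightarrow> 'a \<Rightarrow> 'b"

definition bilin ::
    "('k::field \<Rightarrow> 'a::ab_group_add \<Rightarrow> 'a) \<Rightarrow> ('k \<Rightarrow> 'b::ab_group_add \<Rightarrow> 'b) \<Rightarrow>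
     ('k \<Rightarrow> 'c::ab_group_add \<Rightarrow> 'c) \<Rightarrow> ('a \<Rightarrow> 'b \<Rightarrow> 'c) \<Rightarrow> bool"
  where "bilin sa sb sc f \<longleftrightarrow>
    (\<forall>x. Vector_Spaces.linear sb sc (\<lambda>y. f x y)) \<and> (\<forall>y. Vector_Spaces.linear sa sc (\<lambda>x. f x y))"

definition trilin ::
    "('k::field \<Rightarrow> 'a::ab_group_add \<Rightarrow> 'a) \<Rightarrow> ('k \<Rightarrow> 'b::ab_group_add \<Rightarrow> 'b) \<Rightarrow>
     ('a \<Rightarrow> 'a \<Rightarrow> 'a \<Rightarrow> 'b) \<Rightarrow> bool"
  where "trilin sa sb f \<longleftrightarrow>
    (\<forall>y z. Vector_Spaces.linear sa sb (\<lambda>x. f x y z)) \<and>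
    (\<forall>x z. Vector_Spaces.linear sa sb (\<lambda>y. f x y z)) \<and>
    (\<forall>x y. Vector_Spaces.linear sa sb (\<lambda>z. f x y z))"

definition leib2_algebra ::
    "('k::field_char_0, 'a::ab_group_add, 'b::ab_group_add) leib2 \<Rightarrow> bool"
  where "leib2_algebra V \<longleftrightarrow>
    vector_space (sc0 V) \<and> vector_space (sc1 V) \<and>
    Vector_Spaces.linear (sc1 V) (sc0 V) (l1 V) \<and>
    bilin (sc0 V) (sc0 V) (sc0 V) (l200 V) \<and>
    bilin (sc0 V) (sc1 V) (sc1 V) (l201 V) \<and>
    bilin (sc1 V) (sc0 V) (sc1 V) (l210 V) \<and>
    trilin (sc0 V) (sc1 V) (l3 V) \<and>
    (\<forall>x h. l1 V (l201 V x h) = l200 V x (l1 V h)) \<and>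
    (\<forall>x h. l1 V (l210 V h x) = l200 V (l1 V h) x) \<and>
    (\<forall>h k. l201 V (l1 V h) k = l210 V h (l1 V k)) \<and>
    (\<forall>x y z. l1 V (l3 V x y z) =
       l200 V x (l200 V y z) - l200 V y (l200 V x z) - l200 V (l200 V x y) z) \<and>
    (\<forall>x y h. l3 V x y (l1 V h) =
       l201 V x (l201 V y h) - l201 V y (l201 V x h) - l201 V (l200 V x y) h) \<and>
    (\<forall>x y h. l3 V x (l1 V h) y =
       l201 V x (l210 V h y) - l210 V h (l200 V x y) - l210 V (l201 V x h) y) \<and>
    (\<forall>x y h. l3 V (l1 V h) x y =
       l210 V h (l200 V x y) - l201 V x (l210 V h y) - l210 V (l210 V h x) y) \<and>
    (\<forall>w x y z.
       l210 V (l3 V w x y) z + l201 V w (l3 V x y z) - l201 V x (l3 V w y z)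
       + l201 V y (l3 V w x z) - l3 V (l200 V w x) y z + l3 V w (l200 V x y) z
       - l3 V x (l200 V w y) z - l3 V w x (l200 V y z) + l3 V w y (l200 V x z)
       - l3 V x y (l200 V w z) = 0)"

text \<open>An infinity morphism: $f_1$ has the components \<open>f10\<close> on $V_0$ and \<open>f11\<close> on $V_1$, and
  $f_2$ is a map $V_0\times V_0\to W_1$.\<close>

record ('a, 'b, 'c, 'd) inf_mor =
  f10 :: "'a \<Rightarrow> 'c"
  f11 :: "'b \<Rightarrow> 'd"
  f2 :: "'a \<Rightarrow> 'a \<Rightarrow> 'd"

definition inf_morphism ::
    "('k::field_char_0, 'a::ab_group_add, 'b::ab_group_add) leib2 \<Rightarrow>
     ('k, 'c::ab_group_add, 'd::ab_group_add) leib2 \<Rightarrow> ('a, 'b, 'c, 'd) inf_mor \<Rightarrow> bool"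
  where "inf_morphism V W f \<longleftrightarrow>
    Vector_Spaces.linear (sc0 V) (sc0 W) (f10 f) \<and>
    Vector_Spaces.linear (sc1 V) (sc1 W) (f11 f) \<and>
    bilin (sc0 V) (sc0 V) (sc1 W) (f2 f) \<and>
    (\<forall>h. l1 W (f11 f h) = f10 f (l1 V h)) \<and>
    (\<forall>x y. l200 W (f10 f x) (f10 f y) + l1 W (f2 f x y) = f10 f (l200 V x y)) \<and>
    (\<forall>x h. l201 W (f10 f x) (f11 f h) = f11 f (l201 V x h) - f2 f x (l1 V h)) \<and>
    (\<forall>x h. l210 W (f11 f h) (f10 f x) = f11 f (l210 V h x) - f2 f (l1 V h) x) \<and>
    (\<forall>x y z.
       l3 W (f10 f x) (f10 f y) (f10 f z) - l210 W (f2 f x y) (f10 f z)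
       + l201 W (f10 f x) (f2 f y z) - l201 W (f10 f y) (f2 f x z) =
       f11 f (l3 V x y z) + f2 f (l200 V x y) z - f2 f x (l200 V y z) + f2 f y (l200 V x z))"

text \<open>A 2-term infinity homotopy $\theta_1:f\Rightarrow g$; being of degree $1$, it is a map
  $V_0\to W_1$.\<close>

definition two_term_homotopy ::
    "('k::field_char_0, 'a::ab_group_add, 'b::ab_group_add) leib2 \<Rightarrow>
     ('k, 'c::ab_group_add, 'd::ab_group_add) leib2 \<Rightarrow>
     ('a, 'b, 'c, 'd) inf_mor \<Rightarrow> ('a, 'b, 'c, 'd) inf_mor \<Rightarrow> ('a \<Rightarrow> 'd) \<Rightarrow> bool"
  where "two_term_homotopy V W f g \<theta> \<longleftrightarrow>
    Vector_Spaces.linear (sc0 V) (sc1 W) \<theta> \<and>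
    (\<forall>x. f10 g x - f10 f x = l1 W (\<theta> x)) \<and>
    (\<forall>h. f11 g h - f11 f h = \<theta> (l1 V h)) \<and>
    (\<forall>x y. f2 g x y - f2 f x y =
       \<theta> (l200 V x y) - l201 W (f10 f x) (\<theta> y) - l210 W (\<theta> x) (f10 g y))"


section \<open>The differential on the Zinbiel coalgebra\<close>

text \<open>A homogeneous element of $V$. The same letters serve for $sV$, with degree raised by
  one.\<close>

datatype ('a, 'b) hom = Hom0 'a | Hom1 'b

fun hdeg :: "('a, 'b) hom \<Rightarrow> int"
  where "hdeg (Hom0 _) = 0" | "hdeg (Hom1 _) = 1"

definition sdeg :: "('a, 'b) hom \<Rightarrow> int"
  where "sdeg v = hdeg v + 1"

fun incl :: "('a::zero, 'b::zero) hom \<Rightarrow> 'a \<times> 'b"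
  where "incl (Hom0 x) = (x, 0)" | "incl (Hom1 h) = (0, h)"

text \<open>The multilinear maps $l_p$ on the whole of $V=V_0\oplus V_1$, all \<open>p\<close> at once.\<close>

fun lmap :: "('k, 'a::ab_group_add, 'b::ab_group_add) leib2 \<Rightarrow> ('a \<times> 'b) list \<Rightarrow> 'a \<times> 'b"
  where
    "lmap V [(x, h)] = (l1 V h, 0)"
  | "lmap V [(x, h), (y, k)] = (l200 V x y, l201 V x k + l210 V h y)"
  | "lmap V [(x, h), (y, k), (z, m)] = (0, l3 V x y z)"
  | "lmap V _ = 0"

text \<open>$s^{\otimes p}(v_1\otimes\dots\otimes v_p)=\pm\,sv_1\otimes\dots\otimes sv_p$ with the
  following sign, so that $D_p(sv_1,\dots,sv_p)=\pm\,s\,l_p(v_1,\dots,v_p)$.\<close>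

definition susp_sign :: "('a, 'b) hom list \<Rightarrow> 'k::comm_ring_1"
  where "susp_sign w = (\<Prod>j<length w. psgn (int (length w - 1 - j) * hdeg (w ! j)))"

definition corestr ::
    "('k::comm_ring_1, 'a::ab_group_add, 'b::ab_group_add) leib2 \<Rightarrow>
     ('a, 'b) hom list \<Rightarrow> (('a, 'b) hom \<Rightarrow>\<^sub>0 'k)"
  where "corestr V w =
    (let v = lmap V (map incl w); n = word_deg hdeg w + int (length w) - 2
     in if n = 0 then Poly_Mapping.single (Hom0 (fst v)) (susp_sign w)
        else if n = 1 then Poly_Mapping.single (Hom1 (snd v)) (susp_sign w)
        else 0)"

text \<open>Words are treated here as formal objects: this is the coderivation on the Zinbiel
  coalgebra over the free vector space on the homogeneous elements of $sV$, and it induces $D$ on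
  the quotient $\mathrm{Zin}^c(sV)$. It is only used below inside maps that are multilinear
  in the letters, i.e. that factor through this quotient.\<close>

definition codiff ::
    "('k::field_char_0, 'a::ab_group_add, 'b::ab_group_add) leib2 \<Rightarrow>
     ('a, 'b) hom list \<Rightarrow> (('a, 'b) hom list \<Rightarrow>\<^sub>0 'k)"
  where "codiff V = the_coderivation sdeg (corestr V)"

lemma corestr_degree:
  "y \<in> Poly_Mapping.keys (corestr V w) \<Longrightarrow> even (sdeg y - word_deg sdeg w + 1)"
proof -
  have d: "word_deg sdeg w = word_deg hdeg w + int (length w)"
    by (induction w) (auto simp: sdeg_def)
  assume "y \<in> Poly_Mapping.keys (corestr V w)"
  then have "hdeg y = word_deg hdeg w + int (length w) - 2"
    by (auto simp: corestr_def Let_def split: if_splits)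
  then show ?thesis by (simp add: d sdeg_def)
qed

lemma codiff_coderivation: "zin_coderivation sdeg (corestr V) (codiff V)"
  unfolding codiff_def by (rule the_coderivation_eq(2)) (rule corestr_degree)


section \<open>The convolution Lie infinity algebra\<close>

type_synonym ('a, 'b, 'c, 'd) conv = "('a, 'b) hom list \<Rightarrow> 'c \<times> 'd"

definition scW :: "('k, 'c, 'd) leib2 \<Rightarrow> 'k \<Rightarrow> 'c \<times> 'd \<Rightarrow> 'c \<times> 'd"
  where "scW W c v = (sc0 W c (fst v), sc1 W c (snd v))"

definition grade :: "int \<Rightarrow> ('c::zero \<times> 'd::zero) set"
  where "grade n = {v. (n \<noteq> 0 \<longrightarrow> fst v = 0) \<and> (n \<noteq> 1 \<longrightarrow> snd v = 0)}"

text \<open>The degree \<open>d\<close> part of $L=\mathrm{Hom}(\mathrm{Zin}^c(sV),W)$: a linear map on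
  $(sV)^{\otimes n}$ is a function on words of length \<open>n\<close> that is linear in each letter; linearity
  in a letter $v\in V_0\oplus V_1$ amounts to linearity on $V_0$ and on $V_1$. The value at
  the empty word is a dummy.\<close>

definition conv_space ::
    "('k::field_char_0, 'a::ab_group_add, 'b::ab_group_add) leib2 \<Rightarrow>
     ('k, 'c::ab_group_add, 'd::ab_group_add) leib2 \<Rightarrow> int \<Rightarrow> ('a, 'b, 'c, 'd) conv set"
  where "conv_space V W d =
    {f. f [] = 0 \<and>
        (\<forall>u v. Vector_Spaces.linear (sc0 V) (scW W) (\<lambda>x. f (u @ Hom0 x # v))) \<and>
        (\<forall>u v. Vector_Spaces.linear (sc1 V) (scW W) (\<lambda>h. f (u @ Hom1 h # v))) \<and>
        (\<forall>w. w \<noteq> [] \<longrightarrow> f w \<in> grade (word_deg sdeg w + d))}"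

definition conv_scale :: "('k, 'c, 'd) leib2 \<Rightarrow> 'k \<Rightarrow> ('a, 'b, 'c, 'd) conv \<Rightarrow> ('a, 'b, 'c, 'd) conv"
  where "conv_scale W c f = (\<lambda>w. scW W c (f w))"

text \<open>Homogeneous elements are passed to the operations as pairs \<open>(d, x)\<close> of a degree and an
  element, since the signs depend on the degrees.\<close>

text \<open>The Koszul sign of $f_1\cdots f_p\mapsto f_{\sigma(1)}\cdots f_{\sigma(p)}$ for elements of
  degrees \<open>ds\<close>, and the one of
  $(f_1\otimes\dots\otimes f_p)(u_1\otimes\dots\otimes u_p)=\pm f_1(u_1)\otimes\dots\otimes f_p(u_p)$,
  i.e. of $f_1\cdots f_pu_1\cdots u_p\mapsto f_1u_1\cdots f_pu_p$, for degrees \<open>ds\<close> of the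
  $f_i$ and \<open>es\<close> of the $u_i$.\<close>

definition koszul_perm :: "int list \<Rightarrow> (nat \<Rightarrow> nat) \<Rightarrow> 'k::comm_ring_1"
  where "koszul_perm ds \<sigma> =
    (\<Prod>(i, j)\<in>{(i, j). i < j \<and> j < length ds \<and> \<sigma> j < \<sigma> i}. psgn (ds ! \<sigma> i * ds ! \<sigma> j))"

definition koszul_zip :: "int list \<Rightarrow> int list \<Rightarrow> 'k::comm_ring_1"
  where "koszul_zip ds es =
    (\<Prod>(i, j)\<in>{(i, j). i < j \<and> j < length ds}. psgn (es ! i * ds ! j))"

definition conv_op ::
    "('k::field_char_0, 'a::ab_group_add, 'b::ab_group_add) leib2 \<Rightarrow>
     ('k, 'c::ab_group_add, 'd::ab_group_add) leib2 \<Rightarrow>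
     (int \<times> ('a, 'b, 'c, 'd) conv) list \<Rightarrow> ('a, 'b, 'c, 'd) conv"
  where "conv_op V W fs =
    (case fs of
       [] \<Rightarrow> 0
     | [(d, f)] \<Rightarrow>
         (\<lambda>w. lmap W [f w] + scW W (psgn d) (lin_ext (scW W) f (codiff V w)))
     | _ \<Rightarrow>
         (let p = length fs in
          (\<lambda>w. lin_ext (scW W)
             (\<lambda>us. \<Sum>\<sigma> | \<sigma> permutes {..<p}.
                scW W
                  (koszul_perm (map fst fs) \<sigma> * of_int (sign \<sigma>) *
                   koszul_zip (map (\<lambda>i. fst (fs ! \<sigma> i)) [0..<p]) (map (word_deg sdeg) us))
                  (lmap W (map (\<lambda>i. snd (fs ! \<sigma> i) (us ! i)) [0..<p])))
             (zin_coprod_iter sdeg (p - 1) w))))"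


section \<open>Maurer-Cartan elements\<close>

text \<open>\<open>G d\<close> is the degree \<open>d\<close> part, \<open>l\<close> the family of operations (the arity being the length
  of the argument list). The sum is over the nonvanishing terms; these are finitely many
  in the cases below, where the operations of arity at least \<open>4\<close> vanish (as \<open>lmap W\<close> does on
  lists of length at least \<open>4\<close>).\<close>

definition MC ::
    "('k::field_char_0 \<Rightarrow> 'g \<Rightarrow> 'g) \<Rightarrow> (int \<Rightarrow> 'g set) \<Rightarrow> ((int \<times> 'g) list \<Rightarrow> 'g::comm_monoid_add) \<Rightarrow> 'g set"
  where "MC sc G l =
    {\<alpha> \<in> G (- 1).
       (\<Sum>i | 1 \<le> i \<and> l (replicate i (- 1, \<alpha>)) \<noteq> 0.
          sc (1 / fact i * (- 1) ^ (i * (i - 1) div 2)) (l (replicate i (- 1, \<alpha>)))) = 0}"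

text \<open>The element of $L_{-1}$ with which an infinity morphism is identified by
  $f_p=\alpha^ps^{\otimes p}$; the sign of $s^{\otimes 2}$ is trivial on $V_0\otimes V_0$.\<close>

fun mor_elem :: "('a, 'b, 'c::zero, 'd::zero) inf_mor \<Rightarrow> ('a, 'b, 'c, 'd) conv"
  where
    "mor_elem f [Hom0 x] = (f10 f x, 0)"
  | "mor_elem f [Hom1 h] = (0, f11 f h)"
  | "mor_elem f [Hom0 x, Hom0 y] = (0, f2 f x y)"
  | "mor_elem f _ = 0"


section \<open>Polynomial differential forms on the 1-simplex and extension of scalars\<close>

text \<open>The pair \<open>(p, q)\<close> stands for the form $p(t)+q(t)\,dt$, where $t$ is the barycentric
  coordinate with value $0$ at the vertex $0$ and $1$ at the vertex $1$.\<close>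

type_synonym 'k form = "'k poly \<times> 'k poly"

definition form_mult :: "'k::field_char_0 form \<Rightarrow> 'k form \<Rightarrow> 'k form"
  where "form_mult a b = (fst a * fst b, fst a * snd b + snd a * fst b)"

definition form_d :: "'k::field_char_0 form \<Rightarrow> 'k form"
  where "form_d a = (0, pderiv (fst a))"

definition form_eval :: "'k::field_char_0 \<Rightarrow> 'k form \<Rightarrow> 'k"
  where "form_eval c a = poly (fst a) c"

text \<open>The basis $t^n$, $t^n\,dt$ of the forms.\<close>

datatype mono = T nat | TdT nat

fun mono_deg :: "mono \<Rightarrow> int"
  where "mono_deg (T n) = 0" | "mono_deg (TdT n) = - 1"

fun mono_form :: "mono \<Rightarrow> 'k::field_char_0 form"
  where "mono_form (T n) = (monom 1 n, 0)" | "mono_form (TdT n) = (0, monom 1 n)"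

fun form_coeff :: "'k::field_char_0 form \<Rightarrow> mono \<Rightarrow> 'k"
  where "form_coeff a (T n) = coeff (fst a) n" | "form_coeff a (TdT n) = coeff (snd a) n"

text \<open>An element of $\mathfrak g\otimes\Omega^\star_1$ is a finitely supported function
  \<open>\<alpha> :: mono \<Rightarrow> 'g\<close>, standing for the sum of the $\alpha(b)\otimes b$ over the basis forms
  $b$.\<close>

definition supp :: "(mono \<Rightarrow> 'g::zero) \<Rightarrow> mono set"
  where "supp \<alpha> = {b. \<alpha> b \<noteq> 0}"

definition tensor :: "('k::field_char_0 \<Rightarrow> 'g \<Rightarrow> 'g) \<Rightarrow> 'g \<Rightarrow> 'k form \<Rightarrow> (mono \<Rightarrow> 'g)"
  where "tensor sc v a = (\<lambda>b. sc (form_coeff a b) v)"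

definition ext_space :: "(int \<Rightarrow> 'g::zero set) \<Rightarrow> int \<Rightarrow> (mono \<Rightarrow> 'g) set"
  where "ext_space G d = {\<alpha>. finite (supp \<alpha>) \<and> (\<forall>b. \<alpha> b \<in> G (d - mono_deg b))}"

definition ext_scale :: "('k \<Rightarrow> 'g \<Rightarrow> 'g) \<Rightarrow> 'k \<Rightarrow> (mono \<Rightarrow> 'g) \<Rightarrow> (mono \<Rightarrow> 'g)"
  where "ext_scale sc c \<alpha> = (\<lambda>b. sc c (\<alpha> b))"

text \<open>The operations are extended multilinearly from their values on the $v\otimes b$ with $b$
  a basis form. The signs are $(\mathrm{id}\otimes d)(v\otimes b)=(-1)^{|v|}v\otimes db$ and the
  Koszul sign of $v_1b_1\cdots v_ib_i\mapsto v_1\cdots v_ib_1\cdots b_i$; in an element of degree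
  \<open>d\<close>, the coefficient of $b$ has degree $d-|b|$.\<close>

definition ext_op ::
    "('k::field_char_0 \<Rightarrow> 'g \<Rightarrow> 'g) \<Rightarrow> ((int \<times> 'g) list \<Rightarrow> 'g) \<Rightarrow>
     (int \<times> (mono \<Rightarrow> 'g::comm_monoid_add)) list \<Rightarrow> (mono \<Rightarrow> 'g)"
  where "ext_op sc l xs =
    (case xs of
       [] \<Rightarrow> 0
     | [(d, \<alpha>)] \<Rightarrow>
         (\<Sum>b\<in>supp \<alpha>.
            tensor sc (l [(d - mono_deg b, \<alpha> b)]) (mono_form b)
            + ext_scale sc (psgn (d - mono_deg b)) (tensor sc (\<alpha> b) (form_d (mono_form b))))
     | _ \<Rightarrow>
         (\<Sum>bs\<in>listset (map (\<lambda>x. supp (snd x)) xs).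
            let vs = map2 (\<lambda>x b. (fst x - mono_deg b, snd x b)) xs bs
            in ext_scale sc (koszul_zip (map fst vs) (map mono_deg bs))
                 (tensor sc (l vs) (foldr form_mult (map mono_form bs) (1, 0)))))"

definition vertex_eval ::
    "('k::field_char_0 \<Rightarrow> 'g \<Rightarrow> 'g) \<Rightarrow> 'k \<Rightarrow> (mono \<Rightarrow> 'g::comm_monoid_add) \<Rightarrow> 'g"
  where "vertex_eval sc c \<alpha> = (\<Sum>b\<in>supp \<alpha>. sc (form_eval c (mono_form b)) (\<alpha> b))"


section \<open>The two classes of homotopies\<close>

definition MC1 ::
    "('k::field_char_0, 'a::ab_group_add, 'b::ab_group_add) leib2 \<Rightarrow>
     ('k, 'c::ab_group_add, 'd::ab_group_add) leib2 \<Rightarrow> (mono \<Rightarrow> ('a, 'b, 'c, 'd) conv) set"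
  where "MC1 V W =
    MC (ext_scale (conv_scale W)) (ext_space (conv_space V W)) (ext_op (conv_scale W) (conv_op V W))"

text \<open>A homotopy is recorded together with its source \<open>f\<close>, its target \<open>g\<close> and the algebras
  \<open>V\<close>, \<open>W\<close> between which these are infinity morphisms. The additive groups underlying the
  components of \<open>V\<close> and \<open>W\<close> are types, so the class of all homotopies consists of the following
  sets for all choices of these types.\<close>

type_synonym ('k, 'a, 'b, 'c, 'd, 'h) homotopy =
  "('k, 'a, 'b) leib2 \<times> ('k, 'c, 'd) leib2 \<times>
   ('a, 'b, 'c, 'd) inf_mor \<times> ('a, 'b, 'c, 'd) inf_mor \<times> 'h"

definition inf_homotopies ::
    "('k::field_char_0, 'a::ab_group_add, 'b::ab_group_add, 'c::ab_group_add, 'd::ab_group_add,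
      mono \<Rightarrow> ('a, 'b, 'c, 'd) conv) homotopy set"
  where "inf_homotopies =
    {(V, W, f, g, \<alpha>). leib2_algebra V \<and> leib2_algebra W \<and> inf_morphism V W f \<and> inf_morphism V W g \<and>
       \<alpha> \<in> MC1 V W \<and>
       vertex_eval (conv_scale W) 0 \<alpha> = mor_elem f \<and> vertex_eval (conv_scale W) 1 \<alpha> = mor_elem g}"

definition two_term_homotopies ::
    "('k::field_char_0, 'a::ab_group_add, 'b::ab_group_add, 'c::ab_group_add, 'd::ab_group_add,
      'a \<Rightarrow> 'd) homotopy set"
  where "two_term_homotopies =
    {(V, W, f, g, \<theta>). leib2_algebra V \<and> leib2_algebra W \<and> inf_morphism V W f \<and> inf_morphism V W g \<and>
       two_term_homotopy V W f g \<theta>}"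

end

theory Submission
  imports Defs
begin

text \<open>
  Let $\alpha$ be an \<open>\<infinity>\<close>-homotopy. By degree reasons an element of $L\otimes\Omega_1^\star$ of
  degree $-1$ is a pair $A(t)+B(t)\,dt$, where $A(t)$ has the three components of an infinity
  morphism $f(t)$, with polynomial dependence on $t$, and $B(t)$ is a polynomial family of linear
  maps $b(t):V_0\to W_1$. The part of the Maurer-Cartan equation without $dt$ says that $f(t)$ is an
  infinity morphism for every $t$; the part with $dt$ is the system
  $f_1'=m_1b$ on $V_0$, $f_1'=b\,l_1$ on $V_1$ and
  $f_2'(x,y)=b\,l_2(x,y)-m_2(f_1x,by)-m_2(bx,f_1y)$.

  Put $\beta(t)=\int_0^tb$ and $\theta=\beta(1)$. The first two equations integrate to the first two
  conditions on a 2-term homotopy. Since $f_1(t)=f_1(0)+m_1\beta(t)$ on $V_0$, the integrand of the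
  third equation contains $m_2(m_1\beta x,\beta'y)+m_2(\beta'x,m_1\beta y)$, and the relation
  $m_2(m_1h,k)=m_2(h,m_1k)$ makes this the derivative of $m_2(\beta x,m_1\beta y)$. Its integral
  $m_2(\theta x,m_1\theta y)$ turns $f_1(0)$ into $f_1(1)$ in the last term of the third condition. Hence
  $\alpha\mapsto\theta$ maps \<open>\<infinity>\<close>-homotopies to 2-term homotopies (\<open>homotopy_dt_integral\<close>); it serves
  as $S_1^i$ for both values of $i$.

  For surjectivity, let $\theta:f\Rightarrow g$ be given and take the constant family $b=\theta$. The
  system then has the solution $f(t)$ whose value at $t=c$ is the morphism obtained from $f$ by
  transport along $c\theta$. Transport preserves infinity morphisms (\<open>transport_inf_morphism\<close>), so
  the part of the Maurer-Cartan expression without $dt$ vanishes at every $c$; as the field is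
  infinite, it vanishes as a polynomial (\<open>homotopy_realization\<close>).

  The link between the abstract operations on $L\otimes\Omega_1^\star$ and these formulas is made in
  two ways: evaluation at a point of the interval is a strict morphism of Lie infinity algebras
  (\<open>vertex_eval_ext_op\<close>), and the $dt$-coefficients are computed on words, where the degrees leave
  only the words $x$, $h$, $xy$ to be considered (\<open>ext_curv_dt\<close>).
\<close>

section \<open>Transport of infinity morphisms along 2-term homotopies\<close>

locale leib2_alg =
  fixes V :: "('k::field_char_0, 'a::ab_group_add, 'b::ab_group_add) leib2"
  assumes leib2: "leib2_algebra V"
begin

sublocale v0: vector_space "sc0 V" using leib2 by (simp add: leib2_algebra_def)
sublocale v1: vector_space "sc1 V" using leib2 by (simp add: leib2_algebra_def)

lemma add_simps [simp]:
  "l1 V (h + k) = l1 V h + l1 V k"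
  "l200 V (x + y) z = l200 V x z + l200 V y z" "l200 V x (y + z) = l200 V x y + l200 V x z"
  "l201 V (x + y) h = l201 V x h + l201 V y h" "l201 V x (h + k) = l201 V x h + l201 V x k"
  "l210 V (h + k) x = l210 V h x + l210 V k x" "l210 V h (x + y) = l210 V h x + l210 V h y"
  "l3 V (w + x) y z = l3 V w y z + l3 V x y z" "l3 V x (w + y) z = l3 V x w z + l3 V x y z"
  "l3 V x y (w + z) = l3 V x y w + l3 V x y z"
  using leib2 by (simp_all add: leib2_algebra_def bilin_def trilin_def Vector_Spaces.linear_iff)

lemma scale_simps [simp]:
  "l1 V (sc1 V c h) = sc0 V c (l1 V h)"
  "l200 V (sc0 V c x) y = sc0 V c (l200 V x y)" "l200 V x (sc0 V c y) = sc0 V c (l200 V x y)"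
  "l201 V (sc0 V c x) h = sc1 V c (l201 V x h)" "l201 V x (sc1 V c h) = sc1 V c (l201 V x h)"
  "l210 V (sc1 V c h) x = sc1 V c (l210 V h x)" "l210 V h (sc0 V c x) = sc1 V c (l210 V h x)"
  "l3 V (sc0 V c x) y z = sc1 V c (l3 V x y z)" "l3 V x (sc0 V c y) z = sc1 V c (l3 V x y z)"
  "l3 V x y (sc0 V c z) = sc1 V c (l3 V x y z)"
  using leib2 by (simp_all add: leib2_algebra_def bilin_def trilin_def Vector_Spaces.linear_iff)

lemma zero_simps [simp]:
  "l1 V 0 = 0" "l200 V 0 x = 0" "l200 V x 0 = 0" "l201 V 0 h = 0" "l201 V x 0 = 0"
  "l210 V 0 x = 0" "l210 V h 0 = 0" "l3 V 0 y z = 0" "l3 V x 0 z = 0" "l3 V x y 0 = 0"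
  by (metis add_simps add_0 add_cancel_right_right)+

lemma diff_simps [simp]:
  "l1 V (h - k) = l1 V h - l1 V k"
  "l200 V (x - y) z = l200 V x z - l200 V y z" "l200 V x (y - z) = l200 V x y - l200 V x z"
  "l201 V (x - y) h = l201 V x h - l201 V y h" "l201 V x (h - k) = l201 V x h - l201 V x k"
  "l210 V (h - k) x = l210 V h x - l210 V k x" "l210 V h (x - y) = l210 V h x - l210 V h y"
  by (metis add_simps eq_diff_eq diff_add_cancel)+

lemma relations:
  "l1 V (l201 V x h) = l200 V x (l1 V h)"
  "l1 V (l210 V h x) = l200 V (l1 V h) x"
  "l201 V (l1 V h) k = l210 V h (l1 V k)"
  "l1 V (l3 V x y z) = l200 V x (l200 V y z) - l200 V y (l200 V x z) - l200 V (l200 V x y) z"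
  "l3 V x y (l1 V h) = l201 V x (l201 V y h) - l201 V y (l201 V x h) - l201 V (l200 V x y) h"
  "l3 V x (l1 V h) y = l201 V x (l210 V h y) - l210 V h (l200 V x y) - l210 V (l201 V x h) y"
  "l3 V (l1 V h) x y = l210 V h (l200 V x y) - l201 V x (l210 V h y) - l210 V (l210 V h x) y"
  using leib2 by (simp_all add: leib2_algebra_def)

end

locale leib2_pair = V: leib2_alg V + W: leib2_alg W
  for V :: "('k::field_char_0, 'a::ab_group_add, 'b::ab_group_add) leib2"
    and W :: "('k, 'c::ab_group_add, 'd::ab_group_add) leib2"
begin

text \<open>Every linear $\theta$ starting at a morphism $f$ has a target $g$, determined by the equations of a
  2-term homotopy; the point is that $g$ is again a morphism. In the last condition the terms of
  $m_3(g_1x,g_1y,g_1z)$ that contain some $m_1\theta$ are rewritten by the relations (d), and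
  everything that is not cancelled by the condition for $f$ cancels by $m_2(m_1h,k)=m_2(h,m_1k)$.\<close>

lemma transport_inf_morphism:
  fixes f :: "('a, 'b, 'c, 'd) inf_mor"
  assumes f: "inf_morphism V W f" and \<theta>: "Vector_Spaces.linear (sc0 V) (sc1 W) \<theta>"
    and g0: "\<And>x. f10 g x = f10 f x + l1 W (\<theta> x)"
    and g1: "\<And>h. f11 g h = f11 f h + \<theta> (l1 V h)"
    and g2: "\<And>x y. f2 g x y =
      f2 f x y + \<theta> (l200 V x y) - l201 W (f10 f x) (\<theta> y) - l210 W (\<theta> x) (f10 g y)"
  shows "inf_morphism V W g"
proof -
  have t: "\<theta> (x + y) = \<theta> x + \<theta> y" "\<theta> (sc0 V c x) = sc1 W c (\<theta> x)" for x y c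
    using \<theta> by (simp_all add: Vector_Spaces.linear_iff)
  have td: "\<theta> (x - y) = \<theta> x - \<theta> y" for x y by (metis t(1) eq_diff_eq diff_add_cancel)
  have fl: "f10 f (x + y) = f10 f x + f10 f y" "f10 f (sc0 V c x) = sc0 W c (f10 f x)"
    "f11 f (h + k) = f11 f h + f11 f k" "f11 f (sc1 V c h) = sc1 W c (f11 f h)"
    "f2 f (x + y) z = f2 f x z + f2 f y z" "f2 f z (x + y) = f2 f z x + f2 f z y"
    "f2 f (sc0 V c x) z = sc1 W c (f2 f x z)" "f2 f z (sc0 V c x) = sc1 W c (f2 f z x)"
    for x y z h k c
    using f by (simp_all add: inf_morphism_def bilin_def Vector_Spaces.linear_iff)
  have f_rel:
    "f11 f (l201 V x h) = l201 W (f10 f x) (f11 f h) + f2 f x (l1 V h)"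
    "f11 f (l210 V h x) = l210 W (f11 f h) (f10 f x) + f2 f (l1 V h) x"
    "f10 f (l200 V x y) = l200 W (f10 f x) (f10 f y) + l1 W (f2 f x y)"
    "l1 W (f11 f h) = f10 f (l1 V h)" for x y h
    using f by (simp_all add: inf_morphism_def)
  have f3: "l3 W (f10 f x) (f10 f y) (f10 f z) = f11 f (l3 V x y z) + f2 f (l200 V x y) z
      - f2 f x (l200 V y z) + f2 f y (l200 V x z)
      + l210 W (f2 f x y) (f10 f z) - l201 W (f10 f x) (f2 f y z) + l201 W (f10 f y) (f2 f x z)"
    for x y z
    using f unfolding inf_morphism_def by (simp add: algebra_simps)
  note vs = V.v0.vector_space_axioms V.v1.vector_space_axioms W.v0.vector_space_axioms
    W.v1.vector_space_axioms
  have lin: "Vector_Spaces.linear (sc0 V) (sc0 W) (f10 g)"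
     "Vector_Spaces.linear (sc1 V) (sc1 W) (f11 g)"
     "bilin (sc0 V) (sc0 V) (sc1 W) (f2 g)"
    by (simp_all add: Vector_Spaces.linear_iff bilin_def vs g0 g1 g2 t fl algebra_simps
         W.v0.scale_right_distrib W.v1.scale_right_distrib W.v1.scale_right_diff_distrib)
  show ?thesis
    unfolding inf_morphism_def
  proof (intro conjI allI lin)
    fix h show "l1 W (f11 g h) = f10 g (l1 V h)"
      by (simp add: g0 g1 f_rel)
  next
    fix x y show "l200 W (f10 g x) (f10 g y) + l1 W (f2 g x y) = f10 g (l200 V x y)"
      by (simp add: g0 g2 f_rel W.relations)
  next
    fix x h show "l201 W (f10 g x) (f11 g h) = f11 g (l201 V x h) - f2 g x (l1 V h)"
      by (simp add: g0 g1 g2 f_rel W.relations V.relations)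
  next
    fix x h show "l210 W (f11 g h) (f10 g x) = f11 g (l210 V h x) - f2 g (l1 V h) x"
      using W.relations(3)[of "f11 f h" "\<theta> x"]
      by (simp add: g0 g1 g2 f_rel W.relations V.relations)
  next
    fix x y z show "l3 W (f10 g x) (f10 g y) (f10 g z) - l210 W (f2 g x y) (f10 g z)
       + l201 W (f10 g x) (f2 g y z) - l201 W (f10 g y) (f2 g x z) =
       f11 g (l3 V x y z) + f2 g (l200 V x y) z - f2 g x (l200 V y z) + f2 g y (l200 V x z)"
      using W.relations(3)[of "l201 W (f10 f x) (\<theta> y)" "\<theta> z"]
        W.relations(3)[of "l210 W (\<theta> x) (f10 f y)" "\<theta> z"]
        W.relations(3)[of "l210 W (\<theta> x) (l1 W (\<theta> y))" "\<theta> z"]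
      by (simp add: g0 g1 g2 f_rel f3 W.relations V.relations td t algebra_simps)
  qed
qed

end

section \<open>Linear extension and the codifferential on short words\<close>

context vector_space
begin

lemma lin_ext_superset:
  assumes "finite A" "Poly_Mapping.keys p \<subseteq> A"
  shows "lin_ext scale F p = (\<Sum>b\<in>A. scale (Poly_Mapping.lookup p b) (F b))"
  unfolding lin_ext_def
  by (rule sum.mono_neutral_left) (use assms in \<open>auto simp: in_keys_iff\<close>)

lemma lin_ext_zero [simp]: "lin_ext scale F 0 = 0"
  by (simp add: lin_ext_def)

lemma lin_ext_add: "lin_ext scale F (p + q) = lin_ext scale F p + lin_ext scale F q"
proof -
  let ?A = "Poly_Mapping.keys p \<union> Poly_Mapping.keys q"
  have k: "Poly_Mapping.keys (p + q) \<subseteq> ?A" by (rule keys_add)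
  show ?thesis
    by (subst (1 2 3) lin_ext_superset[where A = ?A])
       (use k in \<open>auto simp: lookup_add scale_left_distrib sum.distrib\<close>)
qed

lemma lin_ext_sum: "lin_ext scale F (\<Sum>i\<in>A. p i) = (\<Sum>i\<in>A. lin_ext scale F (p i))"
  by (induction A rule: infinite_finite_induct) (auto simp: lin_ext_add)

lemma lin_ext_single [simp]: "lin_ext scale F (Poly_Mapping.single b c) = scale c (F b)"
  by (subst lin_ext_superset[where A = "{b}"]) (auto simp: lookup_single)

lemma lin_ext_fscale: "lin_ext scale F (fscale c p) = scale c (lin_ext scale F p)"
  by (subst (1 2) lin_ext_superset[where A = "Poly_Mapping.keys p"])
     (use keys_fscale[of c p] in \<open>auto simp: lookup_fscale scale_sum_right\<close>)

lemma lin_ext_lin_ext: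
  "lin_ext scale F (lin_ext fscale G p) = lin_ext scale (\<lambda>b. lin_ext scale F (G b)) p"
  by (simp add: lin_ext_def[of fscale] lin_ext_sum lin_ext_fscale)
     (simp add: lin_ext_def)

end

lemma lin_ext_cong:
  "(\<And>b. b \<in> Poly_Mapping.keys p \<Longrightarrow> F b = G b) \<Longrightarrow> lin_ext sc F p = lin_ext sc G p"
  by (simp add: lin_ext_def)

lemma unsh_single: "unsh dg [x] F = F [] [x] + F [x] []"
  using unsh_snoc[of dg "[]" x F] by simp

lemma unsh_pair:
  "unsh dg [x, y] F = F [] [x, y] + psgn (dg y * dg x) * F [y] [x] + F [x] [y] + F [x, y] []"
  using unsh_snoc[of dg "[x]" y F] by (simp add: unsh_single)

lemmas unsh_short = unsh_single unsh_pair

lemma zin_coprod_short: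
  fixes x y z :: 'a
  shows "zin_coprod dg [x] = (0 :: _ \<Rightarrow>\<^sub>0 'k::comm_ring_1)"
    and "zin_coprod dg [x, y] = Poly_Mapping.single ([x], [y]) (1 :: 'k)"
    and "zin_coprod dg [x, y, z] =
      Poly_Mapping.single ([x], [y, z]) (1 :: 'k)
      + Poly_Mapping.single ([y], [x, z]) (psgn (dg y * dg x)) + Poly_Mapping.single ([x, y], [z]) 1"
proof -
  have "ev F (zin_coprod dg [x]) = 0" "ev F (zin_coprod dg [x, y]) = F ([x], [y])"
    "ev F (zin_coprod dg [x, y, z]) =
       F ([x], [y, z]) + psgn (dg y * dg x) * F ([y], [x, z]) + F ([x, y], [z])" for F :: "_ \<Rightarrow> 'k"
    using ev_zin_coprod_snoc[of F dg "[]" x] ev_zin_coprod_snoc[of F dg "[x]" y]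
      ev_zin_coprod_snoc[of F dg "[x, y]" z] by (simp_all add: unsh_short)
  then show "zin_coprod dg [x] = (0 :: _ \<Rightarrow>\<^sub>0 'k::comm_ring_1)"
    "zin_coprod dg [x, y] = Poly_Mapping.single ([x], [y]) (1 :: 'k)"
    "zin_coprod dg [x, y, z] =
      Poly_Mapping.single ([x], [y, z]) (1 :: 'k)
      + Poly_Mapping.single ([y], [x, z]) (psgn (dg y * dg x)) + Poly_Mapping.single ([x, y], [z]) 1"
    by (auto intro!: ev_eqI simp: ev_add)
qed

text \<open>Together with the degrees of the codifferential and of the operations, this will reduce all
  identities in $L$ to finitely many shapes of words.\<close>

lemma zin_coprod_keys_deg:
  assumes "p \<in> Poly_Mapping.keys (zin_coprod dg w :: _ \<Rightarrow>\<^sub>0 'k::comm_ring_1)"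
  shows "word_deg dg (fst p) + word_deg dg (snd p) = word_deg dg w"
proof -
  have "Poly_Mapping.lookup (zin_coprod dg w) p = (0 :: 'k)"
    if ne: "word_deg dg (fst p) + word_deg dg (snd p) \<noteq> word_deg dg w"
  proof (cases w rule: rev_cases)
    case (snoc v x)
    have "Poly_Mapping.lookup (zin_coprod dg w) p = 
      unsh dg v (\<lambda>a b. if a = [] then 0 else of_bool ((a, b @ [x]) = p) :: 'k)"
      unfolding ev_lookup[symmetric] snoc ev_zin_coprod_snoc ..
    also have "\<dots> = unsh dg v (\<lambda>a b. 0 * 0)"
      by (rule unsh_cong) (use ne snoc in auto)
    finally show ?thesis unfolding unsh_mult by simp
  qed simp
  then show ?thesis using assms by (auto simp: in_keys_iff)
qed

text \<open>The induction along the last letter runs over pairings with arbitrary functions, because the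
  recursion for the coderivation is a recursion for such pairings.\<close>

lemma coder_keys_deg:
  assumes c: "\<And>w y. y \<in> Poly_Mapping.keys (c w) \<Longrightarrow> dg y = word_deg dg w - 1"
    and u: "u \<in> Poly_Mapping.keys (coder dg c w :: _ \<Rightarrow>\<^sub>0 'k::comm_ring_1)"
  shows "word_deg dg u = word_deg dg w - 1"
proof -
  have "(\<And>u. word_deg dg u = word_deg dg w - 1 \<Longrightarrow> F u = G u) \<Longrightarrow>
      ev F (coder dg c w) = ev G (coder dg c w)" for F G :: "'a list \<Rightarrow> 'k"
  proof (induction w arbitrary: F G rule: rev_induct)
    case (snoc x w)
    have 1: "ev (\<lambda>u. F (u @ [x])) (coder dg c w) = ev (\<lambda>u. G (u @ [x])) (coder dg c w)"
      by (rule snoc.IH) (auto intro!: snoc.prems)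
    have 2: "unsh dg w (\<lambda>a b. psgn (word_deg dg a) * ev (\<lambda>y. F (a @ [y])) (c (b @ [x]))) =
        unsh dg w (\<lambda>a b. psgn (word_deg dg a) * ev (\<lambda>y. G (a @ [y])) (c (b @ [x])))"
    proof (rule unsh_cong)
      fix a b assume ab: "word_deg dg a + word_deg dg b = word_deg dg w"
      have "ev (\<lambda>y. F (a @ [y])) (c (b @ [x])) = ev (\<lambda>y. G (a @ [y])) (c (b @ [x]))"
        by (intro ev_cong snoc.prems) (use ab c[of _ "b @ [x]"] in simp)
      then show "psgn (word_deg dg a) * ev (\<lambda>y. F (a @ [y])) (c (b @ [x])) =
          psgn (word_deg dg a) * ev (\<lambda>y. G (a @ [y])) (c (b @ [x]))" by simp
    qed
    show ?case unfolding ev_coder_snoc 1 2 ..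
  qed simp
  from this[of "\<lambda>b. of_bool (b = u)" "\<lambda>b. 0 * 0"] show ?thesis
    using u unfolding ev_mult ev_lookup by (auto simp: in_keys_iff)
qed

lemma codiff_eq_coder: "codiff V = coder sdeg (corestr V)"
  unfolding codiff_def by (rule the_coderivation_eq(1)) (rule corestr_degree)

lemma sdeg_simps [simp]: "sdeg (Hom0 x) = 1" "sdeg (Hom1 h) = 2"
  by (simp_all add: sdeg_def)

lemma word_sdeg: "word_deg sdeg w = word_deg hdeg w + int (length w)"
  by (induction w) (auto simp: sdeg_def)

lemma codiff_keys_deg:
  assumes "u \<in> Poly_Mapping.keys (codiff V w)"
  shows "word_deg sdeg u = word_deg sdeg w - 1"
  using assms unfolding codiff_eq_coder
proof (rule coder_keys_deg[rotated])
  fix w y assume "y \<in> Poly_Mapping.keys (corestr V w)"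
  then show "sdeg y = word_deg sdeg w - 1"
    by (auto simp: corestr_def Let_def word_sdeg sdeg_def split: if_splits)
qed

text \<open>Only words of degree at most $3$ matter below. The assumptions on $V$ enter since \<open>lmap\<close> adds the
  two mixed components of $l_2$, one of which has a zero argument on a word of two homogeneous
  letters.\<close>

lemma codiff_short:
  fixes V :: "('k::field_char_0, 'a::ab_group_add, 'b::ab_group_add) leib2"
  assumes z: "\<And>x. l201 V x 0 = 0" "\<And>x. l210 V 0 x = 0"
  shows "codiff V [Hom0 x] = 0"
    and "codiff V [Hom1 h] = Poly_Mapping.single [Hom0 (l1 V h)] 1"
    and "codiff V [Hom0 x, Hom0 y] = Poly_Mapping.single [Hom0 (l200 V x y)] 1"
    and "codiff V [Hom0 x, Hom1 k] = Poly_Mapping.single [Hom1 (l201 V x k)] 1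
      + Poly_Mapping.single [Hom0 x, Hom0 (l1 V k)] (- 1)"
    and "codiff V [Hom1 h, Hom0 y] = Poly_Mapping.single [Hom0 (l1 V h), Hom0 y] 1
      + Poly_Mapping.single [Hom1 (l210 V h y)] (- 1)"
    and "codiff V [Hom0 x, Hom0 y, Hom0 z] = Poly_Mapping.single [Hom1 (l3 V x y z)] 1
      + Poly_Mapping.single [Hom0 (l200 V x y), Hom0 z] 1
      + Poly_Mapping.single [Hom0 x, Hom0 (l200 V y z)] (- 1)
      + Poly_Mapping.single [Hom0 y, Hom0 (l200 V x z)] 1"
proof -
  have s: "ev F (codiff V [v]) = ev (\<lambda>y. F [y]) (corestr V [v])"
    "ev F (codiff V [v, w]) = ev (\<lambda>y. F [y, w]) (corestr V [v])
      + (ev (\<lambda>y. F [y]) (corestr V [v, w])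
      + psgn (sdeg v) * ev (\<lambda>y. F [v, y]) (corestr V [w]))"
    "ev F (codiff V [v, w, t]) = ev (\<lambda>u. F (u @ [t])) (codiff V [v, w])
      + unsh sdeg [v, w] (\<lambda>a b. psgn (word_deg sdeg a) * ev (\<lambda>y. F (a @ [y])) (corestr V (b @ [t])))"
    for F v w t
    using ev_coder_snoc[of F sdeg "corestr V" "[]"] ev_coder_snoc[of F sdeg "corestr V" "[v]"]
      ev_coder_snoc[of F sdeg "corestr V" "[v, w]"]
      ev_coder_snoc[of "\<lambda>u. F (u @ [w])" sdeg "corestr V" "[]"]
    by (simp_all add: codiff_eq_coder unsh_short)
  note cs = corestr_def Let_def susp_sign_def psgn_def lessThan_Suc ev_add s unsh_short z
  show "codiff V [Hom0 x] = 0" by (rule ev_eqI) (simp add: cs)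
  show "codiff V [Hom1 h] = Poly_Mapping.single [Hom0 (l1 V h)] 1"
    by (rule ev_eqI) (simp add: cs)
  show "codiff V [Hom0 x, Hom0 y] = Poly_Mapping.single [Hom0 (l200 V x y)] 1"
    by (rule ev_eqI) (simp add: cs)
  show "codiff V [Hom0 x, Hom1 k] = Poly_Mapping.single [Hom1 (l201 V x k)] 1
      + Poly_Mapping.single [Hom0 x, Hom0 (l1 V k)] (- 1)"
    by (rule ev_eqI) (simp add: cs)
  show "codiff V [Hom1 h, Hom0 y] = Poly_Mapping.single [Hom0 (l1 V h), Hom0 y] 1
      + Poly_Mapping.single [Hom1 (l210 V h y)] (- 1)"
    by (rule ev_eqI) (simp add: cs)
  show "codiff V [Hom0 x, Hom0 y, Hom0 z] = Poly_Mapping.single [Hom1 (l3 V x y z)] 1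
      + Poly_Mapping.single [Hom0 (l200 V x y), Hom0 z] 1
      + Poly_Mapping.single [Hom0 x, Hom0 (l200 V y z)] (- 1)
      + Poly_Mapping.single [Hom0 y, Hom0 (l200 V x z)] 1"
    by (rule ev_eqI) (simp add: cs)
qed

section \<open>Multilinearity and degree of the convolution operations\<close>

lemma scW_sel [simp]: "fst (scW W c v) = sc0 W c (fst v)" "snd (scW W c v) = sc1 W c (snd v)"
  by (simp_all add: scW_def)

lemma linearI_sum:
  assumes "\<And>i. i \<in> I \<Longrightarrow> Vector_Spaces.linear s1 s2 (F i)" "vector_space s1" "vector_space s2"
  shows "Vector_Spaces.linear s1 s2 (\<lambda>x. \<Sum>i\<in>I. F i x)"
proof -
  interpret vector_space s2 by (rule assms)
  show ?thesis
    using assms by (simp add: Vector_Spaces.linear_iff sum.distrib scale_sum_right)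
qed

lemma linearI_scale:
  assumes "Vector_Spaces.linear s1 s2 F"
  shows "Vector_Spaces.linear s1 s2 (\<lambda>x. s2 c (F x))"
proof -
  interpret vector_space s2 using assms by (simp add: Vector_Spaces.linear_iff)
  show ?thesis
    using assms by (simp add: Vector_Spaces.linear_iff scale_right_distrib mult.commute)
qed

lemma linearI_add:
  assumes "Vector_Spaces.linear s1 s2 F" "Vector_Spaces.linear s1 s2 G"
  shows "Vector_Spaces.linear s1 s2 (\<lambda>x. F x + G x)"
proof -
  interpret vector_space s2 using assms by (simp add: Vector_Spaces.linear_iff)
  show ?thesis
    using assms by (simp add: Vector_Spaces.linear_iff scale_right_distrib add_ac)
qed

lemma keys_lin_extE:
  assumes "y \<in> Poly_Mapping.keys (lin_ext fscale G p)"
  obtains b where "b \<in> Poly_Mapping.keys p" "y \<in> Poly_Mapping.keys (G b)"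
proof -
  obtain b where "b \<in> Poly_Mapping.keys p"
    "y \<in> Poly_Mapping.keys (fscale (Poly_Mapping.lookup p b) (G b))"
    using subsetD[OF keys_sum assms[unfolded lin_ext_def]] by blast
  then show thesis by (rule that[OF _ subsetD[OF keys_fscale]])
qed

lemma zin_coprod_iter_keys:
  assumes "us \<in> Poly_Mapping.keys (zin_coprod_iter dg n w :: _ \<Rightarrow>\<^sub>0 'k::comm_ring_1)"
  shows "length us = Suc n \<and> sum_list (map (word_deg dg) us) = word_deg dg w"
  using assms
proof (induction n arbitrary: us)
  case 0
  then show ?case by (simp split: if_splits)
next
  case (Suc n)
  obtain ts where ts: "ts \<in> Poly_Mapping.keys (zin_coprod_iter dg n w :: _ \<Rightarrow>\<^sub>0 'k)"
    and us: "us \<in> Poly_Mapping.keys (lin_ext fscale (\<lambda>(a, b). Poly_Mapping.single (a # b # tl ts) 1)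
                 (zin_coprod dg (hd ts)) :: _ \<Rightarrow>\<^sub>0 'k)"
    using Suc.prems unfolding zin_coprod_iter.simps by (rule keys_lin_extE)
  obtain q where q: "q \<in> Poly_Mapping.keys (zin_coprod dg (hd ts) :: _ \<Rightarrow>\<^sub>0 'k)"
    and us: "us \<in> Poly_Mapping.keys (case q of (a, b) \<Rightarrow> Poly_Mapping.single (a # b # tl ts) (1 :: 'k))"
    using us by (rule keys_lin_extE)
  have "us = fst q # snd q # tl ts" using us by (simp add: split_def split: if_splits)
  then show ?case using zin_coprod_keys_deg[OF q] Suc.IH[OF ts] by (cases ts) auto
qed

lemma lmap_short:
  "lmap V [u] = (l1 V (snd u), 0)"
  "lmap V [u, v] = (l200 V (fst u) (fst v), l201 V (fst u) (snd v) + l210 V (snd u) (fst v))"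
  "lmap V [u, v, t] = (0, l3 V (fst u) (fst v) (fst t))"
  by (cases u; cases v; cases t; simp)+

lemma lmap_long: "length vs \<ge> 4 \<Longrightarrow> lmap V vs = 0"
  by (cases "(V, vs)" rule: lmap.cases) auto

context leib2_alg
begin

sublocale vW: vector_space "scW V"
  by unfold_locales (simp_all add: scW_def v0.scale_right_distrib v0.scale_left_distrib
     v1.scale_right_distrib v1.scale_left_distrib)

text \<open>Linearity in an arbitrary slot is proved for lists of any length, so that it can be used under
  the permutations in the convolution operations.\<close>

lemma lmap_linear: "Vector_Spaces.linear (scW V) (scW V) (\<lambda>v. lmap V (us @ v # ts))"
proof -
  have sh: "us = [] \<and> ts = [] \<or> (\<exists>u. us = [u] \<and> ts = []) \<or> (\<exists>t. us = [] \<and> ts = [t])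
    \<or> (\<exists>t r. us = [] \<and> ts = [t, r]) \<or> (\<exists>u t. us = [u] \<and> ts = [t]) \<or> (\<exists>u r. us = [u, r] \<and> ts = [])
    \<or> length us + length ts \<ge> 3"
    by (cases us; cases ts; cases "tl us"; cases "tl ts"; simp add: Suc_le_eq)
  then show ?thesis
    unfolding Vector_Spaces.linear_iff
    by (intro conjI allI vW.vector_space_axioms; elim disjE conjE exE;
       simp add: lmap_short lmap_long prod_eq_iff v1.scale_right_distrib add_ac)
qed
lemma lmap_graded:
  assumes "list_all2 (\<lambda>v n. v \<in> grade n) vs ns"
  shows "lmap V vs \<in> grade (sum_list ns + int (length vs) - 2)"
proof -
  consider "vs = []" | u where "vs = [u]" | u v where "vs = [u, v]" | u v t where "vs = [u, v, t]" | "length vs \<ge> 4"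
    by (cases "(V, vs)" rule: lmap.cases) auto
  then show ?thesis
  proof cases
    case 2 then show ?thesis using assms by (auto simp: grade_def list_all2_Cons1 lmap_short)
  next
    case 3 then show ?thesis using assms by (auto simp: grade_def list_all2_Cons1 lmap_short)
  next
    case 4 then show ?thesis using assms by (auto simp: grade_def list_all2_Cons1 lmap_short)
  qed (auto simp: grade_def lmap_long)
qed

lemma grade_zero [simp]: "0 \<in> grade n"
  by (simp add: grade_def)

lemma grade_add: "u \<in> grade n \<Longrightarrow> v \<in> grade n \<Longrightarrow> u + v \<in> grade n"
  for u v :: "'a \<times> 'b"
  by (auto simp: grade_def)

lemma grade_diff: "u \<in> grade n \<Longrightarrow> v \<in> grade n \<Longrightarrow> u - v \<in> grade n"
  for u v :: "'a \<times> 'b"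
  by (auto simp: grade_def)

lemma grade_scale: "u \<in> grade n \<Longrightarrow> scW V c u \<in> grade n"
  by (auto simp: grade_def)

lemma grade_sum: "(\<And>i. i \<in> I \<Longrightarrow> F i \<in> grade n) \<Longrightarrow> (\<Sum>i\<in>I. F i) \<in> grade n"
  for F :: "'i \<Rightarrow> 'a \<times> 'b"
  by (induction I rule: infinite_finite_induct) (auto intro: grade_add)

lemma grade_lin_ext:
  "(\<And>b. b \<in> Poly_Mapping.keys p \<Longrightarrow> F b \<in> grade n) \<Longrightarrow> lin_ext (scW V) F p \<in> grade n"
  unfolding lin_ext_def by (intro grade_sum grade_scale) auto

end

context leib2_pair
begin

sublocale L: vector_space "conv_scale W"
  by unfold_locales (simp_all add: conv_scale_def fun_eq_iff W.vW.scale_right_distrib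
    W.vW.scale_left_distrib)

lemma linear_convI:
  assumes "\<And>w. Vector_Spaces.linear (conv_scale W) (scW W) (\<lambda>f. F f w)"
  shows "Vector_Spaces.linear (conv_scale W) (conv_scale W) F"
  using assms by (auto simp: Vector_Spaces.linear_iff L.vector_space_axioms conv_scale_def fun_eq_iff)

lemma linear_evalI:
  assumes "Vector_Spaces.linear (scW W) (scW W) G"
  shows "Vector_Spaces.linear (conv_scale W) (scW W) (\<lambda>f. G (f u))"
  using assms by (simp add: Vector_Spaces.linear_iff L.vector_space_axioms conv_scale_def
    del: split_paired_All)

text \<open>The total sign of the term of $\sigma$ in $\mathcal L_p$. It depends on the arguments only through
  their degrees, which separates the signs from the multilinear part.\<close>

definition conv_sign :: "int list \<Rightarrow> (nat \<Rightarrow> nat) \<Rightarrow> ('a, 'b) hom list list \<Rightarrow> 'k"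
  where "conv_sign ds \<sigma> us = koszul_perm ds \<sigma> * of_int (sign \<sigma>) *
    koszul_zip (map (\<lambda>i. ds ! \<sigma> i) [0..<length ds]) (map (word_deg sdeg) us)"

lemma conv_op_single:
  "conv_op V W [(d, f)] =
    (\<lambda>w. lmap W [f w] + scW W (psgn d) (lin_ext (scW W) f (codiff V w)))"
  by (simp add: conv_op_def)

lemma conv_op_ge2:
  assumes "length fs \<ge> 2"
  shows "conv_op V W fs = (\<lambda>w. lin_ext (scW W)
     (\<lambda>us. \<Sum>\<sigma> | \<sigma> permutes {..<length fs}. scW W (conv_sign (map fst fs) \<sigma> us)
        (lmap W (map (\<lambda>i. snd (fs ! \<sigma> i) (us ! i)) [0..<length fs])))
     (zin_coprod_iter sdeg (length fs - 1) w))"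
proof -
  have zip: "koszul_zip (map (\<lambda>i. fst (fs ! \<sigma> i)) [0..<length fs]) = 
      (koszul_zip (map (\<lambda>i. map fst fs ! \<sigma> i) [0..<length fs]) :: _ \<Rightarrow> 'k)"
    if "\<sigma> permutes {..<length fs}" for \<sigma>
    by (intro arg_cong[where f = koszul_zip] map_cong refl)
       (use permutes_in_image[OF that] in auto)
  obtain x y r where "fs = x # y # r"
    using assms by (auto simp: Suc_le_length_iff numeral_2_eq_2)
  then show ?thesis
    unfolding conv_op_def conv_sign_def using zip
    by (auto simp: Let_def split_def fun_eq_iff intro!: lin_ext_cong sum.cong
        simp del: upt_Suc split: prod.splits)
qed

text \<open>Multilinearity of $\mathcal L_p$, for all $p$ at once: a permutation $\sigma$ moves the slot of
  the argument $f$ to the position $j$ with $\sigma(j)$ the index of $f$, and no other position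
  depends on $f$.\<close>

lemma conv_op_linear:
  "Vector_Spaces.linear (conv_scale W) (conv_scale W) (\<lambda>f. conv_op V W (xs @ (d, f) # ys))"
proof (cases "xs = [] \<and> ys = []")
  case True
  have "Vector_Spaces.linear (conv_scale W) (scW W) (\<lambda>f. lmap W [f w])" for w
    using linear_evalI[OF W.lmap_linear[of "[]" "[]"]] by simp
  moreover have "Vector_Spaces.linear (conv_scale W) (scW W) (\<lambda>f. lin_ext (scW W) f p)" for p
    unfolding lin_ext_def
    by (intro linearI_sum linearI_scale L.vector_space_axioms W.vW.vector_space_axioms)
       (simp add: Vector_Spaces.linear_iff L.vector_space_axioms W.vW.vector_space_axioms
          conv_scale_def del: split_paired_All)
  ultimately show ?thesis
    using True by (auto simp: conv_op_single intro!: linear_convI linearI_add linearI_scale)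
next
  case False
  let ?fs = "\<lambda>f. xs @ (d, f) # ys"
  let ?p = "length xs + Suc (length ys)"
  have len: "length (?fs f) \<ge> 2" for f using False by (cases xs; cases ys) auto
  have slot: "Vector_Spaces.linear (conv_scale W) (scW W)
      (\<lambda>f. lmap W (map (\<lambda>i. snd (?fs f ! \<sigma> i) (us ! i)) [0..<?p]))"
    if \<sigma>: "\<sigma> permutes {..<?p}" for \<sigma> us
  proof -
    obtain j where j: "\<sigma> j = length xs" using \<sigma> by (metis permutes_def)
    have jp: "j < ?p" using permutes_in_image[OF \<sigma>, of j] j by simp
    \<comment> \<open>The value $0$ in the slot of $f$ is a dummy: it is not read at the positions other than $j$.\<close>
    let ?m = "\<lambda>i. snd (?fs 0 ! \<sigma> i) (us ! i)"
    have upt: "[0..<?p] = [0..<j] @ j # [Suc j..<?p]"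
      using jp upt_add_eq_append[of 0 j "?p - j"] upt_conv_Cons[of j ?p] by (simp del: upt_Suc)
    have other: "snd (?fs f ! \<sigma> i) (us ! i) = ?m i" if "i \<noteq> j" for i f
    proof -
      have "\<sigma> i \<noteq> length xs" using that j permutes_inj[OF \<sigma>] by (metis injD)
      then show ?thesis by (auto simp: nth_append nth_Cons')
    qed
    have "map (\<lambda>i. snd (?fs f ! \<sigma> i) (us ! i)) [0..<?p] =
        map ?m [0..<j] @ f (us ! j) # map ?m [Suc j..<?p]" for f
      unfolding upt map_append list.map
      by (intro arg_cong2[where f = append] arg_cong2[where f = Cons] map_cong refl other)
         (auto simp: j simp del: upt_Suc)
    then show ?thesis
      using linear_evalI[OF W.lmap_linear[of "map ?m [0..<j]" "map ?m [Suc j..<?p]"]] by (simp only:)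
  qed
  show ?thesis
    unfolding conv_op_ge2[OF len] lin_ext_def length_append length_Cons map_append list.map fst_conv
    by (intro linear_convI linearI_sum linearI_scale slot L.vector_space_axioms
       W.vW.vector_space_axioms) simp
qed

text \<open>The operation $\mathcal L_p$ has degree $p-2$. As $W$ lives in degrees $0$ and $1$, a
  Maurer-Cartan expression vanishes automatically on all words except those of two degrees.\<close>

lemma conv_op_graded:
  assumes fs: "\<And>d f u. (d, f) \<in> set fs \<Longrightarrow> f u \<in> grade (word_deg sdeg u + d)"
  shows "conv_op V W fs w \<in> grade (word_deg sdeg w + sum_list (map fst fs) + int (length fs) - 2)"
proof (cases "length fs \<ge> 2")
  case False
  then have "fs = [] \<or> (\<exists>x. fs = [x])" by (cases fs; cases "tl fs"; simp add: Suc_le_eq)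
  then consider "fs = []" | d f where "fs = [(d, f)]" by (metis surj_pair)
  then show ?thesis
  proof cases
    case 1 then show ?thesis by (simp add: conv_op_def)
  next
    case 2
    have f: "f u \<in> grade (word_deg sdeg u + d)" for u using fs 2 by auto
    have "lmap W [f w] \<in> grade (word_deg sdeg w + d - 1)"
      using W.lmap_graded[of "[f w]" "[word_deg sdeg w + d]"] f by simp
    moreover have "lin_ext (scW W) f (codiff V w) \<in> grade (word_deg sdeg w + d - 1)"
    proof (rule W.grade_lin_ext)
      fix b assume "b \<in> Poly_Mapping.keys (codiff V w)"
      then show "f b \<in> grade (word_deg sdeg w + d - 1)"
        using f[of b] by (simp add: codiff_keys_deg algebra_simps)
    qed
    ultimately show ?thesis
      by (simp add: 2 conv_op_single W.grade_add W.grade_scale)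
  qed
next
  case True
  let ?p = "length fs"
  show ?thesis
    unfolding conv_op_ge2[OF True]
  proof (intro W.grade_lin_ext W.grade_sum W.grade_scale)
    fix us \<sigma>
    assume us: "us \<in> Poly_Mapping.keys (zin_coprod_iter sdeg (?p - 1) w :: _ \<Rightarrow>\<^sub>0 'k)"
      and "\<sigma> \<in> {\<sigma>. \<sigma> permutes {..<?p}}"
    then have \<sigma>: "\<sigma> permutes {..<?p}" by simp
    have us: "length us = ?p" "sum_list (map (word_deg sdeg) us) = word_deg sdeg w"
      using zin_coprod_iter_keys[OF us] True by auto
    let ?vs = "map (\<lambda>i. snd (fs ! \<sigma> i) (us ! i)) [0..<?p]"
    let ?ns = "map (\<lambda>i. word_deg sdeg (us ! i) + fst (fs ! \<sigma> i)) [0..<?p]"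
    have "list_all2 (\<lambda>v n. v \<in> grade n) ?vs ?ns"
    proof (rule list_all2_all_nthI)
      fix i assume "i < length ?vs"
      then have i: "i < ?p" by simp
      then have "fs ! \<sigma> i \<in> set fs" using permutes_in_image[OF \<sigma>, of i] by simp
      then show "?vs ! i \<in> grade (?ns ! i)" using i fs[of "fst (fs ! \<sigma> i)" "snd (fs ! \<sigma> i)"] by simp
    qed simp
    note W.lmap_graded[OF this]
    moreover have "sum_list ?ns = word_deg sdeg w + sum_list (map fst fs)"
    proof -
      have "sum_list ?ns = (\<Sum>i<?p. word_deg sdeg (us ! i)) + (\<Sum>i<?p. fst (fs ! \<sigma> i))"
        by (simp add: interv_sum_list_conv_sum_set_nat sum.distrib lessThan_atLeast0)
      also have "(\<Sum>i<?p. fst (fs ! \<sigma> i)) = (\<Sum>i<?p. fst (fs ! i))"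
        using sum.permute[OF \<sigma>, of "\<lambda>i. fst (fs ! i)"] by (simp add: o_def)
      finally show ?thesis
        using us by (simp add: sum_list_sum_nth lessThan_atLeast0)
    qed
    ultimately show "lmap W ?vs \<in> grade (word_deg sdeg w + sum_list (map fst fs) + int ?p - 2)"
      by simp
  qed
qed

lemma conv_op_long: "length fs \<ge> 4 \<Longrightarrow> conv_op V W fs = 0"
  by (subst conv_op_ge2) (auto simp: lmap_long fun_eq_iff lin_ext_def)

end

section \<open>The convolution operations on short words\<close>

text \<open>An element of $L_0$ is determined by a map $V_0\to W_1$, in the same way as an element of $L_{-1}$
  by the components of an infinity morphism.\<close>

fun hty_elem :: "('a \<Rightarrow> 'd) \<Rightarrow> ('a, 'b, 'c::zero, 'd::zero) conv"
  where
    "hty_elem \<theta> [Hom0 x] = (0, \<theta> x)"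
  | "hty_elem \<theta> _ = 0"

lemma word_sdeg_ge: "word_deg sdeg w \<ge> int (length w)"
proof (induction w)
  case (Cons v w)
  then show ?case by (cases v) auto
qed simp

text \<open>A letter $sx$ has degree $1$ and a letter $sh$ degree $2$.\<close>

lemma word_sdeg_le_3_cases:
  obtains (deg0) "w = []" | (deg1) x where "w = [Hom0 x]"
    | (deg2) x y where "w = [Hom0 x, Hom0 y]" | (deg2') h where "w = [Hom1 h]"
    | (deg3) x y z where "w = [Hom0 x, Hom0 y, Hom0 z]"
    | (deg3') x h where "w = [Hom0 x, Hom1 h]" | (deg3'') h x where "w = [Hom1 h, Hom0 x]"
    | (deg_ge_4) "word_deg sdeg w \<ge> 4"
proof (cases w)
  case Nil then show ?thesis by (rule deg0)
next
  case v: (Cons v w1)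
  show ?thesis
  proof (cases w1)
    case Nil
    then show ?thesis using v deg1 deg2' by (cases v) auto
  next
    case u: (Cons u w2)
    show ?thesis
    proof (cases w2)
      case Nil
      show ?thesis
      proof (cases v; cases u)
        fix h k assume "v = Hom1 h" "u = Hom1 k"
        then show ?thesis using Nil v u by (intro deg_ge_4) simp
      qed (use Nil v u deg2 deg3' deg3'' in auto)
    next
      case t: (Cons t w3)
      show ?thesis
      proof (cases "word_deg sdeg w \<ge> 4")
        case False
        then have "w3 = []"
          using v u t word_sdeg_ge[of w3] by (cases v; cases u; cases t; cases w3) auto
        then show ?thesis using False v u t deg3 by (cases v; cases u; cases t) auto
      qed (rule deg_ge_4)
    qed
  qed
qed

lemma grade_eq_zero: "v \<in> grade n \<Longrightarrow> n \<noteq> 0 \<Longrightarrow> n \<noteq> 1 \<Longrightarrow> v = 0"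
  by (auto simp: grade_def prod_eq_iff)

lemma mor_elem_graded: "mor_elem f u \<in> grade (word_deg sdeg u - 1)"
  by (cases "(f, u)" rule: mor_elem.cases) (auto simp: grade_def)

lemma hty_elem_graded: "hty_elem \<theta> u \<in> grade (word_deg sdeg u)"
  by (cases "(\<theta>, u)" rule: hty_elem.cases) (auto simp: grade_def)

lemma fst_hty_elem [simp]: "fst (hty_elem \<theta> u) = 0"
  by (cases "(\<theta>, u)" rule: hty_elem.cases) auto

lemma koszul_perm_2:
  "koszul_perm [d, e] \<sigma> = (if \<sigma> 1 < \<sigma> 0 then psgn ([d, e] ! \<sigma> 0 * [d, e] ! \<sigma> 1) else 1 :: 'k::comm_ring_1)"
proof -
  have "{(i, j). i < j \<and> j < length [d, e] \<and> \<sigma> j < \<sigma> i} = (if \<sigma> 1 < \<sigma> 0 then {(0, 1)} else {})"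
    by (auto simp: less_Suc_eq)
  then show ?thesis unfolding koszul_perm_def by simp
qed

lemma koszul_zip_2: "koszul_zip [d, e] [m, n] = psgn (m * e)"
proof -
  have "{(i, j). i < j \<and> j < length [d, e]} = {(0, 1)}"
    by (auto simp: less_Suc_eq)
  then show ?thesis unfolding koszul_zip_def by simp
qed

lemma pairs_3: "{(i, j). i < j \<and> j < (3::nat)} = {(0, 1), (0, 2), (1, 2)}"
  by (auto simp: less_Suc_eq numeral_3_eq_3)

lemma koszul_perm_3:
  assumes "length ds = 3"
  shows "koszul_perm ds \<sigma> = (if \<sigma> 1 < \<sigma> 0 then psgn (ds ! \<sigma> 0 * ds ! \<sigma> 1) else 1)
    * (if \<sigma> 2 < \<sigma> 0 then psgn (ds ! \<sigma> 0 * ds ! \<sigma> 2) else 1)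
    * (if \<sigma> 2 < \<sigma> 1 then psgn (ds ! \<sigma> 1 * ds ! \<sigma> 2) else 1 :: 'k::comm_ring_1)"
proof -
  let ?F = "\<lambda>(i, j). psgn (ds ! \<sigma> i * ds ! \<sigma> j) :: 'k"
  have "koszul_perm ds \<sigma> = prod ?F {p \<in> {(i, j). i < j \<and> j < (3::nat)}. case p of (i, j) \<Rightarrow> \<sigma> j < \<sigma> i}"
    unfolding koszul_perm_def assms by (intro prod.cong) auto
  also have "\<dots> = (\<Prod>p\<in>{(0, 1), (0, 2), (1, 2)}. if (case p of (i, j) \<Rightarrow> \<sigma> j < \<sigma> i) then ?F p else 1)"
    unfolding pairs_3 by (intro prod.inter_filter) simp
  finally show ?thesis by (simp add: mult.assoc)
qed

lemma koszul_zip_3: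
  "koszul_zip [d, e, c] [m, n, r] = (psgn (m * e) * psgn (m * c) * psgn (n * c) :: 'k::comm_ring_1)"
proof -
  have "length [d, e, c] = 3" by simp
  then show ?thesis unfolding koszul_zip_def by (simp only: pairs_3) (simp add: mult.assoc)
qed

lemma sum_permutes_2: "(\<Sum>\<sigma> | \<sigma> permutes {..<2::nat}. F \<sigma>) = F id + F (transpose 0 1)"
proof -
  have "{..<2} = insert 0 (insert (1::nat) {})" by auto
  then show ?thesis
    by (simp add: sum_over_permutations_insert del: insert_absorb)
qed

lemma sum_permutes_3:
  "(\<Sum>\<sigma> | \<sigma> permutes {..<3::nat}. F \<sigma>) = F id + F (transpose 1 2)
    + (F (transpose 0 1) + F (transpose 0 1 \<circ> transpose 1 2))
    + (F (transpose 0 2) + F (transpose 0 2 \<circ> transpose 1 2))"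
proof -
  have "{..<3} = insert 0 (insert 1 (insert (2::nat) {}))" by auto
  then show ?thesis
    by (simp add: sum_over_permutations_insert add.assoc)
qed

lemma lin_ext_fscale_simps:
  fixes p q :: "'x \<Rightarrow>\<^sub>0 'k::comm_ring_1" and G :: "'x \<Rightarrow> ('y \<Rightarrow>\<^sub>0 'k)"
  shows "lin_ext fscale G (p + q) = lin_ext fscale G p + lin_ext fscale G q"
    and "lin_ext fscale G (Poly_Mapping.single x c) = fscale c (G x)"
    and "lin_ext fscale G (fscale c p) = fscale c (lin_ext fscale G p)"
    and "lin_ext fscale G 0 = 0" "fscale 1 p = p" "fscale c 0 = (0 :: 'x \<Rightarrow>\<^sub>0 'k)"
  by (rule ev_eqI; simp add: ev_lin_ext ev_add ev_fscale)+

context leib2_pair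
begin

lemma conv_op_pair:
  "conv_op V W [(d, f), (e, g)] w = lin_ext (scW W)
     (\<lambda>(a, b). scW W (psgn (word_deg sdeg a * e)) (lmap W [f a, g b])
       + scW W (- psgn (d * e + word_deg sdeg a * d)) (lmap W [g a, f b])) (zin_coprod sdeg w)"
proof -
  have it: "zin_coprod_iter sdeg (Suc 0) w =
      lin_ext fscale (\<lambda>(a, b). Poly_Mapping.single [a, b] 1) (zin_coprod sdeg w)"
    by (simp add: lin_ext_fscale_simps)
  have s: "(\<Sum>\<sigma> | \<sigma> permutes {..<Suc (Suc 0)}. F \<sigma>) = F id + F (transpose 0 1)"
    for F :: "_ \<Rightarrow> 'c \<times> 'd"
    using sum_permutes_2[of F] by (simp add: numeral_2_eq_2)
  have "conv_sign [d, e] id [a, b] = psgn (word_deg sdeg a * e)"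
    "conv_sign [d, e] (transpose 0 1) [a, b] = - psgn (d * e + word_deg sdeg a * d)" for a b
    by (simp_all add: conv_sign_def koszul_perm_2 koszul_zip_2 sign_swap_id psgn_add mult.commute)
  then show ?thesis
    by (subst conv_op_ge2)
       (simp_all add: it W.vW.lin_ext_lin_ext s split_def del: zin_coprod_iter.simps)
qed

text \<open>The map $m_3$ only sees $V_0$-components. So a ternary operation vanishes as soon as one of its
  arguments takes values in $W_1$, in particular if it is the coefficient of a $dt$.\<close>

lemma conv_op_triple_zero:
  assumes "k < 3" "\<And>u. fst (snd ([p, q, r] ! k) u) = 0"
  shows "conv_op V W [p, q, r] = 0"
proof -
  have "lmap W (map (\<lambda>i. snd ([p, q, r] ! \<sigma> i) (us ! i)) [0..<3]) = 0"
    if \<sigma>: "\<sigma> permutes {..<3}" for \<sigma> us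
  proof -
    obtain i where i: "\<sigma> i = k" using \<sigma> by (metis permutes_def)
    have "i < 3" using permutes_in_image[OF \<sigma>, of i] i assms(1) by simp
    then have "i = 0 \<or> i = 1 \<or> i = 2" by auto
    then show ?thesis using assms(2) i
      by (auto simp: numeral_3_eq_3 lmap_short numeral_2_eq_2 zero_prod_def)
  qed
  then show ?thesis
    by (subst conv_op_ge2) (auto simp: fun_eq_iff lin_ext_def numeral_3_eq_3)
qed

text \<open>For arguments of odd degree the Koszul sign of a permutation cancels its signature, so all six
  permutations contribute equally; the remaining sign comes from moving three maps of degree $-1$
  past letters of degree $1$.\<close>

lemma conv_op_triple_same:
  "conv_op V W [(- 1, f), (- 1, f), (- 1, f)] [Hom0 x, Hom0 y, Hom0 z] =
    scW W (- 6) (lmap W [f [Hom0 x], f [Hom0 y], f [Hom0 z]])"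
proof -
  let ?us = "[[Hom0 x], [Hom0 y], [Hom0 z]] :: ('a, 'b) hom list list"
  have it: "zin_coprod_iter sdeg 2 [Hom0 x, Hom0 y, Hom0 z] = Poly_Mapping.single ?us (1 :: 'k)"
    by (simp add: numeral_2_eq_2 zin_coprod_short lin_ext_fscale_simps)
  have sum: "(\<Sum>\<sigma> | \<sigma> permutes {..<3}. conv_sign [- 1, - 1, - 1] \<sigma> ?us) = - 6"
    by (simp add: sum_permutes_3 conv_sign_def koszul_perm_3 koszul_zip_3 upt_rec numeral_2_eq_2
       psgn_def sign_compose permutation_swap_id sign_swap_id)
  have m: "map (\<lambda>i. snd ([(- 1 :: int, f), (- 1, f), (- 1, f)] ! \<sigma> i) (?us ! i)) [0..<3] =
      [f [Hom0 x], f [Hom0 y], f [Hom0 z]]" if \<sigma>: "\<sigma> permutes {..<3}" for \<sigma>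
  proof -
    have "\<sigma> i < 3" if "i < 3" for i using permutes_in_image[OF \<sigma>, of i] that by simp
    then have "snd ([(- 1 :: int, f), (- 1, f), (- 1, f)] ! \<sigma> i) = f" if "i < 3" for i
      using that by (fastforce simp: less_Suc_eq numeral_3_eq_3)
    then show ?thesis by (simp add: numeral_3_eq_3 numeral_2_eq_2)
  qed
  have "conv_op V W [(- 1, f), (- 1, f), (- 1, f)] [Hom0 x, Hom0 y, Hom0 z] =
      (\<Sum>\<sigma> | \<sigma> permutes {..<3}. scW W (conv_sign [- 1, - 1, - 1] \<sigma> ?us)
        (lmap W (map (\<lambda>i. snd ([(- 1 :: int, f), (- 1, f), (- 1, f)] ! \<sigma> i) (?us ! i)) [0..<3])))"
    using it by (subst conv_op_ge2) (simp_all add: numeral_3_eq_3 numeral_2_eq_2 del: zin_coprod_iter.simps upt_Suc)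
  also have "\<dots> = (\<Sum>\<sigma> | \<sigma> permutes {..<3}. scW W (conv_sign [- 1, - 1, - 1] \<sigma> ?us)
        (lmap W [f [Hom0 x], f [Hom0 y], f [Hom0 z]]))"
    by (intro sum.cong refl) (simp only: mem_Collect_eq m)
  also have "\<dots> = scW W (- 6) (lmap W [f [Hom0 x], f [Hom0 y], f [Hom0 z]])"
    by (simp only: sum W.vW.scale_sum_left[symmetric])
  finally show ?thesis .
qed

text \<open>By degree reasons, no words of other shapes than those here and in the next lemma can contribute
  to a Maurer-Cartan expression.\<close>

lemma conv_op_elem_single:
  fixes f :: "('a, 'b, 'c, 'd) inf_mor" and \<theta> :: "'a \<Rightarrow> 'd"
  defines "M \<equiv> conv_op V W [(- 1, mor_elem f)]" and "N \<equiv> conv_op V W [(0, hty_elem \<theta>)]"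
  shows "M [Hom1 h] = (l1 W (f11 f h) - f10 f (l1 V h), 0)"
    and "M [Hom0 x, Hom0 y] = (l1 W (f2 f x y) - f10 f (l200 V x y), 0)"
    and "M [Hom0 x, Hom1 h] = (0, f2 f x (l1 V h) - f11 f (l201 V x h))"
    and "M [Hom1 h, Hom0 x] = (0, f11 f (l210 V h x) - f2 f (l1 V h) x)"
    and "M [Hom0 x, Hom0 y, Hom0 z] = (0, f2 f x (l200 V y z) - f2 f y (l200 V x z)
      - f2 f (l200 V x y) z - f11 f (l3 V x y z))"
    and "N [Hom0 x] = (l1 W (\<theta> x), 0)"
    and "N [Hom1 h] = (0, \<theta> (l1 V h))"
    and "N [Hom0 x, Hom0 y] = (0, \<theta> (l200 V x y))"
  by (simp_all add: M_def N_def conv_op_single codiff_short lmap_short W.vW.lin_ext_add psgn_def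
     prod_eq_iff)

lemma conv_op_elem_pair:
  fixes f :: "('a, 'b, 'c, 'd) inf_mor" and \<theta> :: "'a \<Rightarrow> 'd"
  defines "M \<equiv> conv_op V W [(- 1, mor_elem f), (- 1, mor_elem f)]"
    and "N \<equiv> conv_op V W [(- 1, mor_elem f), (0, hty_elem \<theta>)]"
    and "P \<equiv> conv_op V W [(0, hty_elem \<theta>), (- 1, mor_elem f)]"
  shows "M [Hom0 x] = 0" "M [Hom1 h] = 0"
    and "M [Hom0 x, Hom0 y] = scW W (- 2) (l200 W (f10 f x) (f10 f y), 0)"
    and "M [Hom0 x, Hom1 h] = scW W (- 2) (0, l201 W (f10 f x) (f11 f h))"
    and "M [Hom1 h, Hom0 x] = scW W 2 (0, l210 W (f11 f h) (f10 f x))"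
    and "M [Hom0 x, Hom0 y, Hom0 z] = scW W 2 (0, l210 W (f2 f x y) (f10 f z)
      + l201 W (f10 f y) (f2 f x z) - l201 W (f10 f x) (f2 f y z))"
    and "N [Hom0 x] = 0" "N [Hom1 h] = 0"
    and "N [Hom0 x, Hom0 y] = (0, l201 W (f10 f x) (\<theta> y) + l210 W (\<theta> x) (f10 f y))"
    and "P [Hom0 x] = 0" "P [Hom1 h] = 0"
    and "P [Hom0 x, Hom0 y] = (0, - l201 W (f10 f x) (\<theta> y) - l210 W (\<theta> x) (f10 f y))"
proof -
  have two: "sc0 W 2 v = v + v" "sc1 W 2 h = h + h" for v h
    using W.v0.scale_left_distrib[of 1 1 v] W.v1.scale_left_distrib[of 1 1 h] by simp_all
  show "M [Hom0 x] = 0" "M [Hom1 h] = 0"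
    "M [Hom0 x, Hom0 y] = scW W (- 2) (l200 W (f10 f x) (f10 f y), 0)"
    "M [Hom0 x, Hom1 h] = scW W (- 2) (0, l201 W (f10 f x) (f11 f h))"
    "M [Hom1 h, Hom0 x] = scW W 2 (0, l210 W (f11 f h) (f10 f x))"
    "M [Hom0 x, Hom0 y, Hom0 z] = scW W 2 (0, l210 W (f2 f x y) (f10 f z)
      + l201 W (f10 f y) (f2 f x z) - l201 W (f10 f x) (f2 f y z))"
    "N [Hom0 x] = 0" "N [Hom1 h] = 0"
    "N [Hom0 x, Hom0 y] = (0, l201 W (f10 f x) (\<theta> y) + l210 W (\<theta> x) (f10 f y))"
    "P [Hom0 x] = 0" "P [Hom1 h] = 0"
    "P [Hom0 x, Hom0 y] = (0, - l201 W (f10 f x) (\<theta> y) - l210 W (\<theta> x) (f10 f y))"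
    by (simp_all add: M_def N_def P_def conv_op_pair zin_coprod_short lmap_short W.vW.lin_ext_add
       psgn_def prod_eq_iff two)
qed

end

section \<open>Extension of scalars to polynomial forms\<close>

text \<open>The left side of the Maurer-Cartan equation, for operations that vanish in arity at least
  $4$.\<close>

definition mc_curv ::
    "('k::field_char_0 \<Rightarrow> 'g \<Rightarrow> 'g) \<Rightarrow> ((int \<times> 'g) list \<Rightarrow> 'g::comm_monoid_add) \<Rightarrow> 'g \<Rightarrow> 'g"
  where "mc_curv sc l \<alpha> = (\<Sum>i\<in>{1, 2, 3}.
    sc (1 / fact i * (- 1) ^ (i * (i - 1) div 2)) (l (replicate i (- 1, \<alpha>))))"

lemma supp_T_TdT:
  assumes "finite (supp \<alpha>)"
  obtains N where "supp \<alpha> \<subseteq> T ` {..N} \<union> TdT ` {..N}"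
proof -
  have "finite (T -` supp \<alpha>)" "finite (TdT -` supp \<alpha>)"
    using assms by (auto intro!: finite_vimageI simp: inj_on_def)
  then obtain M N where "T -` supp \<alpha> \<subseteq> {..M}" "TdT -` supp \<alpha> \<subseteq> {..N}"
    by (meson finite_nat_iff_bounded_le)
  then have b: "n \<le> max M N" if "T n \<in> supp \<alpha> \<or> TdT n \<in> supp \<alpha>" for n
    using that by (auto simp: le_max_iff_disj)
  have "supp \<alpha> \<subseteq> T ` {..max M N} \<union> TdT ` {..max M N}"
  proof
    fix m assume "m \<in> supp \<alpha>"
    then show "m \<in> T ` {..max M N} \<union> TdT ` {..max M N}" using b by (cases m) blast+
  qed
  then show thesis by (rule that)
qed

lemma sum_T_TdT: "(\<Sum>b\<in>T ` {..N} \<union> TdT ` {..N}. F b) = (\<Sum>i\<le>N. F (T i)) + (\<Sum>i\<le>N. F (TdT i))"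
  by (subst sum.union_disjoint) (auto simp: sum.reindex inj_on_def)

lemma sum_set_Cons: "(\<Sum>bs\<in>set_Cons B C. F bs) = (\<Sum>b\<in>B. \<Sum>bs\<in>C. F (b # bs))"
proof -
  have "set_Cons B C = (\<lambda>(b, bs). b # bs) ` (B \<times> C)" by (auto simp: set_Cons_def)
  then show ?thesis
    by (simp add: sum.reindex inj_on_def sum.cartesian_product split_def)
qed

lemma sum_listset_pair: "(\<Sum>bs\<in>listset [A, B]. F bs) = (\<Sum>a\<in>A. \<Sum>b\<in>B. F [a, b])"
  by (simp add: sum_set_Cons del: set_Cons_sing_Nil)

lemma sum_listset_triple:
  "(\<Sum>bs\<in>listset [A, B, C]. F bs) = (\<Sum>a\<in>A. \<Sum>b\<in>B. \<Sum>c\<in>C. F [a, b, c])"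
  by (simp add: sum_set_Cons del: set_Cons_sing_Nil)

lemma sum_fun_apply: "(\<Sum>i\<in>I. F i) x = (\<Sum>i\<in>I. F i x)"
  by (induction I rule: infinite_finite_induct) auto

lemma form_coeff_mono: "form_coeff (mono_form b) m = (of_bool (b = m) :: 'k::field_char_0)"
  by (cases b; cases m) auto

lemma form_eval_mono: "form_eval c (mono_form b) = (case b of T n \<Rightarrow> c ^ n | TdT n \<Rightarrow> 0)"
  by (cases b) (auto simp: form_eval_def poly_monom)

lemma form_eval_d [simp]: "form_eval c (form_d a) = 0"
  by (simp add: form_eval_def form_d_def)

lemma form_coeff_d_mono:
  "form_coeff (form_d (mono_form b)) (TdT n) =
    (if b = T (Suc n) then of_nat (Suc n) else 0 :: 'k::field_char_0)"
  by (cases b) (auto simp: form_d_def pderiv_monom)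

lemma form_eval_prod:
  "form_eval c (foldr form_mult as (1, 0)) = prod_list (map (form_eval c) as)"
  by (induction as) (auto simp: form_eval_def form_mult_def)

locale vector_space_char_0 = vector_space scale
  for scale :: "'k::field_char_0 \<Rightarrow> 'g::ab_group_add \<Rightarrow> 'g"
begin

lemma vertex_eval_superset:
  assumes "finite B" "supp \<beta> \<subseteq> B"
  shows "vertex_eval scale c \<beta> = (\<Sum>b\<in>B. scale (form_eval c (mono_form b)) (\<beta> b))"
  unfolding vertex_eval_def
  by (rule sum.mono_neutral_left) (use assms in \<open>auto simp: supp_def\<close>)

lemma supp_zero [simp]: "supp 0 = {}"
  by (simp add: supp_def)

lemma finite_supp_add: "finite (supp \<alpha>) \<Longrightarrow> finite (supp \<beta>) \<Longrightarrow> finite (supp (\<alpha> + \<beta>))"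
  for \<alpha> \<beta> :: "mono \<Rightarrow> 'g"
  by (rule finite_subset[of _ "supp \<alpha> \<union> supp \<beta>"]) (auto simp: supp_def)

lemma finite_supp_sum: "(\<And>i. i \<in> I \<Longrightarrow> finite (supp (F i))) \<Longrightarrow> finite (supp (\<Sum>i\<in>I. F i))"
  for F :: "'i \<Rightarrow> mono \<Rightarrow> 'g"
  by (induction I rule: infinite_finite_induct) (auto intro: finite_supp_add)

lemma finite_supp_scale: "finite (supp \<alpha>) \<Longrightarrow> finite (supp (ext_scale scale c \<alpha>))"
  by (rule finite_subset[of _ "supp \<alpha>"]) (auto simp: supp_def ext_scale_def)

lemma supp_tensor:
  "supp (tensor scale v a) \<subseteq> T ` {..degree (fst a)} \<union> TdT ` {..degree (snd a)}"
proof
  fix b assume "b \<in> supp (tensor scale v a)"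
  then have "form_coeff a b \<noteq> 0" by (auto simp: supp_def tensor_def)
  then show "b \<in> T ` {..degree (fst a)} \<union> TdT ` {..degree (snd a)}"
    by (cases b) (auto simp: le_degree)
qed

lemma finite_supp_tensor: "finite (supp (tensor scale v a))"
  by (rule finite_subset[OF supp_tensor]) simp

lemma vertex_eval_add:
  assumes "finite (supp \<alpha>)" "finite (supp \<beta>)"
  shows "vertex_eval scale c (\<alpha> + \<beta>) = vertex_eval scale c \<alpha> + vertex_eval scale c \<beta>"
  by (subst (1 2 3) vertex_eval_superset[of "supp \<alpha> \<union> supp \<beta>"])
     (use assms in \<open>auto simp: supp_def scale_right_distrib sum.distrib\<close>)

lemma vertex_eval_zero [simp]: "vertex_eval scale c 0 = 0"
  by (simp add: vertex_eval_def supp_def)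

lemma vertex_eval_sum:
  assumes "\<And>i. i \<in> I \<Longrightarrow> finite (supp (F i))"
  shows "vertex_eval scale c (\<Sum>i\<in>I. F i) = (\<Sum>i\<in>I. vertex_eval scale c (F i))"
  using assms
  by (induction I rule: infinite_finite_induct) (auto simp: vertex_eval_add finite_supp_sum)

lemma vertex_eval_scale:
  assumes "finite (supp \<alpha>)"
  shows "vertex_eval scale c (ext_scale scale r \<alpha>) = scale r (vertex_eval scale c \<alpha>)"
  by (subst (1 2) vertex_eval_superset[of "supp \<alpha>"])
     (use assms in \<open>auto simp: supp_def ext_scale_def scale_sum_right mult.commute\<close>)

lemma vertex_eval_tensor: "vertex_eval scale c (tensor scale v a) = scale (form_eval c a) v"
proof -
  let ?N = "max (degree (fst a)) (degree (snd a))"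
  have "supp (tensor scale v a) \<subseteq> T ` {..?N} \<union> TdT ` {..?N}"
    using supp_tensor[of v a] by auto
  then have "vertex_eval scale c (tensor scale v a) =
      (\<Sum>i\<le>?N. scale (c ^ i) (scale (coeff (fst a) i) v))"
    by (subst vertex_eval_superset) (auto simp: sum_T_TdT form_eval_mono tensor_def)
  also have "\<dots> = scale (\<Sum>i\<le>?N. coeff (fst a) i * c ^ i) v"
    by (simp add: scale_sum_left mult.commute)
  also have "(\<Sum>i\<le>?N. coeff (fst a) i * c ^ i) = form_eval c a"
    unfolding form_eval_def poly_altdef
    by (rule sum.mono_neutral_right) (auto simp: coeff_eq_0)
  finally show ?thesis .
qed

lemma finite_supp_ext_op:
  "finite (supp (ext_op scale l xs))"
  unfolding ext_op_def Let_def
  by (auto split: list.splits prod.splits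
      intro!: finite_supp_sum finite_supp_add finite_supp_scale finite_supp_tensor)

end

text \<open>Only multilinearity of the operations is needed to extend scalars and to evaluate.\<close>

locale multilinear_ops = vector_space_char_0 scale
  for scale :: "'k::field_char_0 \<Rightarrow> 'g::ab_group_add \<Rightarrow> 'g" +
  fixes l :: "(int \<times> 'g) list \<Rightarrow> 'g"
  assumes slot: "Vector_Spaces.linear scale scale (\<lambda>x. l (xs @ (d, x) # ys))"
begin

lemma slot_zero: "l (xs @ (d, 0) # ys) = 0"
  using slot[of xs d ys] by (auto simp: Vector_Spaces.linear_iff dest: spec[of _ 0])

lemma slot_sum: "l (xs @ (d, \<Sum>b\<in>B. scale (\<phi> b) (\<alpha> b)) # ys) = (\<Sum>b\<in>B. scale (\<phi> b) (l (xs @ (d, \<alpha> b) # ys)))"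
  using slot[of xs d ys] slot_zero
  by (induction B rule: infinite_finite_induct) (auto simp: Vector_Spaces.linear_iff)

text \<open>The expansion of a product of sums, one slot after the other; the list \<open>xs\<close> holds the slots that
  are already expanded.\<close>

lemma multilinear_expand:
  "(\<Sum>bs\<in>listset (replicate n B). scale (prod_list (map \<phi> bs)) (l (xs @ map (\<lambda>b. (d, \<alpha> b)) bs))) =
    l (xs @ replicate n (d, \<Sum>b\<in>B. scale (\<phi> b) (\<alpha> b)))"
proof (induction n arbitrary: xs)
  case (Suc n)
  have "(\<Sum>bs\<in>listset (replicate (Suc n) B).
        scale (prod_list (map \<phi> bs)) (l (xs @ map (\<lambda>b. (d, \<alpha> b)) bs))) =
      (\<Sum>b\<in>B. scale (\<phi> b) (\<Sum>bs\<in>listset (replicate n B).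
        scale (prod_list (map \<phi> bs)) (l ((xs @ [(d, \<alpha> b)]) @ map (\<lambda>b. (d, \<alpha> b)) bs))))"
    by (simp add: sum_set_Cons scale_sum_right)
  also have "\<dots> = l (xs @ replicate (Suc n) (d, \<Sum>b\<in>B. scale (\<phi> b) (\<alpha> b)))"
    unfolding Suc.IH by (simp add: slot_sum)
  finally show ?case .
qed simp

text \<open>Evaluation at $t=c$ is a homomorphism from the forms to the field that kills $dt$ and the image of
  $d$. It therefore commutes with the operations; all signs disappear because only coefficients of
  forms of degree $0$ survive.\<close>

lemma vertex_eval_ext_op:
  assumes fin: "finite (supp \<alpha>)" and "n \<ge> 1"
  shows "vertex_eval scale c (ext_op scale l (replicate n (- 1, \<alpha>))) =
    l (replicate n (- 1, vertex_eval scale c \<alpha>))"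
proof (cases "n = 1")
  case True
  have "vertex_eval scale c (ext_op scale l [(- 1, \<alpha>)]) =
      (\<Sum>b\<in>supp \<alpha>. scale (form_eval c (mono_form b)) (l [(- 1 - mono_deg b, \<alpha> b)]))"
    unfolding ext_op_def
    by (simp add: vertex_eval_sum vertex_eval_add vertex_eval_scale finite_supp_add
       finite_supp_scale finite_supp_tensor vertex_eval_tensor)
  also have "\<dots> = (\<Sum>b\<in>supp \<alpha>. scale (form_eval c (mono_form b)) (l ([] @ [(- 1, \<alpha> b)])))"
  proof (rule sum.cong[OF refl])
    fix b
    show "scale (form_eval c (mono_form b)) (l [(- 1 - mono_deg b, \<alpha> b)]) =
      scale (form_eval c (mono_form b)) (l ([] @ [(- 1, \<alpha> b)]))"
      by (cases b) (simp_all add: form_eval_def)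
  qed
  also have "\<dots> = l [(- 1, vertex_eval scale c \<alpha>)]"
    unfolding vertex_eval_def using slot_sum[of "[]" "- 1" "\<lambda>b. form_eval c (mono_form b)" \<alpha> "supp \<alpha>" "[]"]
    by simp
  finally show ?thesis by (simp add: True)
next
  case False
  with \<open>n \<ge> 1\<close> obtain k where n: "n = Suc (Suc k)" by (metis One_nat_def Suc_le_D le_antisym not_less_eq_eq)
  let ?vs = "\<lambda>bs. map2 (\<lambda>x b. (fst x - mono_deg b, snd x b)) (replicate n (- 1, \<alpha>)) bs"
  let ?\<phi> = "\<lambda>b. form_eval c (mono_form b)"
  let ?F = "\<lambda>bs. foldr form_mult (map mono_form bs) (1, 0) :: 'k form"
  let ?z = "\<lambda>bs. koszul_zip (map fst (?vs bs)) (map mono_deg bs) :: 'k"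
  have "ext_op scale l (replicate n (- 1, \<alpha>)) = (\<Sum>bs\<in>listset (replicate n (supp \<alpha>)).
      ext_scale scale (?z bs) (tensor scale (l (?vs bs)) (?F bs)))"
    by (simp add: n ext_op_def Let_def)
  then have "vertex_eval scale c (ext_op scale l (replicate n (- 1, \<alpha>))) =
      (\<Sum>bs\<in>listset (replicate n (supp \<alpha>)). scale (?z bs * prod_list (map ?\<phi> bs)) (l (?vs bs)))"
    by (simp add: vertex_eval_sum vertex_eval_scale finite_supp_scale finite_supp_tensor
       vertex_eval_tensor form_eval_prod o_def)
  also have "\<dots> = (\<Sum>bs\<in>listset (replicate n (supp \<alpha>)).
      scale (prod_list (map ?\<phi> bs)) (l ([] @ map (\<lambda>b. (- 1, \<alpha> b)) bs)))"
  proof (rule sum.cong[OF refl])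
    fix bs assume "bs \<in> listset (replicate n (supp \<alpha>))"
    then have len: "length bs = n"
      by (induction n arbitrary: bs) (auto simp: set_Cons_def)
    show "scale (?z bs * prod_list (map ?\<phi> bs)) (l (?vs bs)) =
      scale (prod_list (map ?\<phi> bs)) (l ([] @ map (\<lambda>b. (- 1, \<alpha> b)) bs))"
    proof (cases "\<forall>b\<in>set bs. mono_deg b = 0")
      case True
      have "?vs bs = map (\<lambda>b. (- 1, \<alpha> b)) bs"
        by (rule nth_equalityI) (use True len in auto)
      moreover have "?z bs = 1"
        unfolding koszul_zip_def by (rule prod.neutral) (use True len in auto)
      ultimately show ?thesis by simp
    next
      case False
      then obtain b where b: "b \<in> set bs" "mono_deg b \<noteq> 0" by blast
      have "?\<phi> b = 0" using b(2) by (cases b) (simp_all add: form_eval_def)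
      with b(1) have "0 \<in> set (map ?\<phi> bs)"
        unfolding set_map by (intro image_eqI[of _ _ b]) simp_all
      then have "prod_list (map ?\<phi> bs) = 0" by (simp only: prod_list_zero_iff)
      then show ?thesis by simp
    qed
  qed
  also have "\<dots> = l (replicate n (- 1, vertex_eval scale c \<alpha>))"
    unfolding multilinear_expand vertex_eval_def by simp
  finally show ?thesis .
qed

lemma vertex_eval_mc_curv:
  assumes fin: "finite (supp \<alpha>)"
  shows "vertex_eval scale c (mc_curv (ext_scale scale) (ext_op scale l) \<alpha>) =
    mc_curv scale l (vertex_eval scale c \<alpha>)"
  unfolding mc_curv_def
  by (subst vertex_eval_sum)
     (auto simp: vertex_eval_scale finite_supp_scale finite_supp_ext_op vertex_eval_ext_op[OF fin]
       intro!: sum.cong simp del: replicate.simps)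

text \<open>The minus sign is the one of $\mathrm{id}\otimes d$ on a coefficient of degree $-1$.\<close>

lemma ext_op_single_dt:
  assumes fin: "finite (supp \<alpha>)"
  shows "ext_op scale l [(- 1, \<alpha>)] (TdT n) =
    l [(0, \<alpha> (TdT n))] - scale (of_nat (Suc n)) (\<alpha> (T (Suc n)))"
proof -
  have delta: "(\<Sum>b\<in>supp \<alpha>. if b = m then G b else 0) = (if m \<in> supp \<alpha> then G m else 0)"
    for m and G :: "mono \<Rightarrow> 'g"
    using fin by (simp add: sum.delta)
  have "ext_op scale l [(- 1, \<alpha>)] (TdT n) =
      (\<Sum>b\<in>supp \<alpha>. if b = TdT n then l [(- 1 - mono_deg b, \<alpha> b)] else 0)
      + (\<Sum>b\<in>supp \<alpha>. if b = T (Suc n)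
           then scale (psgn (- 1 - mono_deg b) * of_nat (Suc n)) (\<alpha> b) else 0)"
    by (auto simp: ext_op_def sum_fun_apply tensor_def ext_scale_def form_coeff_mono form_coeff_d_mono
        sum.distrib[symmetric] simp del: form_coeff.simps intro!: sum.cong)
  also have "\<dots> = l [(0, \<alpha> (TdT n))] - scale (of_nat (Suc n)) (\<alpha> (T (Suc n)))"
    unfolding delta using slot_zero[of "[]" 0 "[]"] by (auto simp: supp_def psgn_def scale_minus_left[symmetric] simp del: scale_minus_left)
  finally show ?thesis .
qed

text \<open>A $dt$-coefficient arises from one factor without and one factor with $dt$. If the factor with
  $dt$ comes first, the form of degree $-1$ moves past a coefficient of degree $-1$, which gives the
  minus sign.\<close>

lemma ext_op_pair_dt:
  assumes N: "supp \<alpha> \<subseteq> T ` {..N} \<union> TdT ` {..N}"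
  shows "ext_op scale l [(- 1, \<alpha>), (- 1, \<alpha>)] (TdT n) =
    (\<Sum>i\<le>N. \<Sum>j\<le>N. if i + j = n
       then l [(- 1, \<alpha> (T i)), (0, \<alpha> (TdT j))] - l [(0, \<alpha> (TdT j)), (- 1, \<alpha> (T i))] else 0)"
proof -
  let ?B = "T ` {..N} \<union> TdT ` {..N}"
  let ?d = "\<lambda>b. - 1 - mono_deg b"
  let ?G = "\<lambda>b c. scale (psgn (mono_deg b * ?d c) * form_coeff (form_mult (mono_form b) (mono_form c)) (TdT n))
    (l [(?d b, \<alpha> b), (?d c, \<alpha> c)])"
  have one: "form_mult a (1, 0) = a" for a :: "'k form"
    by (simp add: form_mult_def)
  have "ext_op scale l [(- 1, \<alpha>), (- 1, \<alpha>)] (TdT n) = (\<Sum>b\<in>supp \<alpha>. \<Sum>c\<in>supp \<alpha>. ?G b c)"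
    by (simp add: ext_op_def sum_fun_apply tensor_def ext_scale_def Let_def sum_listset_pair
       koszul_zip_2 one del: listset.simps)
  also have "\<dots> = (\<Sum>b\<in>?B. \<Sum>c\<in>?B. ?G b c)"
  proof -
    have "?G b c = 0" if "b \<notin> supp \<alpha> \<or> c \<notin> supp \<alpha>" for b c
      using that slot_zero[of "[]" _ "[_]"] slot_zero[of "[_]" _ "[]"] by (auto simp: supp_def)
    then show ?thesis
      by (intro sum.mono_neutral_cong_left ballI sum.neutral) (use N in auto)
  qed
  also have "\<dots> = (\<Sum>i\<le>N. \<Sum>j\<le>N. ?G (T i) (TdT j)) + (\<Sum>j\<le>N. \<Sum>i\<le>N. ?G (TdT j) (T i))"
    unfolding sum_T_TdT by (simp add: form_mult_def)
  also have "(\<Sum>j\<le>N. \<Sum>i\<le>N. ?G (TdT j) (T i)) = (\<Sum>i\<le>N. \<Sum>j\<le>N. ?G (TdT j) (T i))"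
    by (rule sum.swap)
  also have "(\<Sum>i\<le>N. \<Sum>j\<le>N. ?G (T i) (TdT j)) + (\<Sum>i\<le>N. \<Sum>j\<le>N. ?G (TdT j) (T i)) =
      (\<Sum>i\<le>N. \<Sum>j\<le>N. ?G (T i) (TdT j) + ?G (TdT j) (T i))"
    by (simp add: sum.distrib)
  also have "\<dots> = (\<Sum>i\<le>N. \<Sum>j\<le>N. if i + j = n
       then l [(- 1, \<alpha> (T i)), (0, \<alpha> (TdT j))] - l [(0, \<alpha> (TdT j)), (- 1, \<alpha> (T i))] else 0)"
    by (intro sum.cong refl) (simp add: form_mult_def mult_monom psgn_def add.commute)
  finally show ?thesis .
qed

text \<open>The hypothesis is what the vanishing of a ternary operation on coefficients of $dt$ provides.\<close>

lemma ext_op_triple_dt: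
  assumes l0: "\<And>p q r k n. k < 3 \<Longrightarrow> snd ([p, q, r] ! k) = \<alpha> (TdT n) \<Longrightarrow> l [p, q, r] = 0"
  shows "ext_op scale l [(- 1, \<alpha>), (- 1, \<alpha>), (- 1, \<alpha>)] (TdT n) = 0"
proof -
  let ?d = "\<lambda>b. - 1 - mono_deg b"
  have "scale (form_coeff (form_mult (mono_form a) (form_mult (mono_form b) (form_mult (mono_form c) (1, 0))))
      (TdT n)) (l [(?d a, \<alpha> a), (?d b, \<alpha> b), (?d c, \<alpha> c)]) = 0" for a b c
  proof (cases "\<exists>k<3. \<exists>n. [a, b, c] ! k = TdT n")
    case True
    then obtain k n where k: "k < 3" "[a, b, c] ! k = TdT n" by blast
    then have "snd ([(?d a, \<alpha> a), (?d b, \<alpha> b), (?d c, \<alpha> c)] ! k) = \<alpha> (TdT n)"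
      by (auto simp: less_Suc_eq numeral_3_eq_3)
    from l0[OF k(1) this] show ?thesis by simp
  next
    case False
    from False[simplified, rule_format, of 0] False[simplified, rule_format, of 1]
      False[simplified, rule_format, of 2]
    obtain i j k where "a = T i" "b = T j" "c = T k"
      by (cases a; cases b; cases c) auto
    then show ?thesis by (simp add: form_mult_def)
  qed
  then have "scale (r * form_coeff (form_mult (mono_form a) (form_mult (mono_form b)
      (form_mult (mono_form c) (1, 0)))) (TdT n)) (l [(?d a, \<alpha> a), (?d b, \<alpha> b), (?d c, \<alpha> c)]) = 0"
    for a b c r
    by (metis scale_scale scale_zero_right)
  then show ?thesis
    by (simp add: ext_op_def sum_fun_apply tensor_def ext_scale_def Let_def sum_listset_triple
      del: listset.simps form_coeff.simps scale_eq_0_iff)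
qed

end

section \<open>The Maurer-Cartan equation\<close>

lemma mc_curv_expand:
  assumes "vector_space sc"
  shows "mc_curv sc l \<alpha> = l [(- 1, \<alpha>)] + sc (- (1 / 2)) (l [(- 1, \<alpha>), (- 1, \<alpha>)])
    + sc (- (1 / 6)) (l [(- 1, \<alpha>), (- 1, \<alpha>), (- 1, \<alpha>)])"
proof -
  interpret vector_space sc by fact
  have 3: "replicate 3 x = [x, x, x]" for x :: 'x by (simp add: numeral_3_eq_3)
  have 2: "replicate 2 x = [x, x]" for x :: 'x by (simp add: numeral_2_eq_2)
  show ?thesis by (simp add: mc_curv_def 2 3 fact_numeral add.assoc)
qed

text \<open>The operations of arity at least $4$ vanish, so the sum over the nonvanishing terms is the sum
  over the arities $1$, $2$, $3$.\<close>

lemma MC_iff: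
  assumes "vector_space sc" and long: "\<And>i. i \<ge> 4 \<Longrightarrow> l (replicate i (- 1, \<alpha>)) = 0"
  shows "\<alpha> \<in> MC sc G l \<longleftrightarrow> \<alpha> \<in> G (- 1) \<and> mc_curv sc l \<alpha> = 0"
proof -
  interpret vector_space sc by fact
  have "(\<Sum>i | 1 \<le> i \<and> l (replicate i (- 1, \<alpha>)) \<noteq> 0.
      sc (1 / fact i * (- 1) ^ (i * (i - 1) div 2)) (l (replicate i (- 1, \<alpha>)))) = mc_curv sc l \<alpha>"
    unfolding mc_curv_def
  proof (rule sum.mono_neutral_left)
    show "{i. 1 \<le> i \<and> l (replicate i (- 1, \<alpha>)) \<noteq> 0} \<subseteq> {1, 2, 3}"
    proof
      fix i assume "i \<in> {i. 1 \<le> i \<and> l (replicate i (- 1, \<alpha>)) \<noteq> 0}"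
      then have "1 \<le> i" "\<not> 4 \<le> i" using long by auto
      then show "i \<in> {1, 2, 3}" by auto
    qed
  qed auto
  then show ?thesis by (simp add: MC_def)
qed

lemma (in multilinear_ops) ext_op_long:
  assumes "\<And>xs. length xs \<ge> 4 \<Longrightarrow> l xs = 0" "n \<ge> 4"
  shows "ext_op scale l (replicate n (- 1, \<alpha>)) = 0"
proof -
  obtain k where n: "n = Suc (Suc k)" using \<open>n \<ge> 4\<close> by (intro that[of "n - 2"]) simp
  have "length bs = n" if "bs \<in> listset (replicate n (supp \<alpha>))" for bs
    using that by (induction n arbitrary: bs) (auto simp: set_Cons_def)
  then have "l (map2 (\<lambda>x b. (fst x - mono_deg b, snd x b)) (replicate n (- 1, \<alpha>)) bs) = 0"
    if "bs \<in> listset (replicate n (supp \<alpha>))" for bs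
    using that assms by simp
  then have "(\<Sum>bs\<in>listset (replicate n (supp \<alpha>)).
      ext_scale scale (koszul_zip (map fst (map2 (\<lambda>x b. (fst x - mono_deg b, snd x b)) (replicate n (- 1, \<alpha>)) bs)) (map mono_deg bs))
        (tensor scale (l (map2 (\<lambda>x b. (fst x - mono_deg b, snd x b)) (replicate n (- 1, \<alpha>)) bs))
          (foldr form_mult (map mono_form bs) (1, 0)))) = 0"
    by (intro sum.neutral ballI) (simp add: ext_scale_def tensor_def fun_eq_iff)
  then show ?thesis by (simp add: n ext_op_def Let_def)
qed

lemma ext_scale_vector_space:
  assumes "vector_space sc"
  shows "vector_space (ext_scale sc)"
proof -
  interpret vector_space sc by fact
  show ?thesis
    by unfold_locales (auto simp: ext_scale_def fun_eq_iff scale_right_distrib scale_left_distrib)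
qed

context leib2_pair
begin

sublocale ops: multilinear_ops "conv_scale W" "conv_op V W"
  by (intro multilinear_ops.intro vector_space_char_0.intro L.vector_space_axioms
      multilinear_ops_axioms.intro conv_op_linear)

abbreviation "curv \<equiv> mc_curv (conv_scale W) (conv_op V W)"
abbreviation "ext_curv \<equiv> mc_curv (ext_scale (conv_scale W)) (ext_op (conv_scale W) (conv_op V W))"

lemma MC1_iff: "\<alpha> \<in> MC1 V W \<longleftrightarrow> \<alpha> \<in> ext_space (conv_space V W) (- 1) \<and> ext_curv \<alpha> = 0"
  unfolding MC1_def
  by (intro MC_iff ext_scale_vector_space L.vector_space_axioms ops.ext_op_long conv_op_long)

text \<open>A word of length at most $2$ has no nontrivial decomposition into three words.\<close>

lemma conv_op_triple_short:
  assumes "length w \<le> 2"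
  shows "conv_op V W [p, q, r] w = 0"
proof -
  have "w = [] \<or> (\<exists>x. w = [x]) \<or> (\<exists>x y. w = [x, y])"
    using assms by (cases w; cases "tl w"; simp)
  then have "zin_coprod_iter sdeg 2 w = (0 :: _ \<Rightarrow>\<^sub>0 'k)"
    by (elim disjE exE) (simp_all add: numeral_2_eq_2 zin_coprod_short lin_ext_fscale_simps)
  then show ?thesis
    by (subst conv_op_ge2) (simp_all add: numeral_2_eq_2 del: zin_coprod_iter.simps)
qed

text \<open>On each of the five shapes of words in degrees $2$ and $3$ the Maurer-Cartan expression is one of
  the five conditions on an infinity morphism.\<close>

lemma curv_mor_elem:
  assumes f: "inf_morphism V W f"
  shows "curv (mor_elem f) = 0"
proof
  fix w
  have gr: "conv_op V W (replicate n (- 1, mor_elem f)) w \<in> grade (word_deg sdeg w - 2)" for n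
    using conv_op_graded[of "replicate n (- 1, mor_elem f)" w] mor_elem_graded[of f]
    by (auto simp: sum_list_replicate)
  have grade: "curv (mor_elem f) w \<in> grade (word_deg sdeg w - 2)"
    unfolding mc_curv_def sum_fun_apply conv_scale_def
    by (intro W.grade_sum W.grade_scale gr)
  note e = mc_curv_expand[OF L.vector_space_axioms] conv_scale_def conv_op_elem_single
    conv_op_elem_pair conv_op_triple_same conv_op_triple_short lmap_short prod_eq_iff
  note f = f[unfolded inf_morphism_def]
  show "curv (mor_elem f) w = 0 w"
  proof (cases w rule: word_sdeg_le_3_cases)
    case (deg2 x y)
    have "l200 W (f10 f x) (f10 f y) + l1 W (f2 f x y) = f10 f (l200 V x y)" using f by blast
    then show ?thesis by (simp add: deg2 e algebra_simps)
  next
    case (deg2' h)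
    have "l1 W (f11 f h) = f10 f (l1 V h)" using f by blast
    then show ?thesis by (simp add: deg2' e)
  next
    case (deg3 x y z)
    have "l3 W (f10 f x) (f10 f y) (f10 f z) - l210 W (f2 f x y) (f10 f z)
       + l201 W (f10 f x) (f2 f y z) - l201 W (f10 f y) (f2 f x z) =
       f11 f (l3 V x y z) + f2 f (l200 V x y) z - f2 f x (l200 V y z) + f2 f y (l200 V x z)"
      using f by blast
    then show ?thesis by (simp add: deg3 e algebra_simps)
  next
    case (deg3' x h)
    have "l201 W (f10 f x) (f11 f h) = f11 f (l201 V x h) - f2 f x (l1 V h)" using f by blast
    then show ?thesis by (simp add: deg3' e)
  next
    case (deg3'' h x)
    have "l210 W (f11 f h) (f10 f x) = f11 f (l210 V h x) - f2 f (l1 V h) x" using f by blast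
    then show ?thesis by (simp add: deg3'' e)
  qed (use grade_eq_zero[OF grade] in auto)
qed

end

section \<open>The components of a homotopy\<close>

lemma mor_elem_long: "length w \<ge> 3 \<Longrightarrow> mor_elem f w = 0"
  by (cases "(f, w)" rule: mor_elem.cases) auto

lemma hty_elem_long: "length w \<ge> 2 \<Longrightarrow> hty_elem \<theta> w = 0"
  by (cases "(\<theta>, w)" rule: hty_elem.cases) auto

context vector_space_char_0
begin

text \<open>This is $\int_0^1(\beta_1'\beta_2+\beta_1\beta_2')\,dt=\beta_1(1)\beta_2(1)$ in coefficients: the
  monomials $t^{k+1}$ and $t^{j+1}$ yield the weight $(j+1)/(k+j+2)$, and the weights of $(k,j)$ and
  $(j,k)$ add up to $1$.\<close>

lemma sum_symmetrize:
  "(\<Sum>k\<le>N. \<Sum>j\<le>N. scale (of_nat (Suc j) / of_nat (Suc k + Suc j)) (P k j + P j k)) =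
    (\<Sum>k\<le>N. \<Sum>j\<le>N. P k j)"
proof -
  let ?r = "\<lambda>k j. of_nat (Suc j) / of_nat (Suc k + Suc j) :: 'k"
  have r: "?r k j + ?r j k = 1" for k j
  proof -
    have "?r k j + ?r j k = of_nat (Suc k + Suc j) / of_nat (Suc k + Suc j)"
      by (simp only: add_divide_distrib of_nat_add add.commute)
    also have "\<dots> = 1" by (metis add_Suc divide_self of_nat_neq_0)
    finally show ?thesis .
  qed
  have "(\<Sum>k\<le>N. \<Sum>j\<le>N. scale (?r k j) (P k j + P j k)) =
      (\<Sum>k\<le>N. \<Sum>j\<le>N. scale (?r k j) (P k j)) + (\<Sum>k\<le>N. \<Sum>j\<le>N. scale (?r k j) (P j k))"
    by (simp only: scale_right_distrib sum.distrib)
  also have "(\<Sum>k\<le>N. \<Sum>j\<le>N. scale (?r k j) (P j k)) = (\<Sum>k\<le>N. \<Sum>j\<le>N. scale (?r j k) (P k j))"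
    by (rule sum.swap)
  finally show ?thesis
    by (simp only: sum.distrib[symmetric] scale_left_distrib[symmetric] r scale_one)
qed

text \<open>If $p(c)=\sum_{i\le N+1}c^iv_i$ vanishes identically, then so does $p(2c)-2^{N+1}p(c)$, which has
  lower degree and the coefficients $(2^i-2^{N+1})v_i$; the factors are nonzero in characteristic
  zero.\<close>

lemma coeffs_zero_if_poly_zero:
  assumes "\<And>c. (\<Sum>i\<le>N. scale (c ^ i) (v i)) = 0" "i \<le> N"
  shows "v i = 0"
  using assms
proof (induction N arbitrary: v i)
  case 0
  then show ?case using "0.prems"(1)[of 1] by simp
next
  case (Suc N)
  have ne: "(2 :: 'k) ^ i - 2 ^ Suc N \<noteq> 0" if "i \<le> N" for i
  proof -
    have "(of_nat (2 ^ i) :: 'k) \<noteq> of_nat (2 ^ Suc N)"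
      using that by (simp only: of_nat_eq_iff power_inject_exp)
    then show ?thesis by simp
  qed
  have "(\<Sum>i\<le>N. scale (c ^ i) (scale (2 ^ i - 2 ^ Suc N) (v i))) = 0" for c
  proof -
    have "(\<Sum>i\<le>N. scale (c ^ i) (scale (2 ^ i - 2 ^ Suc N) (v i))) =
        (\<Sum>i\<le>Suc N. scale (c ^ i) (scale (2 ^ i - 2 ^ Suc N) (v i)))"
      by simp
    also have "\<dots> = (\<Sum>i\<le>Suc N. scale ((2 * c) ^ i) (v i)) - scale (2 ^ Suc N) (\<Sum>i\<le>Suc N. scale (c ^ i) (v i))"
      by (simp only: scale_sum_right sum_subtractf[symmetric] scale_scale scale_left_diff_distrib[symmetric]
          power_mult_distrib right_diff_distrib mult.commute)
    also have "\<dots> = 0" unfolding Suc.prems(1) by simp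
    finally show ?thesis .
  qed
  then have "scale (2 ^ i - 2 ^ Suc N) (v i) = 0" if "i \<le> N" for i
    using Suc.IH[of "\<lambda>i. scale (2 ^ i - 2 ^ Suc N) (v i)"] that by blast
  then have low: "v i = 0" if "i \<le> N" for i using ne[OF that] that by (metis scale_eq_0_iff)
  then have "v (Suc N) = 0" using Suc.prems(1)[of 1] by simp
  then show ?case using low Suc.prems(2) by (cases "i = Suc N") auto
qed

lemma vertex_eval_sum_T:
  assumes "supp \<alpha> \<subseteq> T ` {..N} \<union> TdT ` {..N}"
  shows "vertex_eval scale c \<alpha> = (\<Sum>i\<le>N. scale (c ^ i) (\<alpha> (T i)))"
  using assms by (subst vertex_eval_superset) (auto simp: sum_T_TdT form_eval_mono)

lemma T_coeff_zero_if_vertex_evals_zero: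
  assumes fin: "finite (supp \<alpha>)" and 0: "\<And>c. vertex_eval scale c \<alpha> = 0"
  shows "\<alpha> (T n) = 0"
proof -
  obtain N where N: "supp \<alpha> \<subseteq> T ` {..N} \<union> TdT ` {..N}" using supp_T_TdT[OF fin] .
  show ?thesis
  proof (cases "n \<le> N")
    case True
    then show ?thesis
      by (intro coeffs_zero_if_poly_zero[where N = N and v = "\<lambda>i. \<alpha> (T i)"]) (simp_all flip: vertex_eval_sum_T[OF N] add: 0)
  next
    case False
    then have "T n \<notin> supp \<alpha>" using N by auto
    then show ?thesis by (simp add: supp_def)
  qed
qed

end

context leib2_pair
begin

text \<open>The system of differential equations for $f(t)$ and $b(t)$, coefficient by coefficient. The two
  orders of the arguments of the binary operation contribute the same, which cancels the factor
  $\frac12$ of the Maurer-Cartan equation.\<close>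

lemma ext_curv_dt:
  fixes F :: "nat \<Rightarrow> ('a, 'b, 'c, 'd) inf_mor"
  assumes N: "supp \<alpha> \<subseteq> T ` {..N} \<union> TdT ` {..N}"
    and mor: "\<And>n. \<alpha> (T n) = mor_elem (F n)" and hty: "\<And>n. \<alpha> (TdT n) = hty_elem (b n)"
  shows "ext_curv \<alpha> (TdT n) [Hom0 x] =
      (l1 W (b n x) - sc0 W (of_nat (Suc n)) (f10 (F (Suc n)) x), 0)"
    and "ext_curv \<alpha> (TdT n) [Hom1 h] =
      (0, b n (l1 V h) - sc1 W (of_nat (Suc n)) (f11 (F (Suc n)) h))"
    and "ext_curv \<alpha> (TdT n) [Hom0 x, Hom0 y] =
      (0, b n (l200 V x y) - sc1 W (of_nat (Suc n)) (f2 (F (Suc n)) x y)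
        - (\<Sum>i\<le>N. \<Sum>j\<le>N. if i + j = n
             then l201 W (f10 (F i) x) (b j y) + l210 W (b j x) (f10 (F i) y) else 0))"
    and "ext_curv \<alpha> (TdT n) w \<in> grade (word_deg sdeg w - 1)"
proof -
  let ?l = "conv_op V W"
  let ?D = "\<lambda>i j w. if i + j = n then ?l [(- 1, mor_elem (F i)), (0, hty_elem (b j))] w
      - ?l [(0, hty_elem (b j)), (- 1, mor_elem (F i))] w else 0"
  have triple: "?l [p, q, r] = 0" if "k < 3" "snd ([p, q, r] ! k) = \<alpha> (TdT n)" for p q r k n
    by (rule conv_op_triple_zero[OF that(1)]) (simp add: that(2) hty)
  have E: "ext_curv \<alpha> (TdT n) w = ?l [(0, hty_elem (b n))] w
      - scW W (of_nat (Suc n)) (mor_elem (F (Suc n)) w)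
      + scW W (- (1 / 2)) (\<Sum>i\<le>N. \<Sum>j\<le>N. ?D i j w)" for w
    unfolding mc_curv_expand[OF ext_scale_vector_space[OF L.vector_space_axioms]]
    by (simp add: ext_scale_def conv_scale_def ops.ext_op_single_dt[OF finite_subset[OF N]]
        ops.ext_op_pair_dt[OF N] ops.ext_op_triple_dt[OF triple] mor hty sum_fun_apply
        if_distrib[of "\<lambda>u. u _"] cong: if_cong del: of_nat_Suc)
  have half: "sc1 W (1 / 2) (h + h) = h" for h
    using W.v1.scale_left_distrib[of 1 1 h] W.v1.scale_scale[of "1/2" 2 h] by simp
  show "ext_curv \<alpha> (TdT n) [Hom0 x] =
      (l1 W (b n x) - sc0 W (of_nat (Suc n)) (f10 (F (Suc n)) x), 0)"
    by (simp add: E conv_op_elem_single conv_op_elem_pair prod_eq_iff cong: if_cong del: of_nat_Suc)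
  show "ext_curv \<alpha> (TdT n) [Hom1 h] =
      (0, b n (l1 V h) - sc1 W (of_nat (Suc n)) (f11 (F (Suc n)) h))"
    by (simp add: E conv_op_elem_single conv_op_elem_pair prod_eq_iff cong: if_cong del: of_nat_Suc)
  let ?Y = "\<lambda>i j. if i + j = n then l201 W (f10 (F i) x) (b j y) + l210 W (b j x) (f10 (F i) y) else 0"
  have "?D i j [Hom0 x, Hom0 y] = (0, ?Y i j + ?Y i j)" for i j
    by (simp add: conv_op_elem_pair zero_prod_def)
  then have "(\<Sum>i\<le>N. \<Sum>j\<le>N. ?D i j [Hom0 x, Hom0 y]) =
      (0, (\<Sum>i\<le>N. \<Sum>j\<le>N. ?Y i j) + (\<Sum>i\<le>N. \<Sum>j\<le>N. ?Y i j))"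
    by (simp only: prod_eq_iff fst_sum snd_sum sum.distrib fst_conv snd_conv sum.neutral_const)
  then show "ext_curv \<alpha> (TdT n) [Hom0 x, Hom0 y] =
      (0, b n (l200 V x y) - sc1 W (of_nat (Suc n)) (f2 (F (Suc n)) x y) - (\<Sum>i\<le>N. \<Sum>j\<le>N. ?Y i j))"
    by (simp add: E conv_op_elem_single prod_eq_iff half del: of_nat_Suc)
  have g: "?l [(0, hty_elem (b n))] w \<in> grade (word_deg sdeg w - 1)" for n
    using conv_op_graded[of "[(0, hty_elem (b n))]" w] by (simp add: hty_elem_graded)
  have "?l [(- 1, mor_elem (F i)), (0, hty_elem (b j))] w \<in> grade (word_deg sdeg w - 1)"
    "?l [(0, hty_elem (b j)), (- 1, mor_elem (F i))] w \<in> grade (word_deg sdeg w - 1)" for i j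
  proof -
    have "h u \<in> grade (word_deg sdeg u + d)"
      if "(d, h) \<in> {(- 1, mor_elem (F i)), (0, hty_elem (b j))}" for d h and u :: "('a, 'b) hom list"
      using that mor_elem_graded[of "F i" u] by (auto simp: hty_elem_graded)
    then show "?l [(- 1, mor_elem (F i)), (0, hty_elem (b j))] w \<in> grade (word_deg sdeg w - 1)"
      "?l [(0, hty_elem (b j)), (- 1, mor_elem (F i))] w \<in> grade (word_deg sdeg w - 1)"
      using conv_op_graded[of "[(- 1, mor_elem (F i)), (0, hty_elem (b j))]" w]
        conv_op_graded[of "[(0, hty_elem (b j)), (- 1, mor_elem (F i))]" w] by (simp_all add: insert_commute)
  qed
  then show "ext_curv \<alpha> (TdT n) w \<in> grade (word_deg sdeg w - 1)"
    unfolding E using g mor_elem_graded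
    by (intro W.grade_add W.grade_diff W.grade_scale W.grade_sum) (auto intro: W.grade_diff)
qed

lemma ext_curv_dt_zero_iff:
  fixes F :: "nat \<Rightarrow> ('a, 'b, 'c, 'd) inf_mor"
  assumes N: "supp \<alpha> \<subseteq> T ` {..N} \<union> TdT ` {..N}"
    and mor: "\<And>n. \<alpha> (T n) = mor_elem (F n)" and hty: "\<And>n. \<alpha> (TdT n) = hty_elem (b n)"
  shows "ext_curv \<alpha> (TdT n) = 0 \<longleftrightarrow>
    (\<forall>x. sc0 W (of_nat (Suc n)) (f10 (F (Suc n)) x) = l1 W (b n x)) \<and>
    (\<forall>h. sc1 W (of_nat (Suc n)) (f11 (F (Suc n)) h) = b n (l1 V h)) \<and>
    (\<forall>x y. sc1 W (of_nat (Suc n)) (f2 (F (Suc n)) x y) = b n (l200 V x y)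
        - (\<Sum>i\<le>N. \<Sum>j\<le>N. if i + j = n
             then l201 W (f10 (F i) x) (b j y) + l210 W (b j x) (f10 (F i) y) else 0))"
    (is "_ \<longleftrightarrow> ?R")
proof
  note dt = ext_curv_dt[OF assms]
  show ?R if 0: "ext_curv \<alpha> (TdT n) = 0"
    using dt(1)[of n] dt(2)[of n] dt(3)[of n] by (simp add: 0 zero_prod_def algebra_simps del: of_nat_Suc)
  show "ext_curv \<alpha> (TdT n) = 0" if R: ?R
  proof
    fix w
    show "ext_curv \<alpha> (TdT n) w = 0 w"
      by (cases w rule: word_sdeg_le_3_cases)
        (use R dt(1-3) grade_eq_zero[OF dt(4)[of n w]] in \<open>auto simp: zero_prod_def simp del: of_nat_Suc\<close>)
  qed
qed

text \<open>A map of degree $-1$ from the words to $W_0\oplus W_1$ can only be nonzero on words of degree $1$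
  and $2$.\<close>

lemma conv_space_eq_mor_elem:
  assumes "A \<in> conv_space V W (- 1)"
  shows "A = mor_elem \<lparr>f10 = \<lambda>x. fst (A [Hom0 x]), f11 = \<lambda>h. snd (A [Hom1 h]),
    f2 = \<lambda>x y. snd (A [Hom0 x, Hom0 y])\<rparr>"
proof
  fix w
  have A: "A [] = 0" "w \<noteq> [] \<Longrightarrow> A w \<in> grade (word_deg sdeg w - 1)" for w
    using assms by (auto simp: conv_space_def)
  show "A w = mor_elem \<lparr>f10 = \<lambda>x. fst (A [Hom0 x]), f11 = \<lambda>h. snd (A [Hom1 h]),
    f2 = \<lambda>x y. snd (A [Hom0 x, Hom0 y])\<rparr> w" (is "_ = mor_elem ?F w")
  proof (cases "w = []")
    case False
    then show ?thesis
      using A(2)[OF False] mor_elem_graded[of ?F w]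
      by (cases w rule: word_sdeg_le_3_cases) (auto simp: grade_def prod_eq_iff)
  qed (simp add: A)
qed

lemma conv_space_eq_hty_elem:
  assumes "B \<in> conv_space V W 0"
  shows "B = hty_elem (\<lambda>x. snd (B [Hom0 x]))"
    and "Vector_Spaces.linear (sc0 V) (sc1 W) (\<lambda>x. snd (B [Hom0 x]))"
proof -
  have B: "B [] = 0" "w \<noteq> [] \<Longrightarrow> B w \<in> grade (word_deg sdeg w)"
    "Vector_Spaces.linear (sc0 V) (scW W) (\<lambda>x. B ([] @ Hom0 x # []))" for w
    using assms by (simp_all add: conv_space_def del: append_Nil)
  show "B = hty_elem (\<lambda>x. snd (B [Hom0 x]))"
  proof
    fix w
    show "B w = hty_elem (\<lambda>x. snd (B [Hom0 x])) w"
    proof (cases "w = []")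
      case False
      then show ?thesis
        using B(2)[OF False] hty_elem_graded[of "\<lambda>x. snd (B [Hom0 x])" w]
        by (cases w rule: word_sdeg_le_3_cases) (auto simp: grade_def prod_eq_iff)
    qed (simp add: B)
  qed
  show "Vector_Spaces.linear (sc0 V) (sc1 W) (\<lambda>x. snd (B [Hom0 x]))"
    using B(3) W.v1.vector_space_axioms by (simp add: Vector_Spaces.linear_iff)
qed

lemma mor_elem_in_conv_space:
  assumes "Vector_Spaces.linear (sc0 V) (sc0 W) (f10 f)" "Vector_Spaces.linear (sc1 V) (sc1 W) (f11 f)"
    "bilin (sc0 V) (sc0 V) (sc1 W) (f2 f)"
  shows "mor_elem f \<in> conv_space V W (- 1)"
proof -
  note lin = assms[unfolded bilin_def Vector_Spaces.linear_iff]
  have "(u = [] \<and> v = []) \<or> (\<exists>y. u = [] \<and> v = [Hom0 y]) \<or> (\<exists>y. u = [Hom0 y] \<and> v = [])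
      \<or> (\<forall>x. mor_elem f (u @ Hom0 x # v) = 0)" for u v
    by (cases u; cases v; cases "hd u"; cases "hd v"; cases "tl u"; cases "tl v";
       simp add: mor_elem_long)
  note shape = this
  have 1: "Vector_Spaces.linear (sc0 V) (scW W) (\<lambda>x. mor_elem f (u @ Hom0 x # v))" for u v
    unfolding Vector_Spaces.linear_iff using V.v0.vector_space_axioms W.vW.vector_space_axioms
    using shape[of u v] lin by (auto simp: prod_eq_iff)
  have "(u = [] \<and> v = []) \<or> (\<forall>h. mor_elem f (u @ Hom1 h # v) = 0)" for u v
    by (cases u; cases v; cases "hd u"; cases "tl u"; simp add: mor_elem_long)
  note shape = this
  have 2: "Vector_Spaces.linear (sc1 V) (scW W) (\<lambda>h. mor_elem f (u @ Hom1 h # v))" for u v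
    unfolding Vector_Spaces.linear_iff using V.v1.vector_space_axioms W.vW.vector_space_axioms lin
    using shape[of u v] by (auto simp: prod_eq_iff)
  show ?thesis
    using 1 2 mor_elem_graded[of f] by (simp add: conv_space_def)
qed

lemma hty_elem_in_conv_space:
  assumes "Vector_Spaces.linear (sc0 V) (sc1 W) \<theta>"
  shows "hty_elem \<theta> \<in> conv_space V W 0"
proof -
  note lin = assms[unfolded Vector_Spaces.linear_iff]
  have "(u = [] \<and> v = []) \<or> (\<forall>x. hty_elem \<theta> (u @ Hom0 x # v) = (0 :: 'c \<times> 'd))" for u v
    by (cases u; cases v; simp add: hty_elem_long)
  note shape = this
  have 1: "Vector_Spaces.linear (sc0 V) (scW W) (\<lambda>x. hty_elem \<theta> (u @ Hom0 x # v))"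
    for u v :: "('a, 'b) hom list"
    unfolding Vector_Spaces.linear_iff using V.v0.vector_space_axioms W.vW.vector_space_axioms lin
    using shape[of u v] by (auto simp: prod_eq_iff)
  have "hty_elem \<theta> (u @ Hom1 h # v) = (0 :: 'c \<times> 'd)" for u v and h :: 'b
    by (cases u; cases v; simp add: hty_elem_long)
  then have 2: "Vector_Spaces.linear (sc1 V) (scW W) (\<lambda>h. hty_elem \<theta> (u @ Hom1 h # v))" for u v
    unfolding Vector_Spaces.linear_iff using V.v1.vector_space_axioms W.vW.vector_space_axioms by simp
  show ?thesis
    using 1 2 by (simp add: conv_space_def hty_elem_graded)
qed

end

section \<open>Integration along the interval\<close>

text \<open>The coefficient of $t^n\,dt$ is weighted with $\int_0^1t^n\,dt=1/(n+1)$.\<close>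

definition dt_integral ::
    "('k::field_char_0, 'c, 'd::ab_group_add) leib2 \<Rightarrow>
     (mono \<Rightarrow> ('a, 'b, 'c::ab_group_add, 'd) conv) \<Rightarrow> 'a \<Rightarrow> 'd"
  where "dt_integral W \<alpha> x =
    (\<Sum>n | TdT n \<in> supp \<alpha>. sc1 W (1 / of_nat (Suc n)) (snd (\<alpha> (TdT n) [Hom0 x])))"

context leib2_pair
begin

lemma dt_integral_eq:
  assumes N: "supp \<alpha> \<subseteq> T ` {..N} \<union> TdT ` {..N}" and hty: "\<And>n. \<alpha> (TdT n) = hty_elem (b n)"
  shows "dt_integral W \<alpha> x = (\<Sum>n\<le>N. sc1 W (1 / of_nat (Suc n)) (b n x))"
proof -
  have "dt_integral W \<alpha> x =
      (\<Sum>n\<le>N. sc1 W (1 / of_nat (Suc n)) (snd (\<alpha> (TdT n) [Hom0 x])))"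
    unfolding dt_integral_def
    by (rule sum.mono_neutral_left) (use N in \<open>auto simp: supp_def\<close>)
  then show ?thesis by (simp add: hty)
qed

text \<open>The integral runs over coefficients: $\theta=\sum_n\beta_n$ with $\beta_n=b_n/(n+1)$, and
  $f_1(t)=f_1(0)+\sum_nt^{n+1}m_1\beta_n$.\<close>

lemma homotopy_dt_integral:
  assumes \<alpha>: "\<alpha> \<in> MC1 V W"
    and f: "vertex_eval (conv_scale W) 0 \<alpha> = mor_elem f"
    and g: "vertex_eval (conv_scale W) 1 \<alpha> = mor_elem g"
  shows "two_term_homotopy V W f g (dt_integral W \<alpha>)"
proof -
  have fin: "finite (supp \<alpha>)" and sp: "\<And>m. \<alpha> m \<in> conv_space V W (- 1 - mono_deg m)"
    and curv: "ext_curv \<alpha> = 0"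
    using \<alpha> by (auto simp: MC1_iff ext_space_def)
  obtain N where N: "supp \<alpha> \<subseteq> T ` {..N} \<union> TdT ` {..N}" using supp_T_TdT[OF fin] .
  \<comment> \<open>One more than the bound, so that shifting the index of the coefficients of $f(t)$ stays in range.\<close>
  define K where "K = Suc N"
  have K: "supp \<alpha> \<subseteq> T ` {..K} \<union> TdT ` {..K}" using N by (auto simp: K_def)
  define F :: "nat \<Rightarrow> ('a, 'b, 'c, 'd) inf_mor" where "F n = \<lparr>f10 = \<lambda>x. fst (\<alpha> (T n) [Hom0 x]),
    f11 = \<lambda>h. snd (\<alpha> (T n) [Hom1 h]), f2 = \<lambda>x y. snd (\<alpha> (T n) [Hom0 x, Hom0 y])\<rparr>" for n
  define b where "b n = (\<lambda>x. snd (\<alpha> (TdT n) [Hom0 x]))" for n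
  define \<beta> where "\<beta> n x = sc1 W (1 / of_nat (Suc n)) (b n x)" for n x
  define \<theta> where "\<theta> = dt_integral W \<alpha>"
  have mor: "\<alpha> (T n) = mor_elem (F n)" for n
    unfolding F_def using sp[of "T n"] by (intro conv_space_eq_mor_elem) simp
  have hty: "\<alpha> (TdT n) = hty_elem (b n)" and b_lin: "Vector_Spaces.linear (sc0 V) (sc1 W) (b n)" for n
    unfolding b_def using sp[of "TdT n"] by (auto intro: conv_space_eq_hty_elem)
  have high: "\<alpha> (T n) = 0" "\<alpha> (TdT n) = 0" if "n > N" for n
    using that N by (auto simp: supp_def)
  have F_high: "f10 (F n) x = 0" "f11 (F n) h = 0" "f2 (F n) x y = 0" if "n > N" for n x y h
    using high[OF that] by (simp_all add: F_def)
  have b_high: "b n x = 0" if "n > N" for n x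
    using high[OF that] by (simp add: b_def)
  have \<beta>_lin: "Vector_Spaces.linear (sc0 V) (sc1 W) (\<beta> n)" for n
    unfolding \<beta>_def by (intro linearI_scale b_lin)
  have \<theta>: "\<theta> x = (\<Sum>n\<le>N. \<beta> n x)" for x
    unfolding \<theta>_def \<beta>_def by (rule dt_integral_eq[OF N hty])
  have \<theta>': "\<theta> x = (\<Sum>n\<le>M. \<beta> n x)" if "N \<le> M" for x M
    unfolding \<theta> by (rule sum.mono_neutral_left) (use that in \<open>auto simp: \<beta>_def b_high\<close>)
  have inv0: "sc0 W (1 / of_nat (Suc n)) (sc0 W (of_nat (Suc n)) v) = v" for n v
    using of_nat_neq_0[of n] by (simp del: of_nat_Suc)
  have inv1: "sc1 W (1 / of_nat (Suc n)) (sc1 W (of_nat (Suc n)) v) = v"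
     "sc1 W (of_nat (Suc n)) (sc1 W (1 / of_nat (Suc n)) v) = v" for n v
    using of_nat_neq_0[of n] by (simp_all del: of_nat_Suc)
  have b_\<beta>: "b n x = sc1 W (of_nat (Suc n)) (\<beta> n x)" for n x
    by (simp add: \<beta>_def inv1 del: of_nat_Suc)
  let ?Q = "\<lambda>x y i j. l201 W (f10 (F i) x) (b j y) + l210 W (b j x) (f10 (F i) y)"
  have "ext_curv \<alpha> (TdT n) = 0" for n using curv by simp
  note eqs = this[unfolded ext_curv_dt_zero_iff[OF K mor hty]]
  have e1: "f10 (F (Suc n)) x = l1 W (\<beta> n x)" for n x
    using eqs[of n] inv0[of n "f10 (F (Suc n)) x"] by (simp add: \<beta>_def del: of_nat_Suc)
  have e2: "f11 (F (Suc n)) h = \<beta> n (l1 V h)" for n h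
    using eqs[of n] inv1(1)[of n "f11 (F (Suc n)) h"] by (simp add: \<beta>_def del: of_nat_Suc)
  have e3: "f2 (F (Suc n)) x y = \<beta> n (l200 V x y)
      - (\<Sum>i\<le>K. \<Sum>j\<le>K. if i + j = n then sc1 W (1 / of_nat (Suc n)) (?Q x y i j) else 0)" for n x y
  proof -
    have "f2 (F (Suc n)) x y = sc1 W (1 / of_nat (Suc n)) (b n (l200 V x y)
        - (\<Sum>i\<le>K. \<Sum>j\<le>K. if i + j = n then ?Q x y i j else 0))"
      using eqs[of n] inv1(1)[of n "f2 (F (Suc n)) x y"] by (simp del: of_nat_Suc)
    also have "\<dots> = \<beta> n (l200 V x y)
      - (\<Sum>i\<le>K. \<Sum>j\<le>K. sc1 W (1 / of_nat (Suc n)) (if i + j = n then ?Q x y i j else 0))"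
      by (simp only: W.v1.scale_right_diff_distrib W.v1.scale_sum_right \<beta>_def)
    finally show ?thesis by (simp add: if_distrib[of "sc1 W _"] cong: if_cong del: of_nat_Suc)
  qed
  have F0: "mor_elem (F 0) = mor_elem f"
  proof -
    have "mor_elem f = (\<Sum>i\<le>N. conv_scale W (0 ^ i) (\<alpha> (T i)))"
      unfolding f[symmetric] by (rule ops.vertex_eval_sum_T[OF N])
    also have "\<dots> = (\<Sum>i\<in>{0}. conv_scale W (0 ^ i) (\<alpha> (T i)))"
      by (rule sum.mono_neutral_right) (auto simp: power_0_left)
    finally show ?thesis by (simp add: mor)
  qed
  have f0: "f10 (F 0) x = f10 f x" "f11 (F 0) h = f11 f h" "f2 (F 0) x y = f2 f x y" for x y h
    using fun_cong[OF F0, of "[Hom0 x]"] fun_cong[OF F0, of "[Hom1 h]"]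
      fun_cong[OF F0, of "[Hom0 x, Hom0 y]"] by simp_all
  have G: "mor_elem g w = (\<Sum>i\<le>Suc M. mor_elem (F i) w)" if "N \<le> M" for w M
  proof -
    have "mor_elem g = (\<Sum>i\<le>N. conv_scale W (1 ^ i) (\<alpha> (T i)))"
      unfolding g[symmetric] by (rule ops.vertex_eval_sum_T[OF N])
    also have "\<dots> = (\<Sum>i\<le>N. mor_elem (F i))" by (simp add: mor)
    also have "\<dots> = (\<Sum>i\<le>Suc M. mor_elem (F i))"
      by (rule sum.mono_neutral_left) (use that high in \<open>auto simp flip: mor\<close>)
    finally show ?thesis by (simp add: sum_fun_apply)
  qed
  have split: "(\<Sum>i\<le>Suc M. H i) = H 0 + (\<Sum>n\<le>M. H (Suc n))" for H :: "nat \<Rightarrow> 'x::ab_group_add" and M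
    by (rule sum.atMost_Suc_shift)
  have g0: "f10 g x = f10 f x + l1 W (\<theta> x)" for x
  proof -
    have "f10 g x = (\<Sum>i\<le>Suc N. f10 (F i) x)"
      using G[of N "[Hom0 x]"] by (simp add: prod_eq_iff fst_sum del: sum.atMost_Suc)
    also have "\<dots> = f10 f x + (\<Sum>n\<le>N. l1 W (\<beta> n x))" by (simp only: split f0 e1)
    also have "(\<Sum>n\<le>N. l1 W (\<beta> n x)) = l1 W (\<theta> x)"
      unfolding \<theta> by (induction N) simp_all
    finally show ?thesis .
  qed
  have g1: "f11 g h = f11 f h + \<theta> (l1 V h)" for h
  proof -
    have "f11 g h = (\<Sum>i\<le>Suc N. f11 (F i) h)"
      using G[of N "[Hom1 h]"] by (simp add: prod_eq_iff snd_sum del: sum.atMost_Suc)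
    then show ?thesis by (simp only: split f0 e2 \<theta>)
  qed
  have g2: "f2 g x y = f2 f x y + \<theta> (l200 V x y) - l201 W (f10 f x) (\<theta> y) - l210 W (\<theta> x) (f10 g y)" for x y
  proof -
    \<comment> \<open>The largest degree of a product of two polynomials of degree at most $K$.\<close>
    let ?M = "K + K"
    let ?P = "\<lambda>k j. l210 W (\<beta> k x) (l1 W (\<beta> j y))"
    \<comment> \<open>After integration the summand $i=0$ gives the terms with $f_1(0)$; the summands $i=k+1$ give
      the quadratic terms in $\theta$.\<close>
    have "f2 g x y = (\<Sum>i\<le>Suc ?M. f2 (F i) x y)"
      using G[of ?M "[Hom0 x, Hom0 y]"] by (simp add: K_def prod_eq_iff snd_sum del: sum.atMost_Suc)
    also have "\<dots> = f2 f x y + \<theta> (l200 V x y) - (\<Sum>n\<le>?M. \<Sum>i\<le>K. \<Sum>j\<le>K.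
        if i + j = n then sc1 W (1 / of_nat (Suc n)) (?Q x y i j) else 0)"
      using \<theta>'[of ?M "l200 V x y"] by (simp only: split f0 e3 sum_subtractf) (simp add: K_def)
    also have "(\<Sum>n\<le>?M. \<Sum>i\<le>K. \<Sum>j\<le>K. if i + j = n then sc1 W (1 / of_nat (Suc n)) (?Q x y i j) else 0)
        = (\<Sum>i\<le>K. \<Sum>j\<le>K. \<Sum>n\<le>?M. if i + j = n then sc1 W (1 / of_nat (Suc n)) (?Q x y i j) else 0)"
      by (subst sum.swap, rule sum.cong[OF refl], rule sum.swap)
    also have "\<dots> = (\<Sum>i\<le>K. \<Sum>j\<le>K. sc1 W (1 / of_nat (Suc (i + j))) (?Q x y i j))"
      by (intro sum.cong refl) (simp add: sum.delta' del: of_nat_Suc)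
    also have "\<dots> = (\<Sum>i\<le>K. \<Sum>j\<le>N. sc1 W (1 / of_nat (Suc (i + j))) (?Q x y i j))"
      by (intro sum.cong refl sum.mono_neutral_right) (auto simp: K_def b_high simp del: of_nat_Suc)
    also have "\<dots> = (\<Sum>j\<le>N. sc1 W (1 / of_nat (Suc j)) (?Q x y 0 j))
        + (\<Sum>k\<le>N. \<Sum>j\<le>N. sc1 W (1 / of_nat (Suc (Suc k + j))) (?Q x y (Suc k) j))"
      unfolding K_def by (simp only: split add_0)
    also have "(\<Sum>j\<le>N. sc1 W (1 / of_nat (Suc j)) (?Q x y 0 j)) =
        l201 W (f10 f x) (\<theta> y) + l210 W (\<theta> x) (f10 f y)"
    proof -
      have "sc1 W (1 / of_nat (Suc j)) (?Q x y 0 j) = l201 W (f10 f x) (\<beta> j y) + l210 W (\<beta> j x) (f10 f y)" for j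
        by (simp add: f0 \<beta>_def W.v1.scale_right_distrib del: of_nat_Suc)
      moreover have "(\<Sum>j\<le>N. l201 W (f10 f x) (\<beta> j y)) = l201 W (f10 f x) (\<theta> y)"
        unfolding \<theta> by (induction N) simp_all
      moreover have "(\<Sum>j\<le>N. l210 W (\<beta> j x) (f10 f y)) = l210 W (\<theta> x) (f10 f y)"
        unfolding \<theta> by (induction N) simp_all
      ultimately show ?thesis by (simp only: sum.distrib)
    qed
    also have "(\<Sum>k\<le>N. \<Sum>j\<le>N. sc1 W (1 / of_nat (Suc (Suc k + j))) (?Q x y (Suc k) j)) =
        (\<Sum>k\<le>N. \<Sum>j\<le>N. sc1 W (of_nat (Suc j) / of_nat (Suc k + Suc j)) (?P k j + ?P j k))"
    proof (intro sum.cong refl)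
      fix k j
      have "?Q x y (Suc k) j = sc1 W (of_nat (Suc j)) (?P k j + ?P j k)"
        by (simp add: e1 b_\<beta> W.relations W.v1.scale_right_distrib del: of_nat_Suc)
      then show "sc1 W (1 / of_nat (Suc (Suc k + j))) (?Q x y (Suc k) j) =
          sc1 W (of_nat (Suc j) / of_nat (Suc k + Suc j)) (?P k j + ?P j k)"
        by (simp del: of_nat_Suc)
    qed
    also have "\<dots> = (\<Sum>k\<le>N. \<Sum>j\<le>N. ?P k j)"
      by (rule vector_space_char_0.sum_symmetrize[OF vector_space_char_0.intro[OF W.v1.vector_space_axioms]])
    also have "\<dots> = l210 W (\<theta> x) (l1 W (\<theta> y))"
    proof -
      have "(\<Sum>j\<le>N. l210 W u (l1 W (\<beta> j y))) = l210 W u (l1 W (\<theta> y))" for u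
        unfolding \<theta> by (induction N) simp_all
      moreover have "(\<Sum>k\<le>N. l210 W (\<beta> k x) v) = l210 W (\<theta> x) v" for v
        unfolding \<theta> by (induction N) simp_all
      ultimately show ?thesis by simp
    qed
    finally show ?thesis by (simp add: g0 algebra_simps)
  qed
  have "Vector_Spaces.linear (sc0 V) (sc1 W) (\<lambda>x. \<Sum>n\<le>N. \<beta> n x)"
    by (intro linearI_sum \<beta>_lin V.v0.vector_space_axioms W.v1.vector_space_axioms)
  then have "Vector_Spaces.linear (sc0 V) (sc1 W) \<theta>" by (simp add: \<theta>[abs_def])
  then show ?thesis
    unfolding two_term_homotopy_def \<theta>_def[symmetric] by (simp add: g0 g1 g2)
qed

text \<open>For the constant family $b=\theta$ the solution $f(t)$ of the system has degree $2$ in $t$; its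
  coefficients are \<open>f\<close>, \<open>F1\<close> and \<open>F2\<close>.\<close>

lemma homotopy_realization:
  assumes f: "inf_morphism V W f" and h: "two_term_homotopy V W f g \<theta>"
  obtains \<alpha> where "\<alpha> \<in> MC1 V W" "vertex_eval (conv_scale W) 0 \<alpha> = mor_elem f"
    "vertex_eval (conv_scale W) 1 \<alpha> = mor_elem g" "dt_integral W \<alpha> = \<theta>"
proof -
  have \<theta>: "Vector_Spaces.linear (sc0 V) (sc1 W) \<theta>"
    using h by (simp add: two_term_homotopy_def)
  have g: "f10 g x = f10 f x + l1 W (\<theta> x)" "f11 g h = f11 f h + \<theta> (l1 V h)"
      "f2 g x y = f2 f x y + \<theta> (l200 V x y) - l201 W (f10 f x) (\<theta> y) - l210 W (\<theta> x) (f10 g y)"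
    for x y h
  proof -
    have "f10 g x - f10 f x = l1 W (\<theta> x)" "f11 g h - f11 f h = \<theta> (l1 V h)"
      "f2 g x y - f2 f x y = \<theta> (l200 V x y) - l201 W (f10 f x) (\<theta> y) - l210 W (\<theta> x) (f10 g y)"
      using h unfolding two_term_homotopy_def by blast+
    then show "f10 g x = f10 f x + l1 W (\<theta> x)" "f11 g h = f11 f h + \<theta> (l1 V h)"
      "f2 g x y = f2 f x y + \<theta> (l200 V x y) - l201 W (f10 f x) (\<theta> y) - l210 W (\<theta> x) (f10 g y)"
      by (simp_all add: algebra_simps)
  qed
  have \<theta>_simps: "\<theta> (x + y) = \<theta> x + \<theta> y" "\<theta> (sc0 V c x) = sc1 W c (\<theta> x)" for x y c
    using \<theta> by (simp_all add: Vector_Spaces.linear_iff)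
  define F1 :: "('a, 'b, 'c, 'd) inf_mor" where "F1 = \<lparr>f10 = \<lambda>x. l1 W (\<theta> x), f11 = \<lambda>h. \<theta> (l1 V h),
    f2 = \<lambda>x y. \<theta> (l200 V x y) - l201 W (f10 f x) (\<theta> y) - l210 W (\<theta> x) (f10 f y)\<rparr>"
  define F2 :: "('a, 'b, 'c, 'd) inf_mor" where "F2 = \<lparr>f10 = \<lambda>x. 0, f11 = \<lambda>h. 0,
    f2 = \<lambda>x y. - l210 W (\<theta> x) (l1 W (\<theta> y))\<rparr>"
  define Z :: "('a, 'b, 'c, 'd) inf_mor" where "Z = \<lparr>f10 = \<lambda>x. 0, f11 = \<lambda>h. 0, f2 = \<lambda>x y. 0\<rparr>"
  define F where "F n = (if n = 0 then f else if n = 1 then F1 else if n = 2 then F2 else Z)" for n :: nat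
  define b where "b n = (if n = 0 then \<theta> else (\<lambda>x. 0))" for n :: nat
  define \<alpha> :: "mono \<Rightarrow> ('a, 'b, 'c, 'd) conv"
    where "\<alpha> m = (case m of T n \<Rightarrow> mor_elem (F n) | TdT n \<Rightarrow> hty_elem (b n))" for m
  have mor: "\<alpha> (T n) = mor_elem (F n)" and hty: "\<alpha> (TdT n) = hty_elem (b n)" for n
    by (simp_all add: \<alpha>_def)
  have "mor_elem Z w = 0" for w
    by (cases "(Z, w)" rule: mor_elem.cases) (auto simp: Z_def zero_prod_def)
  moreover have "hty_elem (\<lambda>x. 0) w = (0 :: 'c \<times> 'd)" for w :: "('a, 'b) hom list"
    by (cases "(\<lambda>x :: 'a. 0 :: 'd, w)" rule: hty_elem.cases) (auto simp: zero_prod_def)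
  ultimately have zero: "mor_elem Z = 0" "(hty_elem (\<lambda>x. 0) :: ('a, 'b, 'c, 'd) conv) = 0"
    by (simp_all add: fun_eq_iff)
  have N: "supp \<alpha> \<subseteq> T ` {..2} \<union> TdT ` {..2}"
  proof
    fix m assume "m \<in> supp \<alpha>"
    then show "m \<in> T ` {..2} \<union> TdT ` {..2}"
      by (cases m) (auto simp: supp_def mor hty F_def b_def zero split: if_splits)
  qed
  have fin: "finite (supp \<alpha>)" by (rule finite_subset[OF N]) simp
  have f_lin: "Vector_Spaces.linear (sc0 V) (sc0 W) (f10 f)"
    "Vector_Spaces.linear (sc1 V) (sc1 W) (f11 f)" "bilin (sc0 V) (sc0 V) (sc1 W) (f2 f)"
    using f by (simp_all add: inf_morphism_def)
  note vs = V.v0.vector_space_axioms V.v1.vector_space_axioms W.v0.vector_space_axioms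
    W.v1.vector_space_axioms
  have F_space: "mor_elem (F n) \<in> conv_space V W (- 1)" for n
  proof (rule mor_elem_in_conv_space)
    show "Vector_Spaces.linear (sc0 V) (sc0 W) (f10 (F n))"
      using f_lin(1) by (simp add: Vector_Spaces.linear_iff vs F_def F1_def F2_def Z_def \<theta>_simps)
    show "Vector_Spaces.linear (sc1 V) (sc1 W) (f11 (F n))"
      using f_lin(2) by (simp add: Vector_Spaces.linear_iff vs F_def F1_def F2_def Z_def \<theta>_simps)
    show "bilin (sc0 V) (sc0 V) (sc1 W) (f2 (F n))"
      using f_lin by (simp add: bilin_def Vector_Spaces.linear_iff vs F_def F1_def F2_def Z_def
        \<theta>_simps algebra_simps W.v1.scale_right_diff_distrib W.v1.scale_right_distrib)
  qed
  have b_space: "hty_elem (b n) \<in> conv_space V W 0" for n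
    using \<theta> by (intro hty_elem_in_conv_space) (simp add: b_def Vector_Spaces.linear_iff vs)
  have space: "\<alpha> \<in> ext_space (conv_space V W) (- 1)"
    unfolding ext_space_def
  proof (intro CollectI conjI allI fin)
    fix m show "\<alpha> m \<in> conv_space V W (- 1 - mono_deg m)"
      by (cases m) (simp_all add: mor hty F_space b_space)
  qed
  \<comment> \<open>The value of $f(t)$ at $t=c$, written as the transport of $f$ along $c\theta$.\<close>
  define G where "G c = \<lparr>f10 = \<lambda>x. f10 f x + l1 W (sc1 W c (\<theta> x)),
    f11 = \<lambda>h. f11 f h + sc1 W c (\<theta> (l1 V h)),
    f2 = \<lambda>x y. f2 f x y + sc1 W c (\<theta> (l200 V x y)) - l201 W (f10 f x) (sc1 W c (\<theta> y))
      - l210 W (sc1 W c (\<theta> x)) (f10 f y + l1 W (sc1 W c (\<theta> y)))\<rparr>" for c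
  have "inf_morphism V W (G c)" for c
    by (rule transport_inf_morphism[OF f linearI_scale[OF \<theta>, of c]]) (simp_all add: G_def)
  note curv_G = curv_mor_elem[OF this]
  have ev: "vertex_eval (conv_scale W) c \<alpha> = mor_elem (G c)" for c
  proof -
    have "vertex_eval (conv_scale W) c \<alpha> = (\<Sum>i\<le>2. conv_scale W (c ^ i) (\<alpha> (T i)))"
      by (rule ops.vertex_eval_sum_T[OF N])
    also have "\<dots> = conv_scale W 1 (mor_elem f) + conv_scale W c (mor_elem F1) + conv_scale W (c * c) (mor_elem F2)"
      by (simp add: numeral_2_eq_2 mor F_def)
    also have "\<dots> = mor_elem (G c)"
    proof
      fix w
      show "(conv_scale W 1 (mor_elem f) + conv_scale W c (mor_elem F1) + conv_scale W (c * c) (mor_elem F2)) w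
          = mor_elem (G c) w"
        by (cases "(f, w)" rule: mor_elem.cases)
          (auto simp: conv_scale_def G_def F1_def F2_def prod_eq_iff W.v1.scale_right_diff_distrib)
    qed
    finally show ?thesis .
  qed
  have "ext_curv \<alpha> (T n) = 0" for n
  proof (rule ops.T_coeff_zero_if_vertex_evals_zero)
    show "finite (supp (ext_curv \<alpha>))"
      unfolding mc_curv_def
      by (intro ops.finite_supp_sum ops.finite_supp_scale ops.finite_supp_ext_op)
    show "vertex_eval (conv_scale W) c (ext_curv \<alpha>) = 0" for c
      by (simp only: ops.vertex_eval_mc_curv[OF fin] ev curv_G)
  qed
  moreover have "ext_curv \<alpha> (TdT n) = 0" for n
  proof -
    have two: "sc1 W 2 u = u + u" for u
      using W.v1.scale_left_distrib[of 1 1 u] by simp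
    consider "n = 0" | "n = 1" | "n = 2" | "n \<ge> 3" by linarith
    then show ?thesis
      unfolding ext_curv_dt_zero_iff[OF N mor hty]
      by cases (auto simp: F_def b_def F1_def F2_def Z_def numeral_2_eq_2 W.relations two)
  qed
  ultimately have "ext_curv \<alpha> m = 0" for m by (cases m) simp_all
  then have "ext_curv \<alpha> = 0" by (simp add: fun_eq_iff)
  then have "\<alpha> \<in> MC1 V W" using space by (simp add: MC1_iff)
  moreover have "mor_elem (G 0) w = mor_elem f w" "mor_elem (G 1) w = mor_elem g w" for w
    by (cases "(f, w)" rule: mor_elem.cases; simp add: G_def g)+
  then have "mor_elem (G 0) = mor_elem f" "mor_elem (G 1) = mor_elem g" by (simp_all add: fun_eq_iff)
  moreover have "dt_integral W \<alpha> x = \<theta> x" for x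
    unfolding dt_integral_eq[OF N hty] by (simp add: b_def numeral_2_eq_2)
  ultimately show thesis using that[of \<alpha>] ev by (simp add: fun_eq_iff)
qed

end

theorem theorem5p5p5:
  shows "\<exists>S :: nat \<Rightarrow>
      ('k::field_char_0, 'a::ab_group_add, 'b::ab_group_add, 'c::ab_group_add, 'd::ab_group_add,
       mono \<Rightarrow> ('a, 'b, 'c, 'd) conv) homotopy \<Rightarrow>
      ('k, 'a, 'b, 'c, 'd, 'a \<Rightarrow> 'd) homotopy.
    \<forall>i\<in>{0, 1}.
      S i ` inf_homotopies = two_term_homotopies \<and>
      (\<forall>V W f g \<alpha>. (V, W, f, g, \<alpha>) \<in> inf_homotopies \<longrightarrow>
         (\<exists>\<theta>. S i (V, W, f, g, \<alpha>) = (V, W, f, g, \<theta>)))"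
proof -
  let ?S = "\<lambda>(V, W, f, g, \<alpha>). (V, W, f, g, dt_integral W \<alpha>)
    :: ('k, 'a, 'b, 'c, 'd, 'a \<Rightarrow> 'd) homotopy"
  have pair: "leib2_pair V W" if "leib2_algebra V" "leib2_algebra W"
    for V :: "('k, 'a, 'b) leib2" and W :: "('k, 'c, 'd) leib2"
    using that by (simp add: leib2_pair_def leib2_alg_def)
  have into: "?S p \<in> two_term_homotopies" if "p \<in> inf_homotopies" for p
    using that by (auto simp: inf_homotopies_def two_term_homotopies_def
      intro!: leib2_pair.homotopy_dt_integral pair)
  have "q \<in> ?S ` inf_homotopies" if "q \<in> two_term_homotopies" for q
  proof -
    obtain V W f g \<theta> where q: "q = (V, W, f, g, \<theta>)" by (metis surj_pair)
    have alg: "leib2_algebra V" "leib2_algebra W" "inf_morphism V W f" "inf_morphism V W g"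
      and \<theta>: "two_term_homotopy V W f g \<theta>"
      using that by (auto simp: q two_term_homotopies_def)
    obtain \<alpha> where "\<alpha> \<in> MC1 V W" "vertex_eval (conv_scale W) 0 \<alpha> = mor_elem f"
      "vertex_eval (conv_scale W) 1 \<alpha> = mor_elem g" "dt_integral W \<alpha> = \<theta>"
      using leib2_pair.homotopy_realization[OF pair[OF alg(1,2)] alg(3) \<theta>] .
    then have "(V, W, f, g, \<alpha>) \<in> inf_homotopies" "q = ?S (V, W, f, g, \<alpha>)"
      using alg by (simp_all add: inf_homotopies_def q)
    then show ?thesis by (rule rev_image_eqI)
  qed
  then have "?S ` inf_homotopies = two_term_homotopies" using into by blast
  then show ?thesis by (intro exI[of _ "\<lambda>_. ?S"]) simp
qed

end
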